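(* Let $H$ be a Hilbert space and let $(x_j)$ be a finite family in $B(H)$. If the $x_j$'s are all unitary operators, then any (rectangular or square) matrix valued polynomial $P$ in $(x_j,x_j^* )$ with norm $\|P\|<1$ can be written as a finite product $P=P_1P_2\cdots P_m$ of (rectangular or square) matrix valued polynomials in $(x_j,x_j^* )$ of degree at most $1$ with $\|P_\ell\|<1$ for all $1\le \ell\le m$.
   Context: $B(H)$ is the algebra of all bounded operators on $H$, with unit denoted $1$. A monomial in $(x_j,x_j^* )$ is a product (in $B(H)$) of terms among the collection $\{1,x_j,x_j^*\}$; if the product has at most $d$ terms, the monomial has degree at most $d$. A polynomial in $(x_j,x_j^* )$ (resp. of degree at most $d$) is a linear combination of monomials (resp. of monomials of degree at most $d$); it is thus an element of $B(H)$. A (rectangular or square) matrix valued polynomial in $(x_j,x_j^* )$ (resp. of degree at most $d$) is a (rectangular or square) matrix with entries that are polynomials in $(x_j,x_j^* )$ (resp. of degree at most $d$). The norm of an $n\times m$ matrix valued polynomial is the operator norm, i.e. the norm of the associated matrix in $M_{n,m}(B(H))$, viewed as an operator from the Hilbert space direct sum $H^{\oplus m}$ to $H^{\oplus n}$. The sizes of the factors $P_\ell$ may vary (so that the product makes sense), and the product is the matrix product with entries multiplied in $B(H)$. *)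

theory Defs
  imports "HOL-Analysis.L2_Norm" "Jordan_Normal_Form.Matrix"
begin

section \<open>Complex Hilbert spaces\<close>

class scaleC =
  fixes scaleC :: "complex \<Rightarrow> 'a \<Rightarrow> 'a"  (infixr \<open>*\<^sub>C\<close> 75)

class complex_vector = scaleC + ab_group_add +
  assumes scaleC_add_right: "a *\<^sub>C (x + y) = a *\<^sub>C x + a *\<^sub>C y"
    and scaleC_add_left: "(a + b) *\<^sub>C x = a *\<^sub>C x + b *\<^sub>C x"
    and scaleC_scaleC: "a *\<^sub>C (b *\<^sub>C x) = (a * b) *\<^sub>C x"
    and scaleC_one: "1 *\<^sub>C x = x"

global_interpretation complex_vector: vector_space "scaleC :: complex \<Rightarrow> 'a \<Rightarrow> 'a::complex_vector"
  defines cspan = complex_vector.span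
  by unfold_locales
    (simp_all add: scaleC_add_right scaleC_add_left scaleC_scaleC scaleC_one)

text \<open>The inner product is linear in its second argument.\<close>

class chilbert_space = banach + complex_vector +
  fixes cinner :: "'a \<Rightarrow> 'a \<Rightarrow> complex"
  assumes scaleR_scaleC: "r *\<^sub>R x = complex_of_real r *\<^sub>C x"
    and cinner_commute: "cinner x y = cnj (cinner y x)"
    and cinner_add_right: "cinner x (y + z) = cinner x y + cinner x z"
    and cinner_scaleC_right: "cinner x (c *\<^sub>C y) = c * cinner x y"
    and cinner_self: "cinner x x = complex_of_real ((norm x)\<^sup>2)"

lemma cinner_add_left: "cinner (x + y) z = cinner x z + cinner y z"
  by (metis cinner_add_right cinner_commute complex_cnj_add)

lemma cinner_scaleC_left: "cinner (c *\<^sub>C x) y = cnj c * cinner x y"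
  by (metis cinner_commute cinner_scaleC_right complex_cnj_mult)

lemma cinner_zero_right [simp]: "cinner x 0 = 0"
  using cinner_add_right[of x 0 0] by simp

lemma cinner_zero_left [simp]: "cinner 0 x = 0"
  using cinner_add_left[of 0 0 x] by simp

lemma cinner_minus_right: "cinner x (- y) = - cinner x y"
  by (rule minus_unique[symmetric]) (simp add: cinner_add_right[symmetric])

lemma cinner_minus_left: "cinner (- x) y = - cinner x y"
  by (rule minus_unique[symmetric]) (simp add: cinner_add_left[symmetric])

lemma cinner_diff_right: "cinner x (y - z) = cinner x y - cinner x z"
  using cinner_add_right[of x y "- z"] by (simp add: cinner_minus_right)

lemma cinner_diff_left: "cinner (x - y) z = cinner x z - cinner y z"
  using cinner_add_left[of x "- y" z] by (simp add: cinner_minus_left)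

lemma norm_add_sq:
  fixes x y :: "'a::chilbert_space"
  shows "(norm (x + y))\<^sup>2 = (norm x)\<^sup>2 + 2 * Re (cinner x y) + (norm y)\<^sup>2"
proof -
  have "complex_of_real ((norm (x + y))\<^sup>2) =
      complex_of_real ((norm x)\<^sup>2) + (cinner x y + cnj (cinner x y)) + complex_of_real ((norm y)\<^sup>2)"
    unfolding cinner_self[symmetric]
    using cinner_commute[of y x] by (simp add: cinner_add_left cinner_add_right)
  also have "\<dots> = complex_of_real ((norm x)\<^sup>2 + 2 * Re (cinner x y) + (norm y)\<^sup>2)"
    by (simp add: complex_add_cnj)
  finally show ?thesis unfolding of_real_eq_iff .
qed

lemma norm_scaleC: "norm (c *\<^sub>C x) = cmod c * norm (x::'a::chilbert_space)"
proof -
  have "complex_of_real ((norm (c *\<^sub>C x))\<^sup>2) = (c * cnj c) * complex_of_real ((norm x)\<^sup>2)"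
    unfolding cinner_self[symmetric] by (simp add: cinner_scaleC_left cinner_scaleC_right)
  also have "\<dots> = complex_of_real ((cmod c * norm x)\<^sup>2)"
    unfolding complex_norm_square[symmetric] by (simp add: power_mult_distrib)
  finally have "(norm (c *\<^sub>C x))\<^sup>2 = (cmod c * norm x)\<^sup>2" unfolding of_real_eq_iff .
  then show ?thesis by (simp add: power2_eq_iff_nonneg)
qed

lemma parallelogram:
  fixes x y :: "'a::chilbert_space"
  shows "(norm (x - y))\<^sup>2 = 2 * (norm x)\<^sup>2 + 2 * (norm y)\<^sup>2 - (norm (x + y))\<^sup>2"
  using norm_add_sq[of x y] norm_add_sq[of x "- y"] by (simp add: cinner_minus_right)

lemma norm_add_scaleC_opt:
  fixes x w :: "'a::chilbert_space"
  assumes "\<And>c. norm x \<le> norm (x + c *\<^sub>C w)"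
  shows "cinner x w = 0"
proof (cases "w = 0")
  case False
  define c where "c = - cnj (cinner x w) / complex_of_real ((norm w)\<^sup>2)"
  have w: "(norm w)\<^sup>2 > 0" using False by simp
  have "(norm x)\<^sup>2 \<le> (norm (x + c *\<^sub>C w))\<^sup>2" by (simp add: assms power_mono)
  then have le: "0 \<le> 2 * Re (c * cinner x w) + (cmod c)\<^sup>2 * (norm w)\<^sup>2"
    by (simp add: norm_add_sq cinner_scaleC_right norm_scaleC power_mult_distrib)
  have "c * cinner x w = complex_of_real (- ((cmod (cinner x w))\<^sup>2 / (norm w)\<^sup>2))"
    unfolding c_def of_real_minus of_real_divide complex_norm_square by (simp add: mult.commute)
  then have 1: "Re (c * cinner x w) = - ((cmod (cinner x w))\<^sup>2 / (norm w)\<^sup>2)"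
    by (metis Re_complex_of_real)
  have "cmod c = cmod (cinner x w) / (norm w)\<^sup>2"
    by (simp add: c_def norm_divide norm_power)
  then have 2: "(cmod c)\<^sup>2 * (norm w)\<^sup>2 = (cmod (cinner x w))\<^sup>2 / (norm w)\<^sup>2"
    using w by (simp add: power_divide field_simps power2_eq_square)
  have "(cmod (cinner x w))\<^sup>2 / (norm w)\<^sup>2 \<le> 0" using le unfolding 1 2 by simp
  then have "(cmod (cinner x w))\<^sup>2 \<le> 0" using w by (simp add: divide_le_0_iff)
  then show ?thesis by simp
qed simp

lemma riesz:
  fixes f :: "'a::chilbert_space \<Rightarrow> complex"
  assumes bl: "bounded_linear f" and hom: "\<And>c x. f (c *\<^sub>C x) = c * f x"
  shows "\<exists>y. \<forall>x. f x = cinner y x"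
proof (cases "\<forall>x. f x = 0")
  case True
  then show ?thesis by (intro exI[of _ 0]) simp
next
  case False
  interpret f: bounded_linear f by (rule bl)
  define S where "S = {x. f x = 1}"
  obtain x0 where "f x0 \<noteq> 0" using False by blast
  then have "inverse (f x0) *\<^sub>C x0 \<in> S" by (simp add: S_def hom)
  then have ne: "norm ` S \<noteq> {}" by blast
  have bd: "bdd_below (norm ` S)" by (rule bdd_belowI[of _ 0]) auto
  define d where "d = Inf (norm ` S)"
  have dle: "d \<le> norm x" if "x \<in> S" for x
    unfolding d_def by (rule cInf_lower) (use that bd in auto)
  have d0: "0 \<le> d" unfolding d_def by (rule cInf_greatest[OF ne]) auto
  have "\<exists>x\<in>S. norm x < d + 1 / real (Suc n)" for n
  proof -
    have "Inf (norm ` S) < d + 1 / real (Suc n)" by (simp add: d_def)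
    then show ?thesis using cInf_less_iff[OF ne bd] by auto
  qed
  then obtain u where uS: "\<And>n. u n \<in> S" and u: "\<And>n. norm (u n) < d + 1 / real (Suc n)"
    by metis
  have un: "(\<lambda>n. norm (u n)) \<longlonglongrightarrow> d"
  proof (rule tendsto_sandwich)
    show "(\<lambda>n. d) \<longlonglongrightarrow> d" by simp
    show "(\<lambda>n. d + 1 / real (Suc n)) \<longlonglongrightarrow> d"
      using tendsto_add[OF tendsto_const LIMSEQ_inverse_real_of_nat, of d]
      by (simp add: inverse_eq_divide)
    show "\<forall>\<^sub>F n in sequentially. d \<le> norm (u n)"
      by (simp add: dle uS)
    show "\<forall>\<^sub>F n in sequentially. norm (u n) \<le> d + 1 / real (Suc n)"
      using u less_imp_le by (intro always_eventually) blast
  qed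
  have mid: "2 * d \<le> norm (x + y)" if "x \<in> S" "y \<in> S" for x y
  proof -
    have "(1/2) *\<^sub>R (x + y) \<in> S" using that by (simp add: S_def f.scaleR f.add scaleR_conv_of_real)
    from dle[OF this] show ?thesis by simp
  qed
  have "Cauchy u"
  proof (rule metric_CauchyI)
    fix e :: real assume e: "e > 0"
    have "(\<lambda>n. (norm (u n))\<^sup>2) \<longlonglongrightarrow> d\<^sup>2" by (intro tendsto_intros un)
    then have "\<forall>\<^sub>F n in sequentially. (norm (u n))\<^sup>2 < d\<^sup>2 + e\<^sup>2 / 4"
      by (rule order_tendstoD) (use e in simp)
    then obtain N where N: "\<And>n. n \<ge> N \<Longrightarrow> (norm (u n))\<^sup>2 < d\<^sup>2 + e\<^sup>2 / 4"
      unfolding eventually_sequentially by blast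
    have "dist (u m) (u n) < e" if "m \<ge> N" "n \<ge> N" for m n
    proof -
      have "(2 * d)\<^sup>2 \<le> (norm (u m + u n))\<^sup>2"
        by (rule power_mono) (use mid[OF uS uS] d0 in auto)
      then have "(norm (u m - u n))\<^sup>2 < e\<^sup>2"
        using N[OF that(1)] N[OF that(2)] parallelogram[of "u m" "u n"]
        by (simp add: power_mult_distrib)
      then show ?thesis unfolding dist_norm using e by (simp add: power_less_imp_less_base)
    qed
    then show "\<exists>M. \<forall>m\<ge>M. \<forall>n\<ge>M. dist (u m) (u n) < e" by blast
  qed
  then obtain z where z: "u \<longlonglongrightarrow> z" by (metis Cauchy_convergent convergent_def)
  have "(\<lambda>n. f (u n)) \<longlonglongrightarrow> f z" by (rule f.tendsto[OF z])
  moreover have "(\<lambda>n. f (u n)) = (\<lambda>n. 1)" using uS by (auto simp: S_def)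
  ultimately have fz: "f z = 1" using LIMSEQ_unique tendsto_const by metis
  have nz: "norm z = d" by (rule LIMSEQ_unique[OF tendsto_norm[OF z] un])
  have orth: "cinner z w = 0" if "f w = 0" for w
  proof (rule norm_add_scaleC_opt)
    fix c show "norm z \<le> norm (z + c *\<^sub>C w)"
      unfolding nz by (rule dle) (simp add: S_def f.add hom fz that)
  qed
  have "z \<noteq> 0" using fz f.zero by auto
  define y where "y = complex_of_real (1 / (norm z)\<^sup>2) *\<^sub>C z"
  have "f x = cinner y x" for x
  proof -
    have "cinner z (x - f x *\<^sub>C z) = 0" by (rule orth) (simp add: f.diff hom fz)
    then have "cinner z x = f x * complex_of_real ((norm z)\<^sup>2)"
      by (simp add: cinner_diff_right cinner_scaleC_right cinner_self)
    then show ?thesis using \<open>z \<noteq> 0\<close> by (simp add: y_def cinner_scaleC_left)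
  qed
  then show ?thesis by blast
qed

lemma cmod_cinner_le: "cmod (cinner x y) \<le> norm x * norm (y::'a::chilbert_space)"
proof (cases "x = 0")
  case False
  define a where "a = cinner x y / complex_of_real ((norm x)\<^sup>2)"
  define w where "w = y - a *\<^sub>C x"
  have "cinner x w = 0"
    using False by (simp add: w_def a_def cinner_diff_right cinner_scaleC_right cinner_self)
  then have "cinner (a *\<^sub>C x) w = 0" by (simp add: cinner_scaleC_left)
  then have "(norm (a *\<^sub>C x + w))\<^sup>2 = (norm (a *\<^sub>C x))\<^sup>2 + (norm w)\<^sup>2"
    by (simp add: norm_add_sq)
  then have "(norm (a *\<^sub>C x))\<^sup>2 \<le> (norm y)\<^sup>2" by (simp add: w_def)
  then have "norm (a *\<^sub>C x) \<le> norm y" by (rule power2_le_imp_le) simp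
  moreover have "norm (a *\<^sub>C x) = cmod (cinner x y) / norm x"
    using False by (simp add: norm_scaleC a_def norm_divide norm_mult power2_eq_square)
  ultimately show ?thesis using False by (simp add: divide_le_eq mult.commute)
qed simp

section \<open>Bounded operators\<close>

typedef (overloaded) 'a bop =
  "{f :: 'a::chilbert_space \<Rightarrow> 'a. bounded_linear f \<and> (\<forall>c x. f (c *\<^sub>C x) = c *\<^sub>C f x)}"
  morphisms bop_apply Bop
  by (rule exI[of _ "\<lambda>x. x"]) (simp add: bounded_linear_ident)

setup_lifting type_definition_bop

lemma bop_eqI: "(\<And>x. bop_apply A x = bop_apply B x) \<Longrightarrow> A = B"
  by (metis bop_apply_inject ext)

lemma bounded_linear_bop_apply: "bounded_linear (bop_apply A)"
  and bop_apply_scaleC: "bop_apply A (c *\<^sub>C x) = c *\<^sub>C bop_apply A x"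
  using bop_apply[of A] by auto

lemma bounded_linear_scaleC: "bounded_linear (\<lambda>x::'a::chilbert_space. c *\<^sub>C x)"
  by (rule bounded_linear_intro[of _ "cmod c"])
    (simp_all add: scaleC_add_right scaleR_scaleC scaleC_scaleC norm_scaleC mult.commute)

text \<open>\<open>ring_1\<close> is out of reach, as \<open>1 = 0\<close> on the zero Hilbert space.\<close>

instantiation bop :: (chilbert_space) "{ring, monoid_mult, complex_vector}"
begin

lift_definition zero_bop :: "'a bop" is "\<lambda>_. 0"
  by (simp add: complex_vector.scale_zero_right)
lift_definition one_bop :: "'a bop" is "\<lambda>x. x"
  by (simp add: bounded_linear_ident)
lift_definition plus_bop :: "'a bop \<Rightarrow> 'a bop \<Rightarrow> 'a bop" is "\<lambda>f g x. f x + g x"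
  by (simp add: bounded_linear_add scaleC_add_right)
lift_definition minus_bop :: "'a bop \<Rightarrow> 'a bop \<Rightarrow> 'a bop" is "\<lambda>f g x. f x - g x"
  by (simp add: bounded_linear_sub complex_vector.scale_right_diff_distrib)
lift_definition uminus_bop :: "'a bop \<Rightarrow> 'a bop" is "\<lambda>f x. - f x"
  by (simp add: bounded_linear_minus complex_vector.scale_minus_right)
lift_definition times_bop :: "'a bop \<Rightarrow> 'a bop \<Rightarrow> 'a bop" is "\<lambda>f g x. f (g x)"
  by (simp add: bounded_linear_compose)
lift_definition scaleC_bop :: "complex \<Rightarrow> 'a bop \<Rightarrow> 'a bop" is "\<lambda>c f x. c *\<^sub>C f x"
  by (simp add: bounded_linear_compose[OF bounded_linear_scaleC] scaleC_scaleC mult.commute)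

instance
proof
  fix A B C :: "'a bop" and a b :: complex
  show "A + B + C = A + (B + C)" by transfer (simp add: add.assoc)
  show "A + B = B + A" by transfer (simp add: add.commute)
  show "0 + A = A" by transfer simp
  show "- A + A = 0" by transfer simp
  show "A - B = A + - B" by transfer simp
  show "A * B * C = A * (B * C)" by transfer simp
  show "(A + B) * C = A * C + B * C" by transfer simp
  show "A * (B + C) = A * B + A * C"
    by transfer (blast intro: linear_add bounded_linear.linear)
  show "1 * A = A" "A * 1 = A" by (transfer, simp)+
  show "a *\<^sub>C (A + B) = a *\<^sub>C A + a *\<^sub>C B" by transfer (simp add: scaleC_add_right)
  show "(a + b) *\<^sub>C A = a *\<^sub>C A + b *\<^sub>C A" by transfer (simp add: scaleC_add_left)
  show "a *\<^sub>C (b *\<^sub>C A) = (a * b) *\<^sub>C A" by transfer (simp add: scaleC_scaleC)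
  show "1 *\<^sub>C A = A" by transfer (simp add: scaleC_one)
qed

end

definition adj :: "'a::chilbert_space bop \<Rightarrow> 'a bop" where
  "adj A = (THE B. \<forall>x y. cinner (bop_apply B x) y = cinner x (bop_apply A y))"

lemma adj_unique_ex: "\<exists>!B. \<forall>x y. cinner (bop_apply B x) y = cinner x (bop_apply A y)"
proof (rule ex_ex1I)
  interpret A: bounded_linear "bop_apply A" by (rule bounded_linear_bop_apply)
  obtain K where K: "\<And>x. norm (bop_apply A x) \<le> norm x * K" and K0: "K \<ge> 0"
    using A.nonneg_bounded by blast
  have "\<exists>b. \<forall>y. cinner x (bop_apply A y) = cinner b y" for x
  proof (rule riesz)
    show "bounded_linear (\<lambda>y. cinner x (bop_apply A y))"
    proof (rule bounded_linear_intro[of _ "norm x * K"])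
      fix y
      have "cmod (cinner x (bop_apply A y)) \<le> norm x * norm (bop_apply A y)"
        by (rule cmod_cinner_le)
      also have "\<dots> \<le> norm x * (norm y * K)" by (intro mult_left_mono K) simp
      finally show "cmod (cinner x (bop_apply A y)) \<le> norm y * (norm x * K)"
        by (simp add: mult_ac)
    qed (simp_all add: A.add cinner_add_right A.scaleR scaleR_scaleC bop_apply_scaleC
        cinner_scaleC_right scaleR_conv_of_real)
  qed (simp add: bop_apply_scaleC cinner_scaleC_right)
  then obtain b where b: "\<And>x y. cinner x (bop_apply A y) = cinner (b x) y" by metis
  have eqI: "u = v" if "\<And>y. cinner u y = cinner v y" for u v :: 'a
  proof -
    have "cinner (u - v) (u - v) = 0" using that by (simp add: cinner_diff_left)
    then show ?thesis by (simp add: cinner_self)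
  qed
  have scale: "b (c *\<^sub>C x) = c *\<^sub>C b x" for c x
    by (rule eqI) (simp add: b[symmetric] cinner_scaleC_left)
  have "bounded_linear b"
  proof (rule bounded_linear_intro[of _ K])
    fix x y show "b (x + y) = b x + b y"
      by (rule eqI) (simp add: b[symmetric] cinner_add_left)
  next
    fix r x show "b (r *\<^sub>R x) = r *\<^sub>R b x" by (simp add: scaleR_scaleC scale)
  next
    fix x
    have "cinner (b x) (b x) = cinner x (bop_apply A (b x))" by (simp add: b)
    then have "(norm (b x))\<^sup>2 = cmod (cinner x (bop_apply A (b x)))"
      by (metis abs_norm_cancel cinner_self norm_of_real power2_abs abs_power2)
    also have "\<dots> \<le> norm x * norm (bop_apply A (b x))" by (rule cmod_cinner_le)
    also have "\<dots> \<le> norm x * (norm (b x) * K)" by (intro mult_left_mono K) simp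
    finally have "norm (b x) * norm (b x) \<le> norm (b x) * (norm x * K)"
      by (simp add: power2_eq_square mult_ac)
    then show "norm (b x) \<le> norm x * K"
      using K0 by (cases "b x = 0") (simp_all add: mult_le_cancel_left_pos)
  qed
  then have "bop_apply (Bop b) = b" using scale by (simp add: Bop_inverse)
  then show "\<exists>B. \<forall>x y. cinner (bop_apply B x) y = cinner x (bop_apply A y)"
    using b by (intro exI[of _ "Bop b"]) simp
  fix B C
  assume "\<forall>x y. cinner (bop_apply B x) y = cinner x (bop_apply A y)"
    and "\<forall>x y. cinner (bop_apply C x) y = cinner x (bop_apply A y)"
  then show "B = C" by (intro bop_eqI eqI) simp
qed

lemma cinner_adj_left: "cinner (bop_apply (adj A) x) y = cinner x (bop_apply A y)"
  unfolding adj_def using theI'[OF adj_unique_ex, of A] by blast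

definition unitary_op :: "'a::chilbert_space bop \<Rightarrow> bool" where
  "unitary_op U \<longleftrightarrow> adj U * U = 1 \<and> U * adj U = 1"

section \<open>Matrices of operators\<close>

text \<open>The norm of the Hilbert space direct sum, whose elements are vectors with entries in \<open>H\<close>.\<close>

definition dsum_norm :: "'a::chilbert_space vec \<Rightarrow> real" where
  "dsum_norm v = L2_set (\<lambda>j. norm (v $ j)) {..<dim_vec v}"

definition mat_apply :: "'a::chilbert_space bop mat \<Rightarrow> 'a vec \<Rightarrow> 'a vec" where
  "mat_apply A v = vec (dim_row A) (\<lambda>i. \<Sum>j<dim_col A. bop_apply (A $$ (i, j)) (v $ j))"

definition mat_opnorm :: "'a::chilbert_space bop mat \<Rightarrow> real" where
  "mat_opnorm A =
    (SUP v \<in> {v \<in> carrier_vec (dim_col A). dsum_norm v \<le> 1}. dsum_norm (mat_apply A v))"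

lemma mat_opnorm_bdd_above:
  "bdd_above ((\<lambda>v. dsum_norm (mat_apply A v)) ` {v \<in> carrier_vec (dim_col A). dsum_norm v \<le> 1})"
proof -
  have "\<forall>B::'a bop. \<exists>K\<ge>0. \<forall>x. norm (bop_apply B x) \<le> norm x * K"
    using bounded_linear.nonneg_bounded[OF bounded_linear_bop_apply] by blast
  then obtain K where K0: "\<And>B::'a bop. 0 \<le> K B"
    and K: "\<And>B x. norm (bop_apply B x) \<le> norm x * K (B::'a bop)" by metis
  show ?thesis
  proof (rule bdd_aboveI2)
    fix v :: "'a vec" assume v: "v \<in> {v \<in> carrier_vec (dim_col A). dsum_norm v \<le> 1}"
    have le1: "norm (v $ j) \<le> 1" if "j < dim_col A" for j
    proof -
      have "norm (v $ j) \<le> dsum_norm v"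
        unfolding dsum_norm_def by (rule member_le_L2_set) (use that v in auto)
      then show ?thesis using v by simp
    qed
    have "dim_vec (mat_apply A v) = dim_row A" by (simp add: mat_apply_def)
    then have "dsum_norm (mat_apply A v) \<le> (\<Sum>i<dim_row A. norm (mat_apply A v $ i))"
      unfolding dsum_norm_def by (simp add: L2_set_le_sum)
    also have "\<dots> \<le> (\<Sum>i<dim_row A. \<Sum>j<dim_col A. K (A $$ (i, j)))"
    proof (rule sum_mono)
      fix i assume "i \<in> {..<dim_row A}"
      then have "norm (mat_apply A v $ i) \<le> (\<Sum>j<dim_col A. norm (bop_apply (A $$ (i, j)) (v $ j)))"
        by (simp add: mat_apply_def norm_sum)
      also have "\<dots> \<le> (\<Sum>j<dim_col A. K (A $$ (i, j)))"
      proof (rule sum_mono)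
        fix j assume "j \<in> {..<dim_col A}"
        then have "norm (v $ j) * K (A $$ (i, j)) \<le> K (A $$ (i, j))"
          using le1 K0 by (simp add: mult_left_le_one_le)
        then show "norm (bop_apply (A $$ (i, j)) (v $ j)) \<le> K (A $$ (i, j))"
          using K order_trans by blast
      qed
      finally show "norm (mat_apply A v $ i) \<le> (\<Sum>j<dim_col A. K (A $$ (i, j)))" .
    qed
    finally show "dsum_norm (mat_apply A v) \<le> (\<Sum>i<dim_row A. \<Sum>j<dim_col A. K (A $$ (i, j)))" .
  qed
qed

section \<open>Polynomials in the \<open>x\<^sub>j\<close> and their adjoints\<close>

definition monomials :: "'i set \<Rightarrow> ('i \<Rightarrow> 'a::chilbert_space bop) \<Rightarrow> nat \<Rightarrow> 'a bop set" where
  "monomials J x d =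
    {prod_list w | w. length w \<le> d \<and> set w \<subseteq> {1} \<union> x ` J \<union> (\<lambda>j. adj (x j)) ` J}"

definition polys_deg :: "'i set \<Rightarrow> ('i \<Rightarrow> 'a::chilbert_space bop) \<Rightarrow> nat \<Rightarrow> 'a bop set" where
  "polys_deg J x d = cspan (monomials J x d)"

definition polys :: "'i set \<Rightarrow> ('i \<Rightarrow> 'a::chilbert_space bop) \<Rightarrow> 'a bop set" where
  "polys J x = cspan (\<Union>d. monomials J x d)"

text \<open>Matrices with entries in \<open>S\<close>, of any size at least \<open>1 \<times> 1\<close>.\<close>

definition mats_over :: "'b set \<Rightarrow> 'b mat set" where
  "mats_over S = {A. 0 < dim_row A \<and> 0 < dim_col A \<and> elements_mat A \<subseteq> S}"

text \<open>The library product is total, so the sizes of consecutive factors have to be matched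
  explicitly.\<close>

definition composable :: "'b mat list \<Rightarrow> bool" where
  "composable = successively (\<lambda>A B. dim_col A = dim_row B)"

text \<open>Matrices of varying size have no common unit, hence no \<open>prod_list\<close>; the empty list is
  left unspecified.\<close>

fun mat_prod :: "'b::semiring_0 mat list \<Rightarrow> 'b mat" where
  "mat_prod [A] = A"
| "mat_prod (A # B # As) = A * mat_prod (B # As)"

end

theory Submission
  imports Defs "HOL-Library.Function_Algebras" "HOL-Analysis.Convex"
begin

text \<open>
  A product of contractions is a contraction, so the content of the theorem is that contractive
  polynomials of high degree are not lost.  The proof is a Hahn-Banach argument followed by a
  recycling trick.

  Write \<open>P = p v\<close>, where \<open>v\<close> is the column whose entries are the rows \<open>w e\<^sub>j\<close> (\<open>w\<close> a word in the
  unitaries and their adjoints, \<open>j\<close> a column of \<open>P\<close>) and \<open>p\<close> is a scalar matrix.  After scaling,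
  \<open>P\<close> is a contraction, and a slack \<open>\<epsilon> > 0\<close> is available.

  \<^item> Certificate (\<open>relation_certificate\<close>).  Consider matrices of operators indexed by the pairs
  \<open>(w, j)\<close>, and the scalar matrix \<open>Z = (1 + \<epsilon>) e - p\<^sup>* p\<close>, where \<open>e\<close> is the projection onto the empty
  words.  Modulo the relations "entry \<open>u w\<close> is \<open>u\<close> applied to entry \<open>w\<close>" and "\<open>u\<close> does not
  decrease norms", \<open>Z\<close> has strictly positive real part.  Otherwise \<open>cone_separation\<close> gives a
  positive functional \<open>f\<close> that respects the relations.  The form \<open>(a, b) \<mapsto> f (a\<^sub>s\<^sup>* b\<^sub>t)\<close> is a
  semi-inner product on families of operators; its null space is stable under left multiplication,
  and, exactly as for the multiplicative domain of a completely positive map, unitarity of \<open>u\<close>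
  forces \<open>u\<close> at position \<open>w\<close> and \<open>1\<close> at position \<open>u w\<close> to agree modulo null vectors.  Hence \<open>f\<close>
  cannot distinguish \<open>p\<^sup>* p\<close> from \<open>P\<^sup>* P\<close>, and \<open>f Z \<ge> \<epsilon> f e > 0\<close>, a contradiction.

  \<^item> One step (\<open>recycling_step\<close>).  The certificate is a matrix \<open>X\<close> of degree one with strictly
  positive real part such that \<open>X v = S v\<close> for a Hermitian \<^emph>\<open>scalar\<close> matrix \<open>S\<close>.  For small \<open>\<tau>\<close> the
  matrix \<open>1 - \<tau> X\<close> is a contraction of degree one, and it maps \<open>v\<close> to \<open>(1 - \<tau> S) v\<close>.  The
  definition of \<open>S\<close> then becomes an equality of two Gram matrices, so that
  \<open>gram_eq_imp_contraction\<close> supplies a scalar contraction.  Composing, a product of two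
  contractions of degree one carries \<open>(z, \<surd>(1 + \<epsilon>) 1)\<close> to \<open>(P, z)\<close>, where \<open>z\<close> consists of multiples
  of entries of \<open>v\<close>.

  \<^item> Recycling (\<open>steps_recycle\<close>).  The auxiliary column \<open>z\<close> is returned, so it can be used again:
  \<open>z\<close> and \<open>N\<close> copies of \<open>\<surd>(1 + \<epsilon>) 1\<close> are carried to \<open>N\<close> copies of \<open>P\<close> and \<open>z\<close>.  Averaging the copies
  produces \<open>\<surd>N P\<close>, while the input costs \<open>\<surd>(N (1 + \<epsilon>) + c)\<close> with \<open>c\<close> independent of \<open>N\<close>.  For large
  \<open>N\<close> the loss per copy is as small as desired, and the gap \<open>\<parallel>P\<parallel> < 1\<close> pays for it and for making
  every factor strictly contractive (\<open>steps_factor\<close>).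
\<close>

section \<open>Separation of a point from a convex cone\<close>

definition convex_cone :: "(real \<Rightarrow> 'v::ab_group_add \<Rightarrow> 'v) \<Rightarrow> 'v set \<Rightarrow> bool" where
  "convex_cone scl K \<longleftrightarrow>
    0 \<in> K \<and> (\<forall>a\<in>K. \<forall>b\<in>K. a + b \<in> K) \<and> (\<forall>r\<ge>0. \<forall>a\<in>K. scl r a \<in> K)"

text \<open>A cone that contains one of \<open>y\<close> and \<open>- y\<close> for every \<open>y\<close> is a half space up to closure: the supremum of
the \<open>t\<close> with \<open>y - t e\<close> in the cone is superadditive by convexity and odd by totality, hence linear.\<close>

lemma total_cone_functional:
  fixes scl :: "real \<Rightarrow> 'v::ab_group_add \<Rightarrow> 'v"
  assumes vs: "vector_space scl" and K: "convex_cone scl K" and e: "e \<in> K"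
    and unit: "\<And>y. \<exists>t. scl t e + y \<in> K" and ne: "- e \<notin> K"
    and total: "\<And>y. y \<in> K \<or> - y \<in> K"
  obtains f :: "'v \<Rightarrow> real" where "\<And>y z. f (y + z) = f y + f z" "\<And>r y. f (scl r y) = r * f y"
    "\<And>y. y \<in> K \<Longrightarrow> 0 \<le> f y" "f e = 1"
proof -
  interpret vector_space scl by (rule vs)
  have add: "a + b \<in> K" if "a \<in> K" "b \<in> K" for a b
    using K that by (auto simp: convex_cone_def)
  have scale: "scl r a \<in> K" if "0 \<le> r" "a \<in> K" for r a
    using K that by (auto simp: convex_cone_def)
  have pos: "0 \<le> t" if "scl t e \<in> K" for t
  proof (rule ccontr)
    assume "\<not> 0 \<le> t"
    then have "scl (1 / - t) (scl t e) \<in> K" by (intro scale that) auto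
    then show False using \<open>\<not> 0 \<le> t\<close> ne by simp
  qed
  define L where "L y = {t. y - scl t e \<in> K}" for y
  define f where "f y = Sup (L y)" for y
  have Lne: "L y \<noteq> {}" for y
  proof -
    obtain t where "scl t e + y \<in> K" using unit by blast
    then have "- t \<in> L y" by (simp add: L_def add.commute)
    then show ?thesis by blast
  qed
  have Lbd: "bdd_above (L y)" for y
  proof -
    obtain s where s: "scl s e + - y \<in> K" using unit by blast
    have "t \<le> s" if "t \<in> L y" for t
    proof -
      have "(scl s e + - y) + (y - scl t e) \<in> K" by (rule add[OF s]) (use that in \<open>simp add: L_def\<close>)
      then have "scl (s - t) e \<in> K" by (simp add: scale_left_diff_distrib)
      then show ?thesis using pos by fastforce
    qed
    then show ?thesis by (auto simp: bdd_above_def)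
  qed
  have fI: "t \<le> f y" if "t \<in> L y" for t y
    unfolding f_def by (rule cSup_upper[OF that Lbd])
  have below: "t \<in> L y" if "t < f y" for t y
  proof -
    obtain s where s: "s \<in> L y" "t < s"
      using \<open>t < f y\<close> less_cSup_iff[OF Lne Lbd] unfolding f_def by blast
    have "(y - scl s e) + scl (s - t) e \<in> K"
      by (intro add scale e) (use s in \<open>auto simp: L_def\<close>)
    then show ?thesis by (simp add: L_def scale_left_diff_distrib)
  qed
  have above: "- t \<in> L (- y)" if "f y < t" for t y
  proof -
    have "t \<notin> L y" using fI that by fastforce
    then have "- (y - scl t e) \<in> K" using total[of "y - scl t e"] by (auto simp: L_def)
    then show ?thesis by (simp add: L_def)
  qed
  have regroup: "(y - scl s e) + (z - scl t e) = y + z - scl (s + t) e" for y z s t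
    by (simp add: scale_left_distrib)
  have super: "f y + f z \<le> f (y + z)" for y z
  proof (rule dense_ge)
    fix c assume c: "f (y + z) < c"
    show "f y + f z \<le> c"
    proof (rule ccontr)
      assume "\<not> f y + f z \<le> c"
      then have "c < f y + f z" by simp
      define d where "d = (f y + f z - c) / 2"
      have d: "d > 0" using \<open>c < f y + f z\<close> by (simp add: d_def)
      have "f y - d \<in> L y" "f z - d \<in> L z" using d by (auto intro: below)
      then have "(y - scl (f y - d) e) + (z - scl (f z - d) e) \<in> K"
        unfolding L_def by (intro add) auto
      also have "(y - scl (f y - d) e) + (z - scl (f z - d) e) = y + z - scl ((f y - d) + (f z - d)) e"
        by (rule regroup)
      also have "(f y - d) + (f z - d) = c" by (simp add: d_def field_simps)
      finally have "c \<le> f (y + z)" by (intro fI) (simp add: L_def)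
      then show False using c by simp
    qed
  qed
  have zero_le: "f 0 \<le> 0"
  proof (rule ccontr)
    assume "\<not> f 0 \<le> 0"
    then have "f 0 / 2 \<in> L 0" by (intro below) auto
    then have "scl (- (f 0 / 2)) e \<in> K" by (simp add: L_def scale_minus_left)
    then show False using pos \<open>\<not> f 0 \<le> 0\<close> by fastforce
  qed
  have odd: "f (- y) = - f y" for y
  proof (rule antisym)
    show "f (- y) \<le> - f y" using super[of y "- y"] zero_le by simp
    have "- t \<le> f (- y)" if "f y < t" for t using fI[OF above[OF that]] .
    then show "- f y \<le> f (- y)"
      by (metis dense_ge minus_le_iff)
  qed
  have fadd: "f (y + z) = f y + f z" for y z
    using super[of y z] super[of "- y" "- z"] odd[of y] odd[of z] odd[of "y + z"] by simp
  have f0: "f 0 = 0" using fadd[of 0 0] by simp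
  have fscale_ge: "r * f y \<le> f (scl r y)" if r: "r > 0" for r y
  proof (rule dense_le)
    fix c assume "c < r * f y"
    then have "c / r < f y" using r by (simp add: divide_less_eq mult.commute)
    then have "scl r (y - scl (c / r) e) \<in> K"
      using scale r below[of "c / r" y] by (auto simp: L_def)
    then show "c \<le> f (scl r y)" using r by (intro fI) (simp add: L_def scale_right_diff_distrib)
  qed
  have fscale_pos: "f (scl r y) = r * f y" if "r > 0" for r y
    using fscale_ge[OF that, of y] fscale_ge[OF that, of "- y"] by (simp add: odd)
  have fscale: "f (scl r y) = r * f y" for r y
  proof (cases r "0 :: real" rule: linorder_cases)
    case less
    then have "f (scl (- r) y) = - r * f y" by (intro fscale_pos) simp
    then show ?thesis by (simp add: odd)
  qed (simp_all add: f0 fscale_pos)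
  have "f y \<ge> 0" if "y \<in> K" for y by (rule fI) (use that in \<open>simp add: L_def\<close>)
  moreover have "f e = 1"
  proof (rule antisym)
    show "1 \<le> f e" by (rule fI) (use K in \<open>simp add: L_def convex_cone_def\<close>)
    show "f e \<le> 1"
    proof (rule ccontr)
      assume "\<not> f e \<le> 1"
      then have "(1 + f e) / 2 \<in> L e" by (intro below) simp
      then have "scl (1 - (1 + f e) / 2) e \<in> K" by (simp add: L_def scale_left_diff_distrib)
      from pos[OF this] show False using \<open>\<not> f e \<le> 1\<close> by simp
    qed
  qed
  ultimately show thesis using that fadd fscale by blast
qed

text \<open>Hahn-Banach in a form without topology: the order unit \<open>e\<close> replaces an interior point.  Adjoin
\<open>- y0\<close> to the cone; as no \<open>y0 - d e\<close> lies in \<open>C\<close>, this does not capture \<open>- e\<close>.  A maximal cone that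
avoids \<open>- e\<close> is total, because otherwise adjoining \<open>z\<close> and adjoining \<open>- z\<close> would both
capture \<open>- e\<close>, and a positive combination of the two witnesses eliminates \<open>z\<close>.\<close>

lemma cone_separation:
  fixes scl :: "real \<Rightarrow> 'v::ab_group_add \<Rightarrow> 'v"
  assumes vs: "vector_space scl" and C: "convex_cone scl C" and e: "e \<in> C"
    and unit: "\<And>y. \<exists>t. scl t e + y \<in> C"
    and out: "\<And>d. d > 0 \<Longrightarrow> y0 - scl d e \<notin> C"
  obtains f :: "'v \<Rightarrow> real" where "\<And>y z. f (y + z) = f y + f z" "\<And>r y. f (scl r y) = r * f y"
    "\<And>y. y \<in> C \<Longrightarrow> 0 \<le> f y" "f e = 1" "f y0 \<le> 0"
proof -
  interpret vector_space scl by (rule vs)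
  have Cadd: "a + b \<in> C" if "a \<in> C" "b \<in> C" for a b
    using C that by (auto simp: convex_cone_def)
  have Cscale: "scl r a \<in> C" if "0 \<le> r" "a \<in> C" for r a
    using C that by (auto simp: convex_cone_def)
  have adjoin: "convex_cone scl {c + scl r z | c r. c \<in> K \<and> 0 \<le> r}" if "convex_cone scl K" for K z
    unfolding convex_cone_def
  proof (intro conjI ballI allI impI)
    show "0 \<in> {c + scl r z | c r. c \<in> K \<and> 0 \<le> r}"
      using that by (auto simp: convex_cone_def intro!: exI[of _ 0])
  next
    fix a b assume "a \<in> {c + scl r z | c r. c \<in> K \<and> 0 \<le> r}" "b \<in> {c + scl r z | c r. c \<in> K \<and> 0 \<le> r}"
    then obtain c r c' r' where "a = c + scl r z" "b = c' + scl r' z" "c \<in> K" "c' \<in> K" "0 \<le> r" "0 \<le> r'"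
      by blast
    then show "a + b \<in> {c + scl r z | c r. c \<in> K \<and> 0 \<le> r}" using that
      by (intro CollectI exI[of _ "c + c'"] exI[of _ "r + r'"])
        (auto simp: convex_cone_def scale_left_distrib)
  next
    fix s a assume "0 \<le> (s::real)" "a \<in> {c + scl r z | c r. c \<in> K \<and> 0 \<le> r}"
    then obtain c r where "a = c + scl r z" "c \<in> K" "0 \<le> r" by blast
    then show "scl s a \<in> {c + scl r z | c r. c \<in> K \<and> 0 \<le> r}" using that \<open>0 \<le> s\<close>
      by (intro CollectI exI[of _ "scl s c"] exI[of _ "s * r"])
        (auto simp: convex_cone_def scale_right_distrib)
  qed
  define C1 where "C1 = {c + scl r (- y0) | c r. c \<in> C \<and> 0 \<le> r}"
  have C1: "convex_cone scl C1" unfolding C1_def by (rule adjoin[OF C])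
  have neC: "- e \<notin> C"
  proof
    assume me: "- e \<in> C"
    obtain t where t: "scl t e + y0 \<in> C" using unit by blast
    have "scl (max 0 t + 1) (- e) \<in> C" using me by (intro Cscale) auto
    moreover have "scl (max 0 t - t) e \<in> C" using e by (intro Cscale) auto
    ultimately have "(scl t e + y0) + (scl (max 0 t - t) e + scl (max 0 t + 1) (- e)) \<in> C"
      by (intro Cadd t)
    then have "y0 - scl 1 e \<in> C"
      by (simp add: scale_left_diff_distrib scale_left_distrib algebra_simps)
    then show False using out[of 1] by simp
  qed
  have ne1: "- e \<notin> C1"
  proof
    assume "- e \<in> C1"
    then obtain c r where cr: "- e = c + scl r (- y0)" "c \<in> C" "0 \<le> r" by (auto simp: C1_def)
    show False
    proof (cases "r = 0")
      case True then show False using cr neC by simp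
    next
      case False
      then have "scl (1 / r) c \<in> C" using cr by (intro Cscale) auto
      also have "c = scl r y0 - e" using cr(1) by (simp add: algebra_simps)
      also have "scl (1 / r) (scl r y0 - e) = y0 - scl (1 / r) e"
        using False by (simp add: scale_right_diff_distrib)
      finally show False using out[of "1 / r"] False cr(3) by simp
    qed
  qed
  define \<A> where "\<A> = {K. convex_cone scl K \<and> C1 \<subseteq> K \<and> - e \<notin> K}"
  have "\<exists>M\<in>\<A>. \<forall>X\<in>\<A>. M \<subseteq> X \<longrightarrow> X = M"
  proof (rule subset_Zorn_nonempty)
    show "\<A> \<noteq> {}" using C1 ne1 by (auto simp: \<A>_def)
  next
    fix \<C> assume ne: "\<C> \<noteq> {}" and ch: "subset.chain \<A> \<C>"
    have sub: "\<C> \<subseteq> \<A>" using ch by (simp add: subset.chain_def)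
    have cone: "convex_cone scl K" if "K \<in> \<C>" for K using sub that by (auto simp: \<A>_def)
    have "convex_cone scl (\<Union>\<C>)"
      unfolding convex_cone_def
    proof (intro conjI ballI allI impI)
      show "0 \<in> \<Union>\<C>" using ne cone by (auto simp: convex_cone_def)
    next
      fix a b assume "a \<in> \<Union>\<C>" "b \<in> \<Union>\<C>"
      then obtain A B where AB: "A \<in> \<C>" "B \<in> \<C>" "a \<in> A" "b \<in> B" by blast
      have "A \<subseteq> B \<or> B \<subseteq> A" using ch AB by (auto simp: subset.chain_def)
      then have "a + b \<in> A \<or> a + b \<in> B"
        using AB cone[of A] cone[of B] unfolding convex_cone_def by blast
      then show "a + b \<in> \<Union>\<C>" using AB by blast
    next
      fix r a assume "0 \<le> (r::real)" "a \<in> \<Union>\<C>"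
      then show "scl r a \<in> \<Union>\<C>" using cone unfolding convex_cone_def by (meson UnionE UnionI)
    qed
    then show "\<Union>\<C> \<in> \<A>" using sub ne by (auto simp: \<A>_def)
  qed
  then obtain K where K: "K \<in> \<A>" and maxK: "\<And>X. X \<in> \<A> \<Longrightarrow> K \<subseteq> X \<Longrightarrow> X = K" by blast
  have Kc: "convex_cone scl K" and CK: "C1 \<subseteq> K" and neK: "- e \<notin> K" using K by (auto simp: \<A>_def)
  have dep: "\<exists>c r. - e = c + scl r z \<and> c \<in> K \<and> 0 < r" if "z \<notin> K" for z
  proof -
    let ?X = "{c + scl r z | c r. c \<in> K \<and> 0 \<le> r}"
    have KX: "K \<subseteq> ?X"
    proof
      fix c assume "c \<in> K"
      then show "c \<in> ?X" by (intro CollectI exI[of _ c] exI[of _ 0]) simp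
    qed
    have "0 \<in> K" using Kc by (simp add: convex_cone_def)
    then have "z \<in> ?X" by (intro CollectI exI[of _ 0] exI[of _ 1]) simp
    then have "?X \<notin> \<A>" using maxK[OF _ KX] that by blast
    then have "- e \<in> ?X" using adjoin[OF Kc, of z] CK KX by (auto simp: \<A>_def)
    then obtain c r where "- e = c + scl r z" "c \<in> K" "0 \<le> r" by blast
    then show ?thesis using neK by (cases "r = 0") (auto intro!: exI[of _ c] exI[of _ r])
  qed
  have total: "z \<in> K \<or> - z \<in> K" for z
  proof (rule ccontr)
    assume "\<not> (z \<in> K \<or> - z \<in> K)"
    then obtain c r c' r' where 1: "- e = c + scl r z" "c \<in> K" "0 < r"
      and 2: "- e = c' + scl r' (- z)" "c' \<in> K" "0 < r'"
      using dep[of z] dep[of "- z"] by blast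
    have "scl r' (- e) + scl r (- e) = scl r' (c + scl r z) + scl r (c' + scl r' (- z))"
      using 1(1) 2(1) by metis
    also have "\<dots> = scl r' c + scl r c'"
      by (simp add: scale_right_distrib scale_right_diff_distrib mult.commute)
    also have "\<dots> \<in> K" using Kc 1 2 by (auto simp: convex_cone_def)
    finally have "scl (r' + r) (- e) \<in> K" by (simp add: scale_left_distrib)
    moreover have "0 \<le> 1 / (r' + r)" "1 / (r' + r) * (r' + r) = 1" using 1(3) 2(3) by auto
    ultimately have "scl (1 / (r' + r) * (r' + r)) (- e) \<in> K"
      using Kc unfolding convex_cone_def scale_scale[symmetric] by blast
    then show False using neK \<open>1 / (r' + r) * (r' + r) = 1\<close> by (simp only: scale_one) 
  qed
  have CK': "c \<in> K" if "c \<in> C" for c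
  proof -
    have "c \<in> C1" unfolding C1_def using that by (intro CollectI exI[of _ c] exI[of _ 0]) simp
    then show ?thesis using CK by blast
  qed
  have "- y0 \<in> C1" unfolding C1_def using C
    by (intro CollectI exI[of _ 0] exI[of _ 1]) (auto simp: convex_cone_def)
  then have y0K: "- y0 \<in> K" using CK by blast
  obtain f :: "'v \<Rightarrow> real" where f: "\<And>y z. f (y + z) = f y + f z" "\<And>r y. f (scl r y) = r * f y"
    "\<And>y. y \<in> K \<Longrightarrow> 0 \<le> f y" "f e = 1"
  proof (rule total_cone_functional[OF vs Kc CK'[OF e] _ neK total])
    show "\<exists>t. scl t e + y \<in> K" for y using unit[of y] CK' by blast
  qed blast
  have "f (- y0) = - f y0" using f(2)[of "-1" y0] by simp
  then have "f y0 \<le> 0" using f(3)[OF y0K] by simp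
  then show thesis using that f CK' by blast
qed

section \<open>Operators and adjoints\<close>

text \<open>The scalar identities in the proof about Gram matrices below are needed both for complex numbers and
for vectors; this instance allows them to be proved once.\<close>

instantiation complex :: complex_vector
begin
definition scaleC_complex :: "complex \<Rightarrow> complex \<Rightarrow> complex" where
  "scaleC_complex a b = a * b"
instance by standard (simp_all add: scaleC_complex_def algebra_simps)
end

lemma cinner_sum_right: "cinner x (\<Sum>i\<in>A. f i) = (\<Sum>i\<in>A. cinner x (f i))"
  by (induction A rule: infinite_finite_induct) (simp_all add: cinner_add_right)

lemma cinner_sum_left: "cinner (\<Sum>i\<in>A. f i) x = (\<Sum>i\<in>A. cinner (f i) x)"
  by (induction A rule: infinite_finite_induct) (simp_all add: cinner_add_left)

lemma norm_sq_cinner: "(norm (x::'a::chilbert_space))\<^sup>2 = Re (cinner x x)"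
  by (simp add: cinner_self)

lemmas bop_rep = zero_bop.rep_eq one_bop.rep_eq plus_bop.rep_eq minus_bop.rep_eq
  uminus_bop.rep_eq times_bop.rep_eq scaleC_bop.rep_eq

lemma bop_apply_0: "bop_apply A 0 = 0"
  using linear_0[OF bounded_linear.linear[OF bounded_linear_bop_apply]] .

lemma bop_apply_sum_left: "bop_apply (\<Sum>i\<in>S. A i) x = (\<Sum>i\<in>S. bop_apply (A i) x)"
  by (induction S rule: infinite_finite_induct) (simp_all add: bop_rep)

lemma bop_scaleC_mult: "(c *\<^sub>C A) * B = c *\<^sub>C (A * B)" "A * (c *\<^sub>C B) = c *\<^sub>C (A * (B::'a::chilbert_space bop))"
  by (rule bop_eqI, simp add: bop_rep bop_apply_scaleC)+

lemma bop_eqI_cinner: "(\<And>x y. cinner (bop_apply A x) y = cinner (bop_apply B x) y) \<Longrightarrow> A = B"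
proof (rule bop_eqI)
  fix x assume *: "\<And>x y. cinner (bop_apply A x) y = cinner (bop_apply B x) y"
  have "cinner (bop_apply A x - bop_apply B x) (bop_apply A x - bop_apply B x) = 0"
    by (simp add: cinner_diff_left *)
  then show "bop_apply A x = bop_apply B x" by (simp add: cinner_self)
qed

lemma cinner_adj_right: "cinner x (bop_apply (adj A) y) = cinner (bop_apply A x) y"
  by (metis cinner_adj_left cinner_commute)

lemma adj_add: "adj (A + B) = adj A + adj B"
  and adj_mult: "adj (A * B) = adj B * adj A"
  and adj_scaleC: "adj (c *\<^sub>C A) = cnj c *\<^sub>C adj A"
  and adj_adj: "adj (adj A) = A"
  and adj_0: "adj 0 = 0"
  and adj_1: "adj 1 = 1"
  by (rule bop_eqI_cinner; simp add: cinner_adj_left cinner_adj_right bop_rep cinner_add_left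
      cinner_add_right cinner_scaleC_left cinner_scaleC_right)+

lemma norm_unitary: "unitary_op u \<Longrightarrow> norm (bop_apply u x) = norm x"
proof -
  assume "unitary_op u"
  then have "bop_apply (adj u) (bop_apply u x) = x"
    by (metis unitary_op_def times_bop.rep_eq one_bop.rep_eq)
  then have "(norm (bop_apply u x))\<^sup>2 = (norm x)\<^sup>2"
    unfolding norm_sq_cinner by (metis cinner_adj_left)
  then show ?thesis by (simp add: power2_eq_iff_nonneg)
qed

lemma unitary_adj: "unitary_op u \<Longrightarrow> unitary_op (adj u)"
  by (simp add: unitary_op_def adj_adj)

lemma unitary_1: "unitary_op 1"
  by (simp add: unitary_op_def adj_1)

section \<open>Columns with equal Gram matrices\<close>

text \<open>Replacing the component of \<open>g\<close> along \<open>\<beta>\<close>, given by \<open>s\<close>, by \<open>w\<close> changes the squared norm accordingly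
(Pythagoras).  Here \<open>g\<close> has entries in a Hilbert space, so that "component" means the component in
the tensor product with \<open>\<beta>\<close>.\<close>

lemma norm_sq_rank_one_update:
  fixes g :: "'q \<Rightarrow> 'h::chilbert_space"
  assumes k: "(\<Sum>q\<in>Q. (cmod (\<beta> q))\<^sup>2) = k" "k \<noteq> 0"
  defines "s \<equiv> \<Sum>q\<in>Q. cnj (\<beta> q) *\<^sub>C g q"
  shows "(\<Sum>q\<in>Q. (norm (g q + (\<beta> q / complex_of_real k) *\<^sub>C (w - s)))\<^sup>2)
    = (\<Sum>q\<in>Q. (norm (g q))\<^sup>2) + ((norm w)\<^sup>2 - (norm s)\<^sup>2) / k"
proof -
  have "(\<Sum>q\<in>Q. (norm (g q + (\<beta> q / complex_of_real k) *\<^sub>C (w - s)))\<^sup>2) =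
    (\<Sum>q\<in>Q. (norm (g q))\<^sup>2 + 2 * (Re (cinner (cnj (\<beta> q) *\<^sub>C g q) (w - s)) / k)
      + (cmod (\<beta> q))\<^sup>2 * ((norm (w - s))\<^sup>2 / k\<^sup>2))"
  proof (rule sum.cong[OF refl])
    fix q
    have "cinner (g q) ((\<beta> q / complex_of_real k) *\<^sub>C (w - s)) =
        cinner (cnj (\<beta> q) *\<^sub>C g q) (w - s) / complex_of_real k"
      by (simp add: cinner_scaleC_left cinner_scaleC_right)
    then have 1: "Re (cinner (g q) ((\<beta> q / complex_of_real k) *\<^sub>C (w - s))) =
        Re (cinner (cnj (\<beta> q) *\<^sub>C g q) (w - s)) / k"
      by (simp only: Re_divide_of_real)
    show "(norm (g q + (\<beta> q / complex_of_real k) *\<^sub>C (w - s)))\<^sup>2 =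
      (norm (g q))\<^sup>2 + 2 * (Re (cinner (cnj (\<beta> q) *\<^sub>C g q) (w - s)) / k)
      + (cmod (\<beta> q))\<^sup>2 * ((norm (w - s))\<^sup>2 / k\<^sup>2)"
      unfolding norm_add_sq 1 norm_scaleC by (simp add: norm_divide power_mult_distrib power_divide)
  qed
  also have "\<dots> = (\<Sum>q\<in>Q. (norm (g q))\<^sup>2) + 2 * (Re (cinner s (w - s)) / k)
      + k * ((norm (w - s))\<^sup>2 / k\<^sup>2)"
    unfolding sum.distrib sum_distrib_left[symmetric] sum_divide_distrib[symmetric]
      sum_distrib_right[symmetric] k(1) Re_sum[symmetric] s_def cinner_sum_left by simp
  also have "\<dots> = (\<Sum>q\<in>Q. (norm (g q))\<^sup>2) + (2 * Re (cinner s (w - s)) + (norm (w - s))\<^sup>2) / k"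
    using k(2) by (simp add: add_divide_distrib power2_eq_square)
  also have "2 * Re (cinner s (w - s)) + (norm (w - s))\<^sup>2 = (norm w)\<^sup>2 - (norm s)\<^sup>2"
    using norm_add_sq[of s "w - s"] by simp
  finally show ?thesis .
qed

text \<open>Two families of vectors with the same Gram matrix differ by a partial isometry.  The induction removes
one vector \<open>\<alpha>\<close>, respectively \<open>\<beta>\<close>, by projecting all others onto its orthogonal complement, which
preserves equality of Gram matrices, and then extends the map by \<open>\<alpha> \<mapsto> \<beta>\<close>.  Contractivity is
stated for vectors with entries in a Hilbert space, since the scalar matrix will act on operators.\<close>

lemma gram_eq_imp_contraction:
  fixes a :: "'k \<Rightarrow> 'r \<Rightarrow> complex" and b :: "'k \<Rightarrow> 'q \<Rightarrow> complex"
  assumes "finite I" and "finite R" "finite Q"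
    and "\<And>s t. s \<in> I \<Longrightarrow> t \<in> I \<Longrightarrow>
      (\<Sum>r\<in>R. cnj (a s r) * a t r) = (\<Sum>q\<in>Q. cnj (b s q) * b t q)"
  shows "\<exists>U. (\<forall>t\<in>I. \<forall>q\<in>Q. (\<Sum>r\<in>R. U q r * a t r) = b t q) \<and>
    (\<forall>h :: 'r \<Rightarrow> 'h::chilbert_space.
      (\<Sum>q\<in>Q. (norm (\<Sum>r\<in>R. U q r *\<^sub>C h r))\<^sup>2) \<le> (\<Sum>r\<in>R. (norm (h r))\<^sup>2))"
  using assms(1,4)
proof (induction I arbitrary: a b rule: finite_induct)
  case empty
  show ?case by (rule exI[of _ "\<lambda>_ _. 0"]) (simp add: sum_nonneg)
next
  case (insert k I)
  define ipa where "ipa x y = (\<Sum>r\<in>R. cnj (x r) * y r)" for x y :: "'r \<Rightarrow> complex"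
  define ipb where "ipb x y = (\<Sum>q\<in>Q. cnj (x q) * y q)" for x y :: "'q \<Rightarrow> complex"
  have gram: "ipa (a s) (a t) = ipb (b s) (b t)" if "s \<in> insert k I" "t \<in> insert k I" for s t
    unfolding ipa_def ipb_def by (rule insert.prems[OF that])
  define \<alpha> where "\<alpha> = a k"
  define \<beta> where "\<beta> = b k"
  define \<kappa> where "\<kappa> = (\<Sum>r\<in>R. (cmod (\<alpha> r))\<^sup>2)"
  have kC: "complex_of_real \<kappa> = ipa \<alpha> \<alpha>"
    unfolding \<kappa>_def ipa_def of_real_sum complex_norm_square by (simp add: mult.commute)
  have "complex_of_real (\<Sum>q\<in>Q. (cmod (\<beta> q))\<^sup>2) = ipb \<beta> \<beta>"
    unfolding ipb_def of_real_sum complex_norm_square by (simp add: mult.commute)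
  also have "\<dots> = complex_of_real \<kappa>" unfolding kC using gram[of k k] by (simp add: \<alpha>_def \<beta>_def)
  finally have kb: "(\<Sum>q\<in>Q. (cmod (\<beta> q))\<^sup>2) = \<kappa>" unfolding of_real_eq_iff .
  show ?case
  proof (cases "\<kappa> = 0")
    case True
    have a0: "a k r = 0" if "r \<in> R" for r
      using True that assms(2) by (simp add: \<kappa>_def \<alpha>_def sum_nonneg_eq_0_iff)
    have b0: "b k q = 0" if "q \<in> Q" for q
      using True kb that assms(3) by (simp add: \<beta>_def sum_nonneg_eq_0_iff)
    have "\<exists>U. (\<forall>t\<in>I. \<forall>q\<in>Q. (\<Sum>r\<in>R. U q r * a t r) = b t q) \<and>
      (\<forall>h :: 'r \<Rightarrow> 'h.
        (\<Sum>q\<in>Q. (norm (\<Sum>r\<in>R. U q r *\<^sub>C h r))\<^sup>2) \<le> (\<Sum>r\<in>R. (norm (h r))\<^sup>2))"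
      by (rule insert.IH) (use insert.prems in auto)
    then show ?thesis using a0 b0 by auto
  next
    case False
    define ca where "ca t = ipa \<alpha> (a t) / complex_of_real \<kappa>" for t
    define a' where "a' t r = a t r - ca t * \<alpha> r" for t r
    define b' where "b' t q = b t q - ca t * \<beta> q" for t q
    have cb: "ca t = ipb \<beta> (b t) / complex_of_real \<kappa>" if "t \<in> insert k I" for t
      unfolding ca_def \<alpha>_def \<beta>_def using gram that by simp
    have expa: "ipa (\<lambda>r. x r - c * \<alpha> r) (\<lambda>r. y r - d * \<alpha> r) =
        ipa x y - d * ipa x \<alpha> - cnj c * ipa \<alpha> y + cnj c * d * ipa \<alpha> \<alpha>" for x y c d
      unfolding ipa_def by (simp add: algebra_simps sum.distrib sum_subtractf sum_distrib_left)
    have expb: "ipb (\<lambda>r. x r - c * \<beta> r) (\<lambda>r. y r - d * \<beta> r) =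
        ipb x y - d * ipb x \<beta> - cnj c * ipb \<beta> y + cnj c * d * ipb \<beta> \<beta>" for x y c d
      unfolding ipb_def by (simp add: algebra_simps sum.distrib sum_subtractf sum_distrib_left)
    have gram': "(\<Sum>r\<in>R. cnj (a' s r) * a' t r) = (\<Sum>q\<in>Q. cnj (b' s q) * b' t q)"
      if "s \<in> I" "t \<in> I" for s t
    proof -
      have "ipa (a' s) (a' t) = ipb (b' s) (b' t)"
        unfolding a'_def b'_def expa expb using gram that by (simp add: \<alpha>_def \<beta>_def)
      then show ?thesis by (simp add: ipa_def ipb_def)
    qed
    obtain W where W: "\<And>t q. t \<in> I \<Longrightarrow> q \<in> Q \<Longrightarrow> (\<Sum>r\<in>R. W q r * a' t r) = b' t q"
      and Wc: "\<And>h :: 'r \<Rightarrow> 'h.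
        (\<Sum>q\<in>Q. (norm (\<Sum>r\<in>R. W q r *\<^sub>C h r))\<^sup>2) \<le> (\<Sum>r\<in>R. (norm (h r))\<^sup>2)"
      using insert.IH[of a' b', OF gram'] by blast
    \<comment> \<open>\<open>V\<close> is \<open>W\<close> after the projection off \<open>\<alpha>\<close>; \<open>U\<close> sends \<open>\<alpha>\<close> to \<open>\<beta>\<close> and is \<open>V\<close>, projected off \<open>\<beta>\<close>, on
      the complement of \<open>\<alpha>\<close>.\<close>
    define \<kappa>' where "\<kappa>' = complex_of_real \<kappa>"
    have k': "\<kappa>' \<noteq> 0" using False by (simp add: \<kappa>'_def)
    define V where "V q r = W q r - (\<Sum>r'\<in>R. W q r' * \<alpha> r') * cnj (\<alpha> r) / \<kappa>'" for q r
    define U where "U q r = V q r + (\<beta> q / \<kappa>') * (cnj (\<alpha> r) - (\<Sum>q'\<in>Q. cnj (\<beta> q') * V q' r))" for q r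
    have Vapply: "(\<Sum>r\<in>R. V q r *\<^sub>C h r) =
        (\<Sum>r\<in>R. W q r *\<^sub>C (h r - (\<alpha> r / \<kappa>') *\<^sub>C (\<Sum>r\<in>R. cnj (\<alpha> r) *\<^sub>C h r)))"
      for q and h :: "'r \<Rightarrow> 'v::complex_vector"
    proof -
      let ?s = "\<Sum>r\<in>R. cnj (\<alpha> r) *\<^sub>C h r"
      have "(\<Sum>r\<in>R. V q r *\<^sub>C h r) =
          (\<Sum>r\<in>R. W q r *\<^sub>C h r) - ((\<Sum>r'\<in>R. W q r' * \<alpha> r') / \<kappa>') *\<^sub>C ?s"
        unfolding V_def complex_vector.scale_left_diff_distrib sum_subtractf
          complex_vector.scale_sum_right by (simp add: scaleC_scaleC)
      also have "((\<Sum>r'\<in>R. W q r' * \<alpha> r') / \<kappa>') *\<^sub>C ?s = (\<Sum>r\<in>R. W q r *\<^sub>C (\<alpha> r / \<kappa>') *\<^sub>C ?s)"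
        unfolding sum_divide_distrib complex_vector.scale_sum_left by (simp add: scaleC_scaleC)
      finally show ?thesis
        by (simp add: complex_vector.scale_right_diff_distrib sum_subtractf)
    qed
    have Uapply: "(\<Sum>r\<in>R. U q r *\<^sub>C h r) = (\<Sum>r\<in>R. V q r *\<^sub>C h r) +
        (\<beta> q / \<kappa>') *\<^sub>C ((\<Sum>r\<in>R. cnj (\<alpha> r) *\<^sub>C h r) -
          (\<Sum>q'\<in>Q. cnj (\<beta> q') *\<^sub>C (\<Sum>r\<in>R. V q' r *\<^sub>C h r)))"
      for q and h :: "'r \<Rightarrow> 'v::complex_vector"
    proof -
      have "(\<Sum>q'\<in>Q. cnj (\<beta> q') *\<^sub>C (\<Sum>r\<in>R. V q' r *\<^sub>C h r)) =
          (\<Sum>r\<in>R. \<Sum>q'\<in>Q. (cnj (\<beta> q') * V q' r) *\<^sub>C h r)"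
        unfolding complex_vector.scale_sum_right scaleC_scaleC by (rule sum.swap)
      moreover have "U q r *\<^sub>C h r = V q r *\<^sub>C h r +
          (\<beta> q / \<kappa>') *\<^sub>C (cnj (\<alpha> r) *\<^sub>C h r - (\<Sum>q'\<in>Q. (cnj (\<beta> q') * V q' r) *\<^sub>C h r))" for r
        unfolding complex_vector.scale_sum_left[symmetric]
          complex_vector.scale_left_diff_distrib[symmetric] scaleC_scaleC U_def scaleC_add_left ..
      ultimately show ?thesis
        by (simp only: sum.distrib sum_subtractf complex_vector.scale_sum_right[symmetric])
    qed
    have "(\<Sum>r\<in>R. U q r * a t r) = b t q" if t: "t \<in> insert k I" and q: "q \<in> Q" for t q
    proof -
      have Va: "(\<Sum>r\<in>R. V q r * a t r) = b' t q" if "q \<in> Q" for q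
      proof -
        have "(\<Sum>r\<in>R. V q r * a t r) = (\<Sum>r\<in>R. W q r * a' t r)"
          using Vapply[of q "a t"]
          by (simp add: scaleC_complex_def a'_def ca_def ipa_def \<kappa>'_def mult_ac)
        also have "\<dots> = b' t q"
        proof (cases "t = k")
          case True
          have "ca k = 1" using False by (simp add: ca_def \<alpha>_def[symmetric] kC[symmetric])
          then show ?thesis using True by (simp add: a'_def b'_def \<alpha>_def \<beta>_def)
        next
          case False then show ?thesis using W t that by blast
        qed
        finally show ?thesis .
      qed
      have "ipb \<beta> (b' t) = ipb \<beta> (b t) - ca t * ipb \<beta> \<beta>"
        unfolding ipb_def b'_def by (simp add: algebra_simps sum_subtractf sum_distrib_left)
      also have "ipb \<beta> \<beta> = \<kappa>'" unfolding \<kappa>'_def kC using gram[of k k] by (simp add: \<alpha>_def \<beta>_def)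
      finally have 0: "ipb \<beta> (b' t) = 0" using cb[OF t] k' by (simp add: \<kappa>'_def)
      have "(\<Sum>r\<in>R. U q r * a t r) = b' t q + (\<beta> q / \<kappa>') * (ipa \<alpha> (a t) - ipb \<beta> (b' t))"
        using Uapply[of q "a t"] Va[OF q] by (simp add: scaleC_complex_def ipa_def ipb_def Va)
      also have "\<dots> = b t q" using 0 by (simp add: b'_def ca_def \<kappa>'_def mult.commute)
      finally show ?thesis .
    qed
    moreover have "(\<Sum>q\<in>Q. (norm (\<Sum>r\<in>R. U q r *\<^sub>C h r))\<^sup>2) \<le> (\<Sum>r\<in>R. (norm (h r))\<^sup>2)"
      for h :: "'r \<Rightarrow> 'h"
    proof -
      let ?s = "\<Sum>r\<in>R. cnj (\<alpha> r) *\<^sub>C h r"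
      define h' where "h' r = h r + (\<alpha> r / \<kappa>') *\<^sub>C (0 - ?s)" for r
      define g where "g q = (\<Sum>r\<in>R. W q r *\<^sub>C h' r)" for q
      have Vg: "(\<Sum>r\<in>R. V q r *\<^sub>C h r) = g q" for q
        unfolding Vapply g_def h'_def by (simp add: complex_vector.scale_minus_right)
      let ?u = "\<Sum>q\<in>Q. cnj (\<beta> q) *\<^sub>C g q"
      have "(\<Sum>q\<in>Q. (norm (\<Sum>r\<in>R. U q r *\<^sub>C h r))\<^sup>2) =
          (\<Sum>q\<in>Q. (norm (g q + (\<beta> q / \<kappa>') *\<^sub>C (?s - ?u)))\<^sup>2)"
        unfolding Uapply Vg ..
      also have "\<dots> = (\<Sum>q\<in>Q. (norm (g q))\<^sup>2) + ((norm ?s)\<^sup>2 - (norm ?u)\<^sup>2) / \<kappa>"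
        unfolding \<kappa>'_def by (rule norm_sq_rank_one_update[OF kb False])
      also have "\<dots> \<le> (\<Sum>r\<in>R. (norm (h' r))\<^sup>2) + (norm ?s)\<^sup>2 / \<kappa>"
      proof (rule add_mono)
        show "(\<Sum>q\<in>Q. (norm (g q))\<^sup>2) \<le> (\<Sum>r\<in>R. (norm (h' r))\<^sup>2)" unfolding g_def by (rule Wc)
        have "\<kappa> > 0" using False by (simp add: \<kappa>_def less_le sum_nonneg)
        then show "((norm ?s)\<^sup>2 - (norm ?u)\<^sup>2) / \<kappa> \<le> (norm ?s)\<^sup>2 / \<kappa>"
          by (simp add: divide_right_mono)
      qed
      also have "(\<Sum>r\<in>R. (norm (h' r))\<^sup>2) = (\<Sum>r\<in>R. (norm (h r))\<^sup>2) + ((norm (0::'h))\<^sup>2 - (norm ?s)\<^sup>2) / \<kappa>"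
        unfolding h'_def \<kappa>'_def by (rule norm_sq_rank_one_update[OF \<kappa>_def[symmetric] False])
      finally show ?thesis by simp
    qed
    ultimately show ?thesis by blast
  qed
qed

section \<open>Operator matrices as quadratic forms\<close>

definition op_form :: "'k set \<Rightarrow> ('k \<Rightarrow> 'k \<Rightarrow> 'a::chilbert_space bop) \<Rightarrow> ('k \<Rightarrow> 'a) \<Rightarrow> complex" where
  "op_form I Z h = (\<Sum>s\<in>I. \<Sum>t\<in>I. cinner (h s) (bop_apply (Z s t) (h t)))"

definition rscale :: "real \<Rightarrow> ('k \<Rightarrow> 'k \<Rightarrow> 'a::chilbert_space bop) \<Rightarrow> 'k \<Rightarrow> 'k \<Rightarrow> 'a bop" where
  "rscale r Z = (\<lambda>s t. complex_of_real r *\<^sub>C Z s t)"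

definition gram_op :: "('k \<Rightarrow> 'a::chilbert_space bop) \<Rightarrow> ('k \<Rightarrow> 'a bop) \<Rightarrow> 'k \<Rightarrow> 'k \<Rightarrow> 'a bop" where
  "gram_op a b = (\<lambda>s t. adj (a s) * b t)"

definition entry :: "'k \<Rightarrow> 'a::chilbert_space bop \<Rightarrow> 'k \<Rightarrow> 'a bop" where
  "entry s A = (\<lambda>t. if t = s then A else 0)"

lemma vector_space_rscale: "vector_space rscale"
  by unfold_locales (simp_all add: rscale_def plus_fun_def scaleC_add_right scaleC_add_left
      scaleC_scaleC scaleC_one)

lemma op_form_0: "op_form I 0 h = 0"
  by (simp add: op_form_def zero_fun_def bop_rep)

lemma op_form_add: "op_form I (Y + Z) h = op_form I Y h + op_form I Z h"
  by (simp add: op_form_def plus_fun_def bop_rep cinner_add_right sum.distrib)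

lemma op_form_diff: "op_form I (Y - Z) h = op_form I Y h - op_form I Z h"
  by (simp add: op_form_def bop_rep cinner_diff_right sum_subtractf)

lemma op_form_sum: "op_form I (\<Sum>i\<in>S. Z i) h = (\<Sum>i\<in>S. op_form I (Z i) h)"
proof (induction S rule: infinite_finite_induct)
  case (insert i S)
  then show ?case by (simp only: sum.insert[OF insert.hyps] op_form_add)
qed (simp_all only: sum.infinite sum.empty op_form_0 not_False_eq_True)

lemma op_form_rscale: "op_form I (rscale r Z) h = complex_of_real r * op_form I Z h"
  by (simp add: op_form_def rscale_def bop_rep cinner_scaleC_right sum_distrib_left)

text \<open>The matrix \<open>a\<^sub>s\<^sup>* b\<^sub>t\<close> sees a vector only through the row operators \<open>a\<close> and \<open>b\<close>.  Together with the
positivity of a functional this is what makes \<open>(a, b) \<mapsto> f (gram_op a b)\<close> a semi-inner product.\<close>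

lemma op_form_gram:
  "op_form I (gram_op a b) h =
    cinner (\<Sum>s\<in>I. bop_apply (a s) (h s)) (\<Sum>t\<in>I. bop_apply (b t) (h t))"
  by (simp add: op_form_def gram_op_def bop_rep cinner_adj_right cinner_sum_left cinner_sum_right)
    (rule sum.swap)

lemma sum_entry:
  assumes "finite I" "s \<in> I"
  shows "(\<Sum>t\<in>I. bop_apply (entry s A t) (h t)) = bop_apply A (h s)"
proof -
  have "(\<Sum>t\<in>I. bop_apply (entry s A t) (h t)) = (\<Sum>t\<in>I. if t = s then bop_apply A (h s) else 0)"
    by (rule sum.cong) (simp_all add: entry_def bop_rep)
  then show ?thesis using assms by simp
qed

lemma op_form_bound:
  fixes Z :: "'k \<Rightarrow> 'k \<Rightarrow> 'a::chilbert_space bop"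
  assumes "finite I"
  obtains K where "\<And>h. cmod (op_form I Z h) \<le> K * (\<Sum>t\<in>I. (norm (h t))\<^sup>2)"
proof -
  have "\<forall>B::'a bop. \<exists>K\<ge>0. \<forall>x. norm (bop_apply B x) \<le> norm x * K"
    using bounded_linear.nonneg_bounded[OF bounded_linear_bop_apply] by blast
  then obtain K where K0: "\<And>B::'a bop. 0 \<le> K B"
    and K: "\<And>B x. norm (bop_apply B x) \<le> norm x * K (B::'a bop)" by metis
  have "cmod (op_form I Z h) \<le> (\<Sum>s\<in>I. \<Sum>t\<in>I. K (Z s t)) * (\<Sum>t\<in>I. (norm (h t))\<^sup>2)" for h
  proof -
    have "cmod (cinner (h s) (bop_apply (Z s t) (h t))) \<le> K (Z s t) * (\<Sum>t\<in>I. (norm (h t))\<^sup>2)"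
      if st: "s \<in> I" "t \<in> I" for s t
    proof -
      have le: "norm (h r) \<le> sqrt (\<Sum>t\<in>I. (norm (h t))\<^sup>2)" if "r \<in> I" for r
        by (rule real_le_rsqrt) (use that assms in \<open>auto intro: member_le_sum\<close>)
      have "norm (h s) * norm (h t) \<le> sqrt (\<Sum>t\<in>I. (norm (h t))\<^sup>2) * sqrt (\<Sum>t\<in>I. (norm (h t))\<^sup>2)"
        by (intro mult_mono le st) (auto intro: sum_nonneg)
      then have hh: "norm (h s) * norm (h t) \<le> (\<Sum>t\<in>I. (norm (h t))\<^sup>2)"
        by (simp add: sum_nonneg)
      have "cmod (cinner (h s) (bop_apply (Z s t) (h t))) \<le> norm (h s) * (norm (h t) * K (Z s t))"
        by (rule order_trans[OF cmod_cinner_le]) (intro mult_left_mono K; simp)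
      also have "\<dots> \<le> K (Z s t) * (\<Sum>t\<in>I. (norm (h t))\<^sup>2)"
        using mult_left_mono[OF hh K0[of "Z s t"]] by (simp add: mult_ac)
      finally show ?thesis .
    qed
    then show ?thesis unfolding op_form_def sum_distrib_right
      by (intro order_trans[OF norm_sum] sum_mono)
  qed
  then show thesis using that by blast
qed

section \<open>The certificate\<close>

text \<open>The index set of the column \<open>v\<close>: the pair \<open>(w, j)\<close> stands for the row \<open>w e\<^sub>j\<close>.  Words are lists of
operators, not their products, so that different words stay different even when the operators satisfy
relations.\<close>

locale word_system =
  fixes I :: "('a::chilbert_space bop list \<times> nat) set" and m :: nat
  assumes finite_I: "finite I"
    and suffix_closed: "(u # w, j) \<in> I \<Longrightarrow> (w, j) \<in> I"
    and empty_word: "j < m \<longleftrightarrow> ([], j) \<in> I"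
    and unitary_letter: "(u # w, j) \<in> I \<Longrightarrow> unitary_op u"
begin

definition N where "N = {t \<in> I. fst t \<noteq> []}"
definition par :: "'a bop list \<times> nat \<Rightarrow> 'a bop list \<times> nat" where "par t = (tl (fst t), snd t)"
definition letter :: "'a bop list \<times> nat \<Rightarrow> 'a bop" where "letter t = hd (fst t)"

lemma finite_N: "finite N" and N_sub: "N \<subseteq> I"
  using finite_I by (auto simp: N_def)

lemma N_cases: "t \<in> N \<Longrightarrow> \<exists>u w j. t = (u # w, j) \<and> (u # w, j) \<in> I"
  by (cases t; cases "fst t") (auto simp: N_def)

lemma par_I: "t \<in> N \<Longrightarrow> par t \<in> I"
  using N_cases[of t] suffix_closed by (auto simp: par_def)

lemma unitary_N: "t \<in> N \<Longrightarrow> unitary_op (letter t)"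
  using N_cases[of t] unitary_letter by (auto simp: letter_def)

lemma base_exists: "(w, j) \<in> I \<Longrightarrow> ([], j) \<in> I"
  by (induction w) (use suffix_closed in blast)+

text \<open>On every \<open>h\<close> of the form \<open>h t = prod_list (fst t) (k (snd t))\<close> both sums vanish, the first because
\<open>letter t\<close> maps \<open>h (par t)\<close> to \<open>h t\<close> and the second because \<open>letter t\<close> is isometric.  With
nonnegative \<open>\<gamma>\<close>, a functional that is positive on the cone defined from these forms gives position \<open>t\<close>
at least the mass of position \<open>par t\<close>.\<close>

definition rel_form :: "('a bop list \<times> nat \<Rightarrow> real) \<Rightarrow> ('a bop list \<times> nat \<Rightarrow> real) \<Rightarrow>
    ('a bop list \<times> nat \<Rightarrow> 'a) \<Rightarrow> real" where
  "rel_form \<rho> \<gamma> h =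
    (\<Sum>t\<in>N. \<rho> t * (Re (cinner (h t) (bop_apply (letter t) (h (par t)))) - (norm (h t))\<^sup>2)) +
    (\<Sum>t\<in>N. \<gamma> t * ((norm (h t))\<^sup>2 - (norm (h (par t)))\<^sup>2))"

lemma rel_form_0: "rel_form (\<lambda>_. 0) (\<lambda>_. 0) h = 0"
  by (simp add: rel_form_def)

lemma rel_form_add:
  "rel_form (\<lambda>t. \<rho> t + \<rho>' t) (\<lambda>t. \<gamma> t + \<gamma>' t) h = rel_form \<rho> \<gamma> h + rel_form \<rho>' \<gamma>' h"
  by (simp add: rel_form_def distrib_right sum.distrib)

lemma rel_form_scale: "rel_form (\<lambda>t. r * \<rho> t) (\<lambda>t. r * \<gamma> t) h = r * rel_form \<rho> \<gamma> h"
  by (simp add: rel_form_def distrib_left sum_distrib_left mult.assoc)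

definition rel_cone :: "('a bop list \<times> nat \<Rightarrow> 'a bop list \<times> nat \<Rightarrow> 'a bop) set" where
  "rel_cone = {Z. \<exists>\<rho> \<gamma>. (\<forall>t. 0 \<le> \<gamma> t) \<and> (\<forall>h. rel_form \<rho> \<gamma> h \<le> Re (op_form I Z h))}"

lemma rel_coneI: "(\<And>t. 0 \<le> \<gamma> t) \<Longrightarrow> (\<And>h. rel_form \<rho> \<gamma> h \<le> Re (op_form I Z h)) \<Longrightarrow> Z \<in> rel_cone"
  unfolding rel_cone_def by blast

lemma accretive_in_rel_cone: "(\<And>h. 0 \<le> Re (op_form I Z h)) \<Longrightarrow> Z \<in> rel_cone"
  by (rule rel_coneI[of "\<lambda>_. 0" "\<lambda>_. 0"]) (simp_all add: rel_form_0)

lemma convex_cone_rel_cone: "convex_cone rscale rel_cone"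
  unfolding convex_cone_def
proof (intro conjI ballI allI impI)
  show "0 \<in> rel_cone" by (rule accretive_in_rel_cone) (simp add: op_form_0)
next
  fix Y Z assume "Y \<in> rel_cone" "Z \<in> rel_cone"
  then obtain \<rho> \<gamma> \<rho>' \<gamma>' where "\<And>t. 0 \<le> \<gamma> t" "\<And>h. rel_form \<rho> \<gamma> h \<le> Re (op_form I Y h)"
    "\<And>t. 0 \<le> \<gamma>' t" "\<And>h. rel_form \<rho>' \<gamma>' h \<le> Re (op_form I Z h)"
    unfolding rel_cone_def by blast
  then show "Y + Z \<in> rel_cone"
    by (intro rel_coneI[of "\<lambda>t. \<gamma> t + \<gamma>' t" "\<lambda>t. \<rho> t + \<rho>' t"])
      (simp_all add: rel_form_add op_form_add add_mono)
next
  fix r :: real and Z assume r: "0 \<le> r" and "Z \<in> rel_cone"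
  then obtain \<rho> \<gamma> where "\<And>t. 0 \<le> \<gamma> t" "\<And>h. rel_form \<rho> \<gamma> h \<le> Re (op_form I Z h)"
    unfolding rel_cone_def by blast
  then show "rscale r Z \<in> rel_cone"
    by (intro rel_coneI[of "\<lambda>t. r * \<gamma> t" "\<lambda>t. r * \<rho> t"])
      (simp_all add: rel_form_scale op_form_rscale mult_left_mono r)
qed

definition unit_op :: "'a bop list \<times> nat \<Rightarrow> 'a bop list \<times> nat \<Rightarrow> 'a bop" where
  "unit_op = (\<Sum>t\<in>I. gram_op (entry t 1) (entry t 1))"

lemma op_form_gram_entry:
  "s \<in> I \<Longrightarrow> t \<in> I \<Longrightarrow>
    op_form I (gram_op (entry s A) (entry t B)) h = cinner (bop_apply A (h s)) (bop_apply B (h t))"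
  by (simp add: op_form_gram sum_entry finite_I)

lemma op_form_unit: "op_form I unit_op h = complex_of_real (\<Sum>t\<in>I. (norm (h t))\<^sup>2)"
  unfolding unit_op_def op_form_sum of_real_sum
  by (rule sum.cong) (simp_all add: op_form_gram_entry bop_rep cinner_self)

lemma unit_op_order_unit: "\<exists>c. rscale c unit_op + Z \<in> rel_cone"
proof -
  obtain K where K: "\<And>h. cmod (op_form I Z h) \<le> K * (\<Sum>t\<in>I. (norm (h t))\<^sup>2)"
    using op_form_bound[OF finite_I] by blast
  have "0 \<le> Re (op_form I (rscale K unit_op + Z) h)" for h
    using K[of h] abs_Re_le_cmod[of "op_form I Z h"]
    by (simp add: op_form_add op_form_rscale op_form_unit)
  then show ?thesis using accretive_in_rel_cone by blast
qed

text \<open>The multiplicative domain argument.  For a functional \<open>f\<close> that is nonnegative on \<open>rel_cone\<close>, null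
families are stable under left multiplication because \<open>c a\<close> paired with itself is \<open>a\<close> paired with
\<open>c\<^sup>* c a\<close>, which vanishes by Cauchy-Schwarz.  The relations give
\<open>\<parallel>u \<otimes> par t - 1 \<otimes> t\<parallel>\<^sup>2 = \<parallel>1 \<otimes> par t\<parallel>\<^sup>2 - \<parallel>1 \<otimes> t\<parallel>\<^sup>2 \<le> 0\<close>, where \<open>A \<otimes> t\<close> stands for \<open>entry t A\<close>, and
induction on words then moves every \<open>1 \<otimes> (w, j)\<close> to \<open>w \<otimes> ([], j)\<close>.\<close>

lemma functional_null_families:
  fixes f :: "('a bop list \<times> nat \<Rightarrow> 'a bop list \<times> nat \<Rightarrow> 'a bop) \<Rightarrow> real"
  assumes f_add: "\<And>Y Z. f (Y + Z) = f Y + f Z" and f_scale: "\<And>r Z. f (rscale r Z) = r * f Z"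
    and nonneg: "\<forall>Z\<in>rel_cone. 0 \<le> f Z"
  defines "inn a b \<equiv> f (gram_op a b)"
  defines "null a \<equiv> inn a a = 0"
  shows "null a \<Longrightarrow> null (\<lambda>s. C * a s)"
    and "(w, j) \<in> I \<Longrightarrow> null (\<lambda>s. entry ([], j) (prod_list w) s - entry (w, j) 1 s)"
    and "null a \<Longrightarrow> null b \<Longrightarrow> null (\<lambda>s. a s + b s)"
    and "null (\<lambda>s. a s - b s) \<Longrightarrow> inn a a = inn b b"
proof -
  interpret vector_space "rscale :: real \<Rightarrow> ('a bop list \<times> nat \<Rightarrow> 'a bop list \<times> nat \<Rightarrow> 'a bop) \<Rightarrow> _"
    by (rule vector_space_rscale)
  have f_pos: "0 \<le> f Z" if "Z \<in> rel_cone" for Z using nonneg that by blast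
  have f_minus: "f (- Z) = - f Z" for Z using f_scale[of "-1" Z] by simp
  have f_diff: "f (Y - Z) = f Y - f Z" for Y Z using f_add[of Y "- Z"] by (simp add: f_minus)
  have f_accr: "0 \<le> f Z" if "\<And>h. 0 \<le> Re (op_form I Z h)" for Z
    by (rule f_pos[OF accretive_in_rel_cone[OF that]])
  have addl: "inn (\<lambda>s. a s + b s) c = inn a c + inn b c" for a b c
    unfolding inn_def f_add[symmetric]
    by (rule arg_cong[of _ _ f]) (simp add: gram_op_def plus_fun_def adj_add distrib_right)
  have addr: "inn c (\<lambda>s. a s + b s) = inn c a + inn c b" for a b c
    unfolding inn_def f_add[symmetric]
    by (rule arg_cong[of _ _ f]) (simp add: gram_op_def plus_fun_def distrib_left)
  have diffl: "inn (\<lambda>s. a s - b s) c = inn a c - inn b c" for a b c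
    using addl[of "\<lambda>s. a s - b s" b c] by simp
  have diffr: "inn c (\<lambda>s. a s - b s) = inn c a - inn c b" for a b c
    using addr[of c "\<lambda>s. a s - b s" b] by simp
  have scalel: "inn (\<lambda>s. complex_of_real r *\<^sub>C a s) b = r * inn a b" for r a b
    unfolding inn_def f_scale[symmetric]
    by (rule arg_cong[of _ _ f]) (simp add: gram_op_def rscale_def adj_scaleC bop_scaleC_mult)
  have scaler: "inn b (\<lambda>s. complex_of_real r *\<^sub>C a s) = r * inn b a" for r a b
    unfolding inn_def f_scale[symmetric]
    by (rule arg_cong[of _ _ f]) (simp add: gram_op_def rscale_def bop_scaleC_mult)
  have sym: "inn a b = inn b a" for a b
  proof -
    have "0 \<le> f (gram_op a b - gram_op b a)" for a b
    proof (rule f_accr)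
      fix h
      have "Re (cinner x y) = Re (cinner y x)" for x y :: 'a
        by (subst cinner_commute) simp
      then show "0 \<le> Re (op_form I (gram_op a b - gram_op b a) h)"
        by (simp add: op_form_diff op_form_gram)
    qed
    from this[of a b] this[of b a] show ?thesis by (simp add: f_diff inn_def)
  qed
  have pos: "0 \<le> inn a a" for a
    unfolding inn_def by (rule f_accr) (simp add: op_form_gram cinner_self)
  have mult: "inn (\<lambda>s. C * a s) b = inn a (\<lambda>s. adj C * b s)" for C a b
    unfolding inn_def by (rule arg_cong[of _ _ f]) (simp add: gram_op_def adj_mult mult.assoc)
  have null_inn: "inn a b = 0" if "null a" for a b
  proof (rule ccontr)
    assume ne: "inn a b \<noteq> 0"
    \<comment> \<open>Any \<open>r\<close> that makes the square of \<open>b + r a\<close> negative contradicts positivity.\<close>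
    define r where "r = - (inn b b + 1) / (2 * inn a b)"
    have "0 \<le> inn (\<lambda>s. b s + complex_of_real r *\<^sub>C a s) (\<lambda>s. b s + complex_of_real r *\<^sub>C a s)"
      by (rule pos)
    also have "\<dots> = inn b b + 2 * r * inn a b"
      using that by (simp add: addl addr scalel scaler null_def sym[of b a])
    also have "\<dots> = - 1" using ne by (simp add: r_def field_simps)
    finally show False by simp
  qed
  show null_mult: "null (\<lambda>s. C * a s)" if "null a" for a C
    unfolding null_def mult by (rule null_inn[OF that])
  show null_add: "null (\<lambda>s. a s + b s)" if "null a" "null b" for a b
    using null_inn[OF that(1)] null_inn[OF that(2)] by (simp add: null_def addl)
  show "inn a a = inn b b" if "null (\<lambda>s. a s - b s)" for a b
    using null_inn[OF that, of a] null_inn[OF that, of b] by (simp add: diffl sym[of a b])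
  have step: "null (\<lambda>s. entry (par t) (letter t) s - entry t 1 s)" if t: "t \<in> N" for t
  proof -
    have tI: "t \<in> I" "par t \<in> I" using t N_sub par_I by auto
    let ?Z = "gram_op (entry t 1) (entry (par t) (letter t)) - gram_op (entry t 1) (entry t 1)"
    have form: "Re (op_form I ?Z h) =
        Re (cinner (h t) (bop_apply (letter t) (h (par t)))) - (norm (h t))\<^sup>2" for h
      by (simp add: op_form_diff op_form_gram_entry tI bop_rep norm_sq_cinner)
    have single: "rel_form (\<lambda>s. if s = t then c else 0) (\<lambda>s. if s = t then d else 0) h =
        c * (Re (cinner (h t) (bop_apply (letter t) (h (par t)))) - (norm (h t))\<^sup>2) +
        d * ((norm (h t))\<^sup>2 - (norm (h (par t)))\<^sup>2)" for c d h
      unfolding rel_form_def if_distrib[of "\<lambda>x. x * _"] mult_zero_left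
      using t finite_N by simp
    have "?Z \<in> rel_cone"
      by (rule rel_coneI[of "\<lambda>s. if s = t then 0 else 0" "\<lambda>s. if s = t then 1 else 0"])
        (simp_all only: single form, simp_all)
    moreover have "- ?Z \<in> rel_cone"
    proof (rule rel_coneI[of "\<lambda>s. if s = t then 0 else 0" "\<lambda>s. if s = t then - 1 else 0"])
      fix h
      have "op_form I (- ?Z) h = - op_form I ?Z h" using op_form_diff[of I 0 ?Z h]
        by (simp add: op_form_0)
      then show "rel_form (\<lambda>s. if s = t then - 1 else 0) (\<lambda>s. if s = t then 0 else 0) h
          \<le> Re (op_form I (- ?Z) h)"
        unfolding single uminus_complex.sel by (simp only: uminus_complex.sel form) simp
    qed simp
    ultimately have "f ?Z = 0" using f_pos[of ?Z] f_pos[of "- ?Z"] f_minus[of ?Z] by linarith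
    then have 1: "inn (entry t 1) (entry (par t) (letter t)) = inn (entry t 1) (entry t 1)"
      by (simp add: f_diff inn_def)
    let ?Y = "gram_op (entry t 1) (entry t 1) - gram_op (entry (par t) 1) (entry (par t) 1)"
    have "?Y \<in> rel_cone"
    proof (rule rel_coneI[of "\<lambda>s. if s = t then 1 else 0" "\<lambda>s. if s = t then 0 else 0"])
      show "rel_form (\<lambda>s. if s = t then 0 else 0) (\<lambda>s. if s = t then 1 else 0) h
          \<le> Re (op_form I ?Y h)" for h
        unfolding single by (simp add: op_form_diff op_form_gram_entry tI bop_rep norm_sq_cinner)
    qed simp
    then have 2: "inn (entry (par t) 1) (entry (par t) 1) \<le> inn (entry t 1) (entry t 1)"
      using f_pos[of ?Y] by (simp add: f_diff inn_def)
    have "gram_op (entry (par t) (letter t)) (entry (par t) (letter t)) =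
        gram_op (entry (par t) 1) (entry (par t) 1)"
      using unitary_N[OF t] by (intro ext) (simp add: gram_op_def entry_def adj_0 adj_1 unitary_op_def)
    then have 3: "inn (entry (par t) (letter t)) (entry (par t) (letter t)) =
        inn (entry (par t) 1) (entry (par t) 1)"
      by (simp add: inn_def)
    show ?thesis unfolding null_def
      by (rule antisym[OF _ pos])
        (use 1 2 3 sym[of "entry t 1" "entry (par t) (letter t)"] in \<open>simp add: diffl diffr\<close>)
  qed
  have zero: "null (\<lambda>s. 0)"
    using addl[of "\<lambda>s. 0" "\<lambda>s. 0" "\<lambda>s. 0"] by (simp add: null_def)
  show "null (\<lambda>s. entry ([], j) (prod_list w) s - entry (w, j) 1 s)" if "(w, j) \<in> I" for w j
    using that
  proof (induction w)
    case Nil then show ?case using zero by simp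
  next
    case (Cons u w)
    have "null (\<lambda>s. u * (entry ([], j) (prod_list w) s - entry (w, j) 1 s))"
      by (rule null_mult[OF Cons.IH[OF suffix_closed[OF Cons.prems]]])
    moreover have "null (\<lambda>s. entry (w, j) u s - entry (u # w, j) 1 s)"
      using step[of "(u # w, j)"] Cons.prems by (simp add: N_def par_def letter_def)
    ultimately have "null (\<lambda>s. u * (entry ([], j) (prod_list w) s - entry (w, j) 1 s) +
        (entry (w, j) u s - entry (u # w, j) 1 s))"
      by (rule null_add)
    also have "(\<lambda>s. u * (entry ([], j) (prod_list w) s - entry (w, j) 1 s) +
        (entry (w, j) u s - entry (u # w, j) 1 s)) =
        (\<lambda>s. entry ([], j) (prod_list (u # w)) s - entry (u # w, j) 1 s)"
      by (intro ext) (simp add: entry_def right_diff_distrib)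
    finally show ?case .
  qed
qed

text \<open>For \<open>h\<close> on which the relations hold, the inequality just says that \<open>P\<close> is contractive, with the slack
\<open>\<epsilon>\<close> paying for the term with \<open>\<delta>\<close>; the point is that the failure of the relations can be compensated by the terms of \<open>rel_form\<close>, uniformly in \<open>h\<close>.\<close>

theorem relation_certificate:
  fixes p :: "nat \<Rightarrow> 'a bop list \<times> nat \<Rightarrow> complex"
  assumes contr: "\<And>h :: nat \<Rightarrow> 'a.
      (\<Sum>r<n. (norm (\<Sum>t\<in>I. p r t *\<^sub>C bop_apply (prod_list (fst t)) (h (snd t))))\<^sup>2)
        \<le> (\<Sum>j<m. (norm (h j))\<^sup>2)"
    and \<epsilon>: "\<epsilon> > 0"
  obtains \<delta> \<rho> \<gamma> where "\<delta> > 0" "\<And>t. 0 \<le> \<gamma> t"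
    "\<And>h. rel_form \<rho> \<gamma> h + \<delta> * (\<Sum>t\<in>I. (norm (h t))\<^sup>2) \<le>
      (1 + \<epsilon>) * (\<Sum>j<m. (norm (h ([], j)))\<^sup>2) - (\<Sum>r<n. (norm (\<Sum>t\<in>I. p r t *\<^sub>C h t))\<^sup>2)"
proof -
  \<comment> \<open>The family \<open>pr r\<close> is row \<open>r\<close> of \<open>p\<close>, and \<open>cr r\<close> is row \<open>r\<close> of \<open>P\<close> placed at the empty words; they
    agree modulo null families.\<close>
  define pr where "pr r = (\<lambda>s. \<Sum>t\<in>I. p r t *\<^sub>C entry t (1::'a bop) s)" for r
  define cr where "cr r = (\<lambda>s. \<Sum>t\<in>I. p r t *\<^sub>C entry ([] :: 'a bop list, snd t) (prod_list (fst t)) s)" for r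
  define base where "base = (\<Sum>j<m. gram_op (entry ([] :: 'a bop list, j) (1::'a bop)) (entry ([], j) 1))"
  define y0 where "y0 = rscale (1 + \<epsilon>) base - (\<Sum>r<n. gram_op (pr r) (pr r))"
  have form_base: "op_form I base h = complex_of_real (\<Sum>j<m. (norm (h ([], j)))\<^sup>2)" for h
    unfolding base_def op_form_sum of_real_sum
    by (rule sum.cong) (use empty_word in \<open>simp_all add: op_form_gram_entry bop_rep cinner_self\<close>)
  have lin: "(\<Sum>s\<in>I. bop_apply (\<Sum>t\<in>I. p r t *\<^sub>C entry (g t) (A t) s) (h s)) =
      (\<Sum>t\<in>I. p r t *\<^sub>C bop_apply (A t) (h (g t)))" if "g ` I \<subseteq> I" for r g A h
  proof -
    have "(\<Sum>s\<in>I. bop_apply (\<Sum>t\<in>I. p r t *\<^sub>C entry (g t) (A t) s) (h s)) =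
        (\<Sum>t\<in>I. \<Sum>s\<in>I. p r t *\<^sub>C bop_apply (entry (g t) (A t) s) (h s))"
      unfolding bop_apply_sum_left scaleC_bop.rep_eq by (rule sum.swap)
    also have "\<dots> = (\<Sum>t\<in>I. p r t *\<^sub>C bop_apply (A t) (h (g t)))"
      unfolding complex_vector.scale_sum_right[symmetric]
      by (rule sum.cong[OF refl]) (use that finite_I in \<open>auto simp: sum_entry\<close>)
    finally show ?thesis .
  qed
  have form_pr: "op_form I (gram_op (pr r) (pr r)) h =
      complex_of_real ((norm (\<Sum>t\<in>I. p r t *\<^sub>C h t))\<^sup>2)" for r h
    unfolding op_form_gram pr_def using lin[of "\<lambda>t. t" r "\<lambda>_. 1" h] by (simp add: bop_rep cinner_self)
  have form_cr: "op_form I (gram_op (cr r) (cr r)) h =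
      complex_of_real ((norm (\<Sum>t\<in>I. p r t *\<^sub>C bop_apply (prod_list (fst t)) (h ([], snd t))))\<^sup>2)" for r h
  proof -
    have "(\<lambda>t. ([], snd t)) ` I \<subseteq> I" using base_exists by auto
    from lin[OF this, of r "\<lambda>t. prod_list (fst t)" h] show ?thesis unfolding op_form_gram cr_def by (simp add: cinner_self)
  qed
  have "\<exists>\<delta>>0. y0 - rscale \<delta> unit_op \<in> rel_cone"
  proof (rule ccontr)
    assume "\<not> ?thesis"
    then have out: "y0 - rscale \<delta> unit_op \<notin> rel_cone" if "\<delta> > 0" for \<delta> using that by blast
    have unit: "unit_op \<in> rel_cone"
      by (rule accretive_in_rel_cone) (simp add: op_form_unit sum_nonneg)
    obtain f where f_add: "\<And>Y Z. f (Y + Z) = f Y + f Z" and f_scale: "\<And>r Z. f (rscale r Z) = r * f Z"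
      and f_pos: "\<And>Z. Z \<in> rel_cone \<Longrightarrow> 0 \<le> f Z" and f1: "f unit_op = 1" and f0: "f y0 \<le> 0"
      using cone_separation[OF vector_space_rscale convex_cone_rel_cone unit unit_op_order_unit out]
      by blast
    interpret vector_space "rscale :: real \<Rightarrow> ('a bop list \<times> nat \<Rightarrow> 'a bop list \<times> nat \<Rightarrow> 'a bop) \<Rightarrow> _"
      by (rule vector_space_rscale)
    have "\<forall>Z\<in>rel_cone. 0 \<le> f Z" using f_pos by blast
    note families = functional_null_families[of f, OF f_add f_scale this]
    note null_mult_left = families(1) and null_word = families(2) and null_add = families(3)
      and null_diff_imp_eq = families(4)
    have f_zero: "f 0 = 0" using f_add[of 0 0] by simp
    have f_diff: "f (Y - Z) = f Y - f Z" for Y Z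
      using f_add[of Y "- Z"] f_scale[of "-1" Z] by simp
    have f_sum: "f (\<Sum>i\<in>S. Z i) = (\<Sum>i\<in>S. f (Z i))" for S :: "'i set" and Z
    proof (induction S rule: infinite_finite_induct)
      case (insert i S)
      then show ?case by (simp only: sum.insert[OF insert.hyps] f_add)
    qed (simp_all only: sum.infinite sum.empty f_zero not_False_eq_True)
    define null where "null a \<longleftrightarrow> f (gram_op a a) = 0" for a
    have null_sum: "null (\<lambda>s. \<Sum>t\<in>S. a t s)" if "finite S" "\<And>t. t \<in> S \<Longrightarrow> null (a t)"
      for S :: "'i set" and a
      using that
    proof (induction S rule: finite_induct)
      case empty
      have "gram_op (\<lambda>s :: 'a bop list \<times> nat. 0) (\<lambda>s. 0) = (0 :: _ \<Rightarrow> _ \<Rightarrow> 'a bop)" by (simp add: gram_op_def zero_fun_def)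
      then show ?case by (simp only: null_def sum.empty f_zero)
    next
      case (insert x F) then show ?case using null_add[of "a x" "\<lambda>s. \<Sum>t\<in>F. a t s"] by (simp add: null_def)
    qed
    have "f (gram_op (cr r) (cr r)) = f (gram_op (pr r) (pr r))" for r
    proof (rule null_diff_imp_eq)
      have "null (\<lambda>s. \<Sum>t\<in>I. p r t *\<^sub>C 1 * (entry ([], snd t) (prod_list (fst t)) s - entry t 1 s))"
      proof (rule null_sum[OF finite_I])
        fix t assume "t \<in> I"
        then have "(fst t, snd t) \<in> I" by simp
        from null_word[OF this] have "f (gram_op (\<lambda>s. entry ([], snd t) (prod_list (fst t)) s - entry t 1 s)
            (\<lambda>s. entry ([], snd t) (prod_list (fst t)) s - entry t 1 s)) = 0"
          unfolding prod.collapse .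
        then show "null (\<lambda>s. p r t *\<^sub>C 1 * (entry ([], snd t) (prod_list (fst t)) s - entry t 1 s))"
          unfolding null_def by (rule null_mult_left)
      qed
      then show "f (gram_op (\<lambda>s. cr r s - pr r s) (\<lambda>s. cr r s - pr r s)) = 0"
        by (simp add: null_def cr_def pr_def sum_subtractf[symmetric] bop_scaleC_mult
            complex_vector.scale_right_diff_distrib)
    qed
    then have "f y0 = \<epsilon> * f base + f (base - (\<Sum>r<n. gram_op (cr r) (cr r)))"
      by (simp add: y0_def f_diff f_scale f_sum distrib_right)
    \<comment> \<open>This is where contractivity of \<open>P\<close> enters.\<close>
    moreover have "0 \<le> f (base - (\<Sum>r<n. gram_op (cr r) (cr r)))"
    proof (rule f_pos[OF accretive_in_rel_cone])
      fix h
      show "0 \<le> Re (op_form I (base - (\<Sum>r<n. gram_op (cr r) (cr r))) h)"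
        unfolding op_form_diff op_form_sum form_cr form_base of_real_sum[symmetric]
        using contr[of "\<lambda>j. h ([], j)"] by simp
    qed
    ultimately have "\<epsilon> * f base \<le> 0" using f0 by linarith
    then have base_le: "f base \<le> 0" using \<epsilon> by (simp add: mult_le_0_iff)
    have pos: "0 \<le> f (gram_op a a)" for a
      by (rule f_pos[OF accretive_in_rel_cone]) (simp add: op_form_gram cinner_self)
    have "f base = (\<Sum>j<m. f (gram_op (entry ([], j) 1) (entry ([], j) 1)))"
      by (simp add: base_def f_sum)
    then have base0: "null (entry ([], j) 1)" if "j < m" for j
      using base_le that pos sum_nonneg_eq_0_iff[of "{..<m}" "\<lambda>j. f (gram_op (entry ([], j) 1) (entry ([], j) 1))"]
        sum_nonneg[of "{..<m}" "\<lambda>j. f (gram_op (entry ([], j) 1) (entry ([], j) 1))"]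
      unfolding null_def by auto
    \<comment> \<open>If \<open>f\<close> vanishes at the empty words, it vanishes at all words and hence at the order unit.\<close>
    have "f (gram_op (entry t 1) (entry t 1)) = 0" if "t \<in> I" for t
    proof -
      have "null (\<lambda>s. prod_list (fst t) * entry ([], snd t) 1 s)"
        unfolding null_def
        by (rule null_mult_left, rule base0[unfolded null_def]) (use that base_exists empty_word in \<open>cases t; auto\<close>)
      also have "(\<lambda>s. prod_list (fst t) * entry ([], snd t) 1 s) = entry ([], snd t) (prod_list (fst t))"
        by (intro ext) (simp add: entry_def)
      finally show ?thesis
        using null_diff_imp_eq[OF null_word[of "fst t" "snd t"]] that by (simp add: null_def)
    qed
    then have "f unit_op = 0" by (simp add: unit_op_def f_sum)
    then show False using f1 by simp
  qed
  then obtain \<delta> \<rho> \<gamma> where "\<delta> > 0" "\<And>t. 0 \<le> \<gamma> t"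
    and le: "\<And>h. rel_form \<rho> \<gamma> h \<le> Re (op_form I (y0 - rscale \<delta> unit_op) h)"
    unfolding rel_cone_def by blast
  moreover have "Re (op_form I (y0 - rscale \<delta> unit_op) h) =
      (1 + \<epsilon>) * (\<Sum>j<m. (norm (h ([], j)))\<^sup>2) - (\<Sum>r<n. (norm (\<Sum>t\<in>I. p r t *\<^sub>C h t))\<^sup>2)
      - \<delta> * (\<Sum>t\<in>I. (norm (h t))\<^sup>2)" for h
    unfolding y0_def op_form_diff op_form_rscale op_form_unit form_base op_form_sum form_pr
      of_real_sum[symmetric] of_real_mult[symmetric] of_real_diff[symmetric] Re_complex_of_real ..
  ultimately show thesis using that[of \<delta> \<gamma> \<rho>] by (simp add: algebra_simps)
qed

end

section \<open>Columns and contractions of degree one\<close>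

text \<open>A list of rows represents a column of operator matrices with a common number of columns.  Lists make
block decompositions associative on the nose: stacking is \<open>@\<close>, and no index arithmetic with block
matrices is needed.  A step is left multiplication by a contraction with entries in \<open>E\<close>; transitive
closure of the relation corresponds to products of such contractions.\<close>

definition lin_step :: "'a::chilbert_space bop set \<Rightarrow> (nat \<Rightarrow> 'a bop) list \<Rightarrow> (nat \<Rightarrow> 'a bop) list \<Rightarrow> bool" where
  "lin_step E X Y \<longleftrightarrow> X \<noteq> [] \<and> Y \<noteq> [] \<and>
    (\<exists>q. (\<forall>i<length Y. \<forall>l<length X. q i l \<in> E) \<and>
      (\<forall>h. (\<Sum>i<length Y. (norm (\<Sum>l<length X. bop_apply (q i l) (h l)))\<^sup>2)
        \<le> (\<Sum>l<length X. (norm (h l))\<^sup>2)) \<and>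
      (\<forall>i<length Y. \<forall>j. (Y ! i) j = (\<Sum>l<length X. q i l * (X ! l) j)))"

lemma sum_nth_distinct:
  "distinct xs \<Longrightarrow> (\<Sum>l<length xs. F (xs ! l)) = (\<Sum>x\<in>set xs. F x)"
  by (rule sum.reindex_bij_betw[OF bij_betw_nth]) auto

text \<open>Steps are easier to construct with arbitrary finite index sets than with positions in lists.\<close>

lemma lin_step_map:
  fixes f :: "'x \<Rightarrow> nat \<Rightarrow> 'a::chilbert_space bop"
  assumes xs: "distinct xs" "xs \<noteq> []" and ys: "distinct ys" "ys \<noteq> []"
    and E: "\<And>y x. y \<in> set ys \<Longrightarrow> x \<in> set xs \<Longrightarrow> c y x \<in> E"
    and contr: "\<And>h. (\<Sum>y\<in>set ys. (norm (\<Sum>x\<in>set xs. bop_apply (c y x) (h x)))\<^sup>2)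
      \<le> (\<Sum>x\<in>set xs. (norm (h x))\<^sup>2)"
    and eq: "\<And>y j. y \<in> set ys \<Longrightarrow> g y j = (\<Sum>x\<in>set xs. c y x * f x j)"
  shows "lin_step E (map f xs) (map g ys)"
  unfolding lin_step_def
proof (intro conjI exI[of _ "\<lambda>i l. c (ys ! i) (xs ! l)"] allI impI)
  fix h :: "nat \<Rightarrow> 'a"
  define h' where "h' x = h (the_inv_into {..<length xs} ((!) xs) x)" for x
  have h': "h l = h' (xs ! l)" if "l < length xs" for l
    unfolding h'_def using that xs(1) by (subst the_inv_into_f_f) (auto simp: inj_on_nth)
  have "(\<Sum>l<length xs. bop_apply (c y (xs ! l)) (h l)) = (\<Sum>x\<in>set xs. bop_apply (c y x) (h' x))" for y
    unfolding sum_nth_distinct[OF xs(1), symmetric] by (rule sum.cong) (simp_all add: h')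
  moreover have "(\<Sum>l<length xs. (norm (h l))\<^sup>2) = (\<Sum>x\<in>set xs. (norm (h' x))\<^sup>2)"
    unfolding sum_nth_distinct[OF xs(1), symmetric] by (rule sum.cong) (simp_all add: h')
  ultimately show "(\<Sum>i<length (map g ys). (norm (\<Sum>l<length (map f xs). bop_apply (c (ys ! i) (xs ! l)) (h l)))\<^sup>2)
        \<le> (\<Sum>l<length (map f xs). (norm (h l))\<^sup>2)"
    using contr[of h'] sum_nth_distinct[OF ys(1), of "\<lambda>y. (norm (\<Sum>x\<in>set xs. bop_apply (c y x) (h' x)))\<^sup>2"]
    by simp
next
  fix i j assume "i < length (map g ys)"
  then show "(map g ys ! i) j = (\<Sum>l<length (map f xs). c (ys ! i) (xs ! l) * (map f xs ! l) j)"
    using eq[of "ys ! i" j] sum_nth_distinct[OF xs(1), of "\<lambda>x. c (ys ! i) x * f x j"] by simp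
qed (use xs ys E in auto)

text \<open>A block diagonal matrix of contractions is a contraction.\<close>

lemma lin_step_append:
  fixes X :: "(nat \<Rightarrow> 'a::chilbert_space bop) list"
  assumes E0: "0 \<in> E" and 1: "lin_step E X Y" and 2: "lin_step E X' Y'"
  shows "lin_step E (X @ X') (Y @ Y')"
proof -
  obtain q where q: "\<And>i l. i < length Y \<Longrightarrow> l < length X \<Longrightarrow> q i l \<in> E"
    "\<And>h. (\<Sum>i<length Y. (norm (\<Sum>l<length X. bop_apply (q i l) (h l)))\<^sup>2) \<le> (\<Sum>l<length X. (norm (h l))\<^sup>2)"
    "\<And>i j. i < length Y \<Longrightarrow> (Y ! i) j = (\<Sum>l<length X. q i l * (X ! l) j)"
    using 1 unfolding lin_step_def by blast
  obtain q' where q': "\<And>i l. i < length Y' \<Longrightarrow> l < length X' \<Longrightarrow> q' i l \<in> E"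
    "\<And>h. (\<Sum>i<length Y'. (norm (\<Sum>l<length X'. bop_apply (q' i l) (h l)))\<^sup>2) \<le> (\<Sum>l<length X'. (norm (h l))\<^sup>2)"
    "\<And>i j. i < length Y' \<Longrightarrow> (Y' ! i) j = (\<Sum>l<length X'. q' i l * (X' ! l) j)"
    using 2 unfolding lin_step_def by blast
  define idx where "idx a b = map Inl [0..<a] @ map Inr [0..<b]" for a b :: nat
  have set_idx: "set (idx a b) = {..<a} <+> {..<b}" for a b by (auto simp: idx_def)
  have dist: "distinct (idx a b)" for a b by (auto simp: idx_def distinct_map)
  have list: "map (case_sum ((!) Z) ((!) Z')) (idx (length Z) (length Z')) = Z @ Z'" for Z Z' :: "'b list"
    by (simp add: idx_def comp_def map_nth)
  define c where "c y x = (case y of Inl i \<Rightarrow> (case x of Inl l \<Rightarrow> q i l | Inr l \<Rightarrow> 0)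
    | Inr i \<Rightarrow> (case x of Inl l \<Rightarrow> 0 | Inr l \<Rightarrow> q' i l))" for y x
  have "lin_step E (map (case_sum ((!) X) ((!) X')) (idx (length X) (length X')))
      (map (case_sum ((!) Y) ((!) Y')) (idx (length Y) (length Y')))"
  proof (rule lin_step_map[where c = c])
    show "idx (length X) (length X') \<noteq> []" "idx (length Y) (length Y') \<noteq> []"
      using 1 by (auto simp: lin_step_def idx_def)
  next
    fix y x assume "y \<in> set (idx (length Y) (length Y'))" "x \<in> set (idx (length X) (length X'))"
    then show "c y x \<in> E" using E0 q(1) q'(1) by (auto simp: set_idx c_def)
  next
    fix h :: "nat + nat \<Rightarrow> 'a"
    show "(\<Sum>y\<in>set (idx (length Y) (length Y')). (norm (\<Sum>x\<in>set (idx (length X) (length X')). bop_apply (c y x) (h x)))\<^sup>2)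
        \<le> (\<Sum>x\<in>set (idx (length X) (length X')). (norm (h x))\<^sup>2)"
      using q(2)[of "\<lambda>l. h (Inl l)"] q'(2)[of "\<lambda>l. h (Inr l)"]
      by (simp add: set_idx sum.Plus c_def bop_rep)
  next
    fix y j assume "y \<in> set (idx (length Y) (length Y'))"
    then show "case_sum ((!) Y) ((!) Y') y j =
        (\<Sum>x\<in>set (idx (length X) (length X')). c y x * case_sum ((!) X) ((!) X') x j)"
      using q(3) q'(3) by (auto simp: set_idx sum.Plus c_def)
  qed (rule dist)+
  then show ?thesis unfolding list .
qed

lemma lin_step_refl:
  assumes "0 \<in> E" "1 \<in> E" "X \<noteq> []"
  shows "lin_step E X X"
  unfolding lin_step_def
proof (intro conjI exI[of _ "\<lambda>i l. if i = l then 1 else 0"] allI impI)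
  fix h :: "nat \<Rightarrow> 'a"
  have "(\<Sum>l<length X. bop_apply (if i = l then 1 else 0) (h l)) = h i" if "i < length X" for i
  proof -
    have "(\<Sum>l<length X. bop_apply (if i = l then 1 else 0) (h l)) = (\<Sum>l<length X. if i = l then h l else 0)"
      by (rule sum.cong) (auto simp: bop_rep)
    then show ?thesis using that by simp
  qed
  then show "(\<Sum>i<length X. (norm (\<Sum>l<length X. bop_apply (if i = l then 1 else 0) (h l)))\<^sup>2)
      \<le> (\<Sum>l<length X. (norm (h l))\<^sup>2)" by simp
next
  fix i j assume "i < length X"
  then show "(X ! i) j = (\<Sum>l<length X. (if i = l then 1 else 0) * (X ! l) j)"
    by (simp add: if_distrib[of "\<lambda>x. x * _"] cong: if_cong)
qed (use assms in auto)

lemma lin_step_scale: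
  assumes "lin_step E X Y"
  shows "lin_step E (map (\<lambda>y j. c *\<^sub>C y j) X) (map (\<lambda>y j. c *\<^sub>C y j) Y)"
proof -
  obtain q where "\<forall>i<length Y. \<forall>l<length X. q i l \<in> E"
    "\<forall>h. (\<Sum>i<length Y. (norm (\<Sum>l<length X. bop_apply (q i l) (h l)))\<^sup>2) \<le> (\<Sum>l<length X. (norm (h l))\<^sup>2)"
    "\<forall>i<length Y. \<forall>j. (Y ! i) j = (\<Sum>l<length X. q i l * (X ! l) j)"
    using assms unfolding lin_step_def by blast
  then show ?thesis
    using assms unfolding lin_step_def
    by (intro conjI exI[of _ q]) (auto simp: bop_scaleC_mult complex_vector.scale_sum_right)
qed

lemma lin_step_nonempty: "(lin_step E)\<^sup>+\<^sup>+ X Y \<Longrightarrow> X \<noteq> [] \<and> Y \<noteq> []"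
  by (induction rule: tranclp_induct) (auto simp: lin_step_def)

lemma steps_append:
  assumes E: "0 \<in> E" "1 \<in> E" and "(lin_step E)\<^sup>+\<^sup>+ X Y" and "(lin_step E)\<^sup>+\<^sup>+ X' Y'"
  shows "(lin_step E)\<^sup>+\<^sup>+ (X @ X') (Y @ Y')"
proof -
  have X': "lin_step E X' X'" and Y: "lin_step E Y Y"
    using lin_step_refl[OF E] lin_step_nonempty assms(3,4) by blast+
  have "(lin_step E)\<^sup>+\<^sup>+ (X @ X') (Y @ X')"
    using assms(3)
  proof (induction rule: tranclp_induct)
    case (base Z)
    show ?case by (rule tranclp.r_into_trancl, rule lin_step_append[OF E(1) base X'])
  next
    case (step Z W)
    show ?case by (rule tranclp.trancl_into_trancl[OF step.IH lin_step_append[OF E(1) step.hyps(2) X']])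
  qed
  also have "(lin_step E)\<^sup>+\<^sup>+ (Y @ X') (Y @ Y')"
    using assms(4)
  proof (induction rule: tranclp_induct)
    case (base Z)
    show ?case by (rule tranclp.r_into_trancl, rule lin_step_append[OF E(1) Y base])
  next
    case (step Z W)
    show ?case by (rule tranclp.trancl_into_trancl[OF step.IH lin_step_append[OF E(1) Y step.hyps(2)]])
  qed
  finally show ?thesis .
qed

lemma steps_refl: "0 \<in> E \<Longrightarrow> 1 \<in> E \<Longrightarrow> X \<noteq> [] \<Longrightarrow> (lin_step E)\<^sup>+\<^sup>+ X X"
  by (rule tranclp.r_into_trancl, rule lin_step_refl)

lemma steps_scale:
  "(lin_step E)\<^sup>+\<^sup>+ X Y \<Longrightarrow> (lin_step E)\<^sup>+\<^sup>+ (map (\<lambda>y j. c *\<^sub>C y j) X) (map (\<lambda>y j. c *\<^sub>C y j) Y)"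
proof (induction rule: tranclp_induct)
  case (base Y)
  show ?case by (rule tranclp.r_into_trancl, rule lin_step_scale[OF base])
next
  case (step Y Z)
  show ?case by (rule tranclp.trancl_into_trancl[OF step.IH lin_step_scale[OF step.hyps(2)]])
qed

definition word_row :: "'a::chilbert_space bop list \<times> nat \<Rightarrow> nat \<Rightarrow> 'a bop" where
  "word_row t = (\<lambda>j. if j = snd t then prod_list (fst t) else 0)"

context word_system
begin

section \<open>One step that returns its auxiliary column\<close>

text \<open>The auxiliary column \<open>z\<close> consists of the rows \<open>k w e\<^sub>j\<close> with \<open>k = 1 / \<surd>(2 \<tau>)\<close> and of the rows
\<open>\<surd>(\<gamma> t) (u w) e\<^sub>j\<close> for \<open>t = (u # w, j)\<close>.  The first step applies \<open>1 - \<tau> X\<close> to the former and \<open>u\<^sup>*\<close> to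
the latter.  With rows written as coefficient vectors over the words, the outcome together with
\<open>\<surd>(1 + \<epsilon>) 1\<close> is \<open>a\<close>, while \<open>b\<close> is the desired output, namely \<open>P\<close> and \<open>z\<close>, together with the surplus
\<open>k \<tau> S\<close>.  The identity
\<open>(1 - \<tau> S)\<^sup>2 / (2 \<tau>) = 1 / (2 \<tau>) - S + (\<tau> / 2) S\<^sup>2\<close> and the definition of \<open>S\<close> show that \<open>a\<close> and \<open>b\<close> have
the same Gram matrix, so a scalar contraction is the second step.\<close>

theorem recycling_step:
  fixes p :: "nat \<Rightarrow> 'a bop list \<times> nat \<Rightarrow> complex"
  assumes contr: "\<And>h :: nat \<Rightarrow> 'a.
      (\<Sum>r<n. (norm (\<Sum>t\<in>I. p r t *\<^sub>C bop_apply (prod_list (fst t)) (h (snd t))))\<^sup>2)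
        \<le> (\<Sum>j<m. (norm (h j))\<^sup>2)"
    and \<epsilon>: "\<epsilon> > 0" and m: "m > 0"
    and E0: "0 \<in> E" and E1: "1 \<in> E" and E_add: "\<And>A B. A \<in> E \<Longrightarrow> B \<in> E \<Longrightarrow> A + B \<in> E"
    and E_scale: "\<And>c A. A \<in> E \<Longrightarrow> c *\<^sub>C A \<in> E"
    and E_letter: "\<And>t. t \<in> N \<Longrightarrow> letter t \<in> E" and E_adj: "\<And>t. t \<in> N \<Longrightarrow> adj (letter t) \<in> E"
  obtains z where "z \<noteq> []" "\<And>y. y \<in> set z \<Longrightarrow> \<exists>c. \<exists>t\<in>I. y = (\<lambda>j. c *\<^sub>C word_row t j)"
    "(lin_step E)\<^sup>+\<^sup>+
      (z @ map (\<lambda>i j. complex_of_real (sqrt (1 + \<epsilon>)) *\<^sub>C word_row ([], i) j) [0..<m])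
      (map (\<lambda>r j. \<Sum>t\<in>I. p r t *\<^sub>C word_row t j) [0..<n] @ z)"
proof -
  obtain \<delta> \<rho> \<gamma> where \<delta>: "\<delta> > 0" and \<gamma>: "\<And>t. 0 \<le> \<gamma> t" and key: 
    "\<And>h. rel_form \<rho> \<gamma> h + \<delta> * (\<Sum>t\<in>I. (norm (h t))\<^sup>2) \<le>
      (1 + \<epsilon>) * (\<Sum>j<m. (norm (h ([], j)))\<^sup>2) - (\<Sum>r<n. (norm (\<Sum>t\<in>I. p r t *\<^sub>C h t))\<^sup>2)"
    by (rule relation_certificate[OF contr \<epsilon>]) (rule that, assumption+)
  \<comment> \<open>The matrices \<open>X\<close> and \<open>S\<close> agree on the column of words; \<open>X\<close> represents the difference of the two
    sides of \<open>key\<close> other than the term with \<open>\<delta>\<close>, up to a skew-Hermitian part.\<close>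
  define dg where "dg s = (if fst s = [] then 1 + \<epsilon> else 0) - (if s \<in> N then \<gamma> s else 0)
    + (\<Sum>t\<in>N. if par t = s then \<gamma> t else 0)" for s
  define S where "S s t = (if s = t then complex_of_real (dg s) else 0) - (\<Sum>r<n. cnj (p r s) * p r t)" for s t
  define X where "X s t = S s t *\<^sub>C (1::'a bop) - (if s \<in> N then complex_of_real (\<rho> s) *\<^sub>C
    ((if t = par s then letter s else 0) - (if t = s then 1 else 0)) else 0)" for s t
  have herm: "cnj (S s t) = S t s" for s t
    by (simp add: S_def mult.commute)
  have E_minus: "- A \<in> E" if "A \<in> E" for A using E_scale[OF that, of "- 1"] by simp
  have E_diff: "A - B \<in> E" if "A \<in> E" "B \<in> E" for A B
    using E_add[OF that(1) E_minus[OF that(2)]] by simp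
  have X_E: "X s t \<in> E" for s t
    unfolding X_def by (auto intro!: E_diff E_add E_scale E0 E1 E_letter)
  have X_apply: "(\<Sum>t\<in>I. bop_apply (X s t) (h t)) = (\<Sum>t\<in>I. S s t *\<^sub>C h t) -
      (if s \<in> N then complex_of_real (\<rho> s) *\<^sub>C (bop_apply (letter s) (h (par s)) - h s) else 0)"
    if "s \<in> I" for s h
  proof (cases "s \<in> N")
    case True
    have "bop_apply (X s t) (h t) = S s t *\<^sub>C h t - complex_of_real (\<rho> s) *\<^sub>C
        ((if t = par s then bop_apply (letter s) (h (par s)) else 0) - (if t = s then h s else 0))" for t
      using True by (auto simp: X_def bop_rep)
    then show ?thesis
      using True that par_I[OF True] finite_I
      by (simp add: sum_subtractf complex_vector.scale_sum_right[symmetric])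
  qed (simp add: X_def bop_rep)
  have X_row: "(\<Sum>t\<in>I. X s t * word_row t j) = (\<Sum>t\<in>I. S s t *\<^sub>C word_row t j)" if "s \<in> I" for s j
  proof (cases "s \<in> N")
    case True
    have "X s t * word_row t j = S s t *\<^sub>C word_row t j - complex_of_real (\<rho> s) *\<^sub>C
        ((if t = par s then letter s * word_row (par s) j else 0) - (if t = s then word_row s j else 0))" for t
      using True by (auto simp: X_def left_diff_distrib bop_scaleC_mult)
    moreover have "letter s * word_row (par s) j = word_row s j"
      using N_cases[OF True] by (auto simp: word_row_def letter_def par_def)
    ultimately show ?thesis
      using True that par_I[OF True] finite_I
      by (simp add: sum_subtractf complex_vector.scale_sum_right[symmetric])
  qed (simp add: X_def bop_scaleC_mult)
  have base_sum: "(\<Sum>s\<in>I. if fst s = [] then F s else 0) = (\<Sum>j<m. F ([], j))" for F :: "_ \<Rightarrow> real"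
  proof -
    have "(\<Sum>s\<in>I. if fst s = [] then F s else 0) = (\<Sum>s\<in>{s\<in>I. fst s = []}. F s)"
      by (simp add: sum.inter_filter[OF finite_I])
    also have "{s\<in>I. fst s = []} = (\<lambda>j. ([], j)) ` {..<m}"
      using empty_word by force
    also have "(\<Sum>s\<in>(\<lambda>j. ([], j)) ` {..<m}. F s) = (\<Sum>j<m. F ([], j))"
      by (subst sum.reindex) (auto simp: inj_on_def)
    finally show ?thesis .
  qed
  have N_sum: "(\<Sum>s\<in>I. if s \<in> N then F s else 0) = (\<Sum>s\<in>N. F s)" for F :: "_ \<Rightarrow> real"
    using sum.inter_restrict[OF finite_I, of F N] N_sub by (simp add: Int_absorb1)
  have par_sum: "(\<Sum>s\<in>I. (\<Sum>t\<in>N. if par t = s then \<gamma> t else 0) * F s) = (\<Sum>t\<in>N. \<gamma> t * F (par t))"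
    for F :: "_ \<Rightarrow> real"
  proof -
    have "(\<Sum>s\<in>I. (\<Sum>t\<in>N. if par t = s then \<gamma> t else 0) * F s) =
        (\<Sum>t\<in>N. \<Sum>s\<in>I. if par t = s then \<gamma> t * F s else 0)"
      unfolding sum_distrib_right if_distrib[of "\<lambda>x. x * _"] mult_zero_left by (rule sum.swap)
    also have "\<dots> = (\<Sum>t\<in>N. \<gamma> t * F (par t))"
      by (rule sum.cong) (use finite_I par_I in auto)
    finally show ?thesis .
  qed
  define Xh where "Xh h s = (\<Sum>t\<in>I. bop_apply (X s t) (h t))" for h s
  have accretive: "\<delta> * (\<Sum>t\<in>I. (norm (h t))\<^sup>2) \<le> (\<Sum>s\<in>I. Re (cinner (h s) (Xh h s)))" for h
  proof -
    have diag: "(\<Sum>s\<in>I. dg s * (norm (h s))\<^sup>2) = (1 + \<epsilon>) * (\<Sum>j<m. (norm (h ([], j)))\<^sup>2)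
        - (\<Sum>t\<in>N. \<gamma> t * ((norm (h t))\<^sup>2 - (norm (h (par t)))\<^sup>2))"
      unfolding dg_def
      by (simp add: distrib_right left_diff_distrib right_diff_distrib sum.distrib sum_subtractf
          par_sum if_distrib[of "\<lambda>x. x * _"] base_sum N_sum sum_distrib_left cong: if_cong)
    have "(\<Sum>s\<in>I. Re (cinner (h s) (\<Sum>t\<in>I. S s t *\<^sub>C h t))) = (\<Sum>s\<in>I. dg s * (norm (h s))\<^sup>2)
        - (\<Sum>r<n. (norm (\<Sum>t\<in>I. p r t *\<^sub>C h t))\<^sup>2)"
    proof -
      define v where "v r = (\<Sum>t\<in>I. p r t *\<^sub>C h t)" for r
      have "(\<Sum>t\<in>I. S s t *\<^sub>C h t) = complex_of_real (dg s) *\<^sub>C h s -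
          (\<Sum>r<n. cnj (p r s) *\<^sub>C (\<Sum>t\<in>I. p r t *\<^sub>C h t))" if "s \<in> I" for s
      proof -
        have "(\<Sum>t\<in>I. (if s = t then complex_of_real (dg s) else 0) *\<^sub>C h t) =
            (\<Sum>t\<in>I. if s = t then complex_of_real (dg s) *\<^sub>C h t else 0)"
          by (rule sum.cong) auto
        also have "\<dots> = complex_of_real (dg s) *\<^sub>C h s" using that finite_I by simp
        moreover have "(\<Sum>t\<in>I. (\<Sum>r<n. cnj (p r s) * p r t) *\<^sub>C h t) =
            (\<Sum>r<n. cnj (p r s) *\<^sub>C (\<Sum>t\<in>I. p r t *\<^sub>C h t))"
          unfolding complex_vector.scale_sum_left complex_vector.scale_sum_right scaleC_scaleC
          by (rule sum.swap)
        ultimately show ?thesis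
          by (simp add: S_def complex_vector.scale_left_diff_distrib sum_subtractf)
      qed
      then have Sh: "(\<Sum>t\<in>I. S s t *\<^sub>C h t) = complex_of_real (dg s) *\<^sub>C h s -
          (\<Sum>r<n. cnj (p r s) *\<^sub>C v r)" if "s \<in> I" for s
        using that by (simp add: v_def)
      have "cinner (h s) (\<Sum>t\<in>I. S s t *\<^sub>C h t) = complex_of_real (dg s * (norm (h s))\<^sup>2)
          - (\<Sum>r<n. cinner (p r s *\<^sub>C h s) (v r))" if "s \<in> I" for s
        unfolding Sh[OF that] by (simp add: cinner_diff_right cinner_sum_right cinner_scaleC_right
            cinner_scaleC_left cinner_self)
      then have "(\<Sum>s\<in>I. cinner (h s) (\<Sum>t\<in>I. S s t *\<^sub>C h t)) =
          (\<Sum>s\<in>I. complex_of_real (dg s * (norm (h s))\<^sup>2)) - (\<Sum>s\<in>I. \<Sum>r<n. cinner (p r s *\<^sub>C h s) (v r))"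
        by (simp add: sum_subtractf)
      also have "(\<Sum>s\<in>I. \<Sum>r<n. cinner (p r s *\<^sub>C h s) (v r)) = (\<Sum>r<n. cinner (v r) (v r))"
        unfolding v_def cinner_sum_left by (rule sum.swap)
      finally have "(\<Sum>s\<in>I. cinner (h s) (\<Sum>t\<in>I. S s t *\<^sub>C h t)) =
          complex_of_real ((\<Sum>s\<in>I. dg s * (norm (h s))\<^sup>2) - (\<Sum>r<n. (norm (v r))\<^sup>2))"
        by (simp add: cinner_self)
      then show ?thesis unfolding Re_sum[symmetric] by (simp add: v_def)
    qed
    moreover have "(\<Sum>s\<in>I. Re (cinner (h s) (Xh h s))) =
        (\<Sum>s\<in>I. Re (cinner (h s) (\<Sum>t\<in>I. S s t *\<^sub>C h t)) - (if s \<in> N then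
          \<rho> s * (Re (cinner (h s) (bop_apply (letter s) (h (par s)))) - (norm (h s))\<^sup>2) else 0))"
      by (rule sum.cong) (simp_all add: Xh_def X_apply cinner_diff_right cinner_scaleC_right cinner_self)
    ultimately show ?thesis
      using key[of h] diag unfolding sum_subtractf N_sum rel_form_def by simp
  qed
  have "\<exists>K\<ge>0. \<forall>h. (\<Sum>s\<in>I. (norm (Xh h s))\<^sup>2) \<le> K * (\<Sum>t\<in>I. (norm (h t))\<^sup>2)"
  proof -
    obtain K where K: "\<And>h. cmod (op_form I (\<Sum>s\<in>I. gram_op (X s) (X s)) h) \<le> K * (\<Sum>t\<in>I. (norm (h t))\<^sup>2)"
      using op_form_bound[OF finite_I] by blast
    have "op_form I (\<Sum>s\<in>I. gram_op (X s) (X s)) h = complex_of_real (\<Sum>s\<in>I. (norm (Xh h s))\<^sup>2)" for h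
      by (simp add: op_form_sum op_form_gram cinner_self Xh_def)
    then have "(\<Sum>s\<in>I. (norm (Xh h s))\<^sup>2) \<le> max K 0 * (\<Sum>t\<in>I. (norm (h t))\<^sup>2)" for h
      using K[of h] mult_right_mono[of K "max K 0" "\<Sum>t\<in>I. (norm (h t))\<^sup>2"]
      by (simp add: sum_nonneg del: of_real_sum)
    then show ?thesis by (intro exI[of _ "max K 0"]) simp
  qed
  then obtain K where K0: "K \<ge> 0" and K: "\<And>h. (\<Sum>s\<in>I. (norm (Xh h s))\<^sup>2) \<le> K * (\<Sum>t\<in>I. (norm (h t))\<^sup>2)"
    by blast
  define \<tau> where "\<tau> = \<delta> / (K + 1)"
  have \<tau>: "\<tau> > 0" "\<tau> * K \<le> \<delta>"
    using \<delta> K0 by (simp_all add: \<tau>_def field_simps)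
  \<comment> \<open>Strictness of the positivity matters: the real part of \<open>X\<close> must dominate the term \<open>\<tau> X\<^sup>* X\<close>, and
    \<open>X\<close> need not be Hermitian.\<close>
  have contrX: "(\<Sum>s\<in>I. (norm (h s - complex_of_real \<tau> *\<^sub>C Xh h s))\<^sup>2) \<le> (\<Sum>s\<in>I. (norm (h s))\<^sup>2)" for h
  proof -
    have "(norm (h s - complex_of_real \<tau> *\<^sub>C Xh h s))\<^sup>2 = (norm (h s))\<^sup>2
        - 2 * \<tau> * Re (cinner (h s) (Xh h s)) + \<tau>\<^sup>2 * (norm (Xh h s))\<^sup>2" for s
      using norm_add_sq[of "h s" "- (complex_of_real \<tau> *\<^sub>C Xh h s)"] 
      by (simp add: cinner_minus_right cinner_scaleC_right norm_scaleC power_mult_distrib)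
    then have "(\<Sum>s\<in>I. (norm (h s - complex_of_real \<tau> *\<^sub>C Xh h s))\<^sup>2) = (\<Sum>s\<in>I. (norm (h s))\<^sup>2)
        - 2 * \<tau> * (\<Sum>s\<in>I. Re (cinner (h s) (Xh h s))) + \<tau>\<^sup>2 * (\<Sum>s\<in>I. (norm (Xh h s))\<^sup>2)"
      by (simp add: sum.distrib sum_subtractf sum_distrib_left)
    moreover have "\<tau>\<^sup>2 * (\<Sum>s\<in>I. (norm (Xh h s))\<^sup>2) \<le> \<tau>\<^sup>2 * (K * (\<Sum>s\<in>I. (norm (h s))\<^sup>2))"
      by (intro mult_left_mono K) simp
    moreover have "\<tau>\<^sup>2 * (K * (\<Sum>s\<in>I. (norm (h s))\<^sup>2)) \<le> \<tau> * (\<delta> * (\<Sum>s\<in>I. (norm (h s))\<^sup>2))"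
      using \<tau> mult_right_mono[OF \<tau>(2), of "\<tau> * (\<Sum>s\<in>I. (norm (h s))\<^sup>2)"]
      by (simp add: power2_eq_square mult_ac sum_nonneg)
    moreover have "\<tau> * (\<delta> * (\<Sum>s\<in>I. (norm (h s))\<^sup>2)) \<le> \<tau> * (\<Sum>s\<in>I. Re (cinner (h s) (Xh h s)))"
      by (intro mult_left_mono accretive) (use \<tau> in simp)
    moreover have "0 \<le> \<tau> * (\<delta> * (\<Sum>s\<in>I. (norm (h s))\<^sup>2))" using \<tau> \<delta> by (simp add: sum_nonneg)
    ultimately show ?thesis by linarith
  qed
  define k where "k = complex_of_real (1 / sqrt (2 * \<tau>))"
  have kk: "k * k = complex_of_real (1 / (2 * \<tau>))" and kr: "cnj k = k"
    using \<tau> by (simp_all add: k_def of_real_mult[symmetric] del: of_real_mult of_real_divide)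
  \<comment> \<open>Rows are indexed by \<open>Inl (Inl s)\<close> for the words, \<open>Inl (Inr s)\<close> for the relations with weight
    \<open>\<gamma> s\<close>, and \<open>Inr\<close> for the input, respectively for the output and the surplus.\<close>
  define a where "a t x = (case x of
      Inl (Inl s) \<Rightarrow> k * ((if s = t then 1 else 0) - complex_of_real \<tau> * S s t)
    | Inl (Inr s) \<Rightarrow> (if par s = t then complex_of_real (sqrt (\<gamma> s)) else 0)
    | Inr j \<Rightarrow> (if t = ([], j) then complex_of_real (sqrt (1 + \<epsilon>)) else 0))" for t x
  define b where "b t x = (case x of
      Inl (Inl s) \<Rightarrow> (if s = t then k else 0)
    | Inl (Inr s) \<Rightarrow> (if s = t then complex_of_real (sqrt (\<gamma> s)) else 0)
    | Inr (Inl r) \<Rightarrow> p r t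
    | Inr (Inr s) \<Rightarrow> k * complex_of_real \<tau> * S s t)" for t x
  have gram: "(\<Sum>x\<in>(I <+> N) <+> {..<m}. cnj (a s x) * a t x) =
      (\<Sum>y\<in>(I <+> N) <+> ({..<n} <+> I). cnj (b s y) * b t y)" if st: "s \<in> I" "t \<in> I" for s t
  proof -
    let ?d = "if s = t then 1 else 0 :: complex"
    have sq: "complex_of_real (sqrt c) * complex_of_real (sqrt c) = complex_of_real c" if "0 \<le> c" for c
      using that by (simp add: of_real_mult[symmetric] del: of_real_mult)
    have prod_if: "cnj (if P then c else 0) * (if R then d else 0) = (if P \<and> R then cnj c * d else 0)"
      for P R and c d :: complex by simp
    have A1: "(\<Sum>x\<in>I. cnj (a s (Inl (Inl x))) * a t (Inl (Inl x))) =
        k * k * (?d - 2 * complex_of_real \<tau> * S s t + complex_of_real \<tau> * complex_of_real \<tau> * (\<Sum>x\<in>I. S s x * S x t))"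
    proof -
      have "cnj (a s (Inl (Inl x))) * a t (Inl (Inl x)) = k * k * ((if x = s then ?d else 0)
          - (if x = s then complex_of_real \<tau> * S s t else 0) - (if x = t then complex_of_real \<tau> * S s t else 0)
          + complex_of_real \<tau> * complex_of_real \<tau> * (S s x * S x t))" for x
        by (auto simp: a_def kr herm algebra_simps)
      then show ?thesis using st finite_I
        by (simp add: sum_distrib_left[symmetric] sum.distrib sum_subtractf)
    qed
    have A2: "(\<Sum>x\<in>N. cnj (a s (Inl (Inr x))) * a t (Inl (Inr x))) =
        (if s = t then complex_of_real (\<Sum>x\<in>N. if par x = s then \<gamma> x else 0) else 0)"
    proof -
      have "cnj (a s (Inl (Inr x))) * a t (Inl (Inr x)) =
          (if s = t then complex_of_real (if par x = s then \<gamma> x else 0) else 0)" for x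
        unfolding a_def sum.case prod_if using \<gamma>[of x] by (auto simp: sq)
      then show ?thesis by simp
    qed
    have A3: "(\<Sum>j<m. cnj (a s (Inr j)) * a t (Inr j)) =
        (if s = t then complex_of_real (if fst s = [] then 1 + \<epsilon> else 0) else 0)"
    proof -
      have sqe: "complex_of_real (sqrt (1 + \<epsilon>)) * complex_of_real (sqrt (1 + \<epsilon>)) = complex_of_real (1 + \<epsilon>)"
        using \<epsilon> by (intro sq) simp
      have "cnj (a s (Inr j)) * a t (Inr j) =
          (if j = snd s then if s = t \<and> fst s = [] then complex_of_real (1 + \<epsilon>) else 0 else 0)" for j
        unfolding a_def sum.case prod_if using sqe by (cases s; cases t; auto)
      moreover have "snd s < m" if "fst s = []" using that st empty_word by (cases s) auto
      ultimately show ?thesis by auto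
    qed
    have B1: "(\<Sum>x\<in>I. cnj (b s (Inl (Inl x))) * b t (Inl (Inl x))) = k * k * ?d"
    proof -
      have "cnj (b s (Inl (Inl x))) * b t (Inl (Inl x)) = (if x = s then k * k * ?d else 0)" for x
        by (auto simp: b_def kr)
      then show ?thesis using st finite_I by simp
    qed
    have B2: "(\<Sum>x\<in>N. cnj (b s (Inl (Inr x))) * b t (Inl (Inr x))) =
        (if s = t then complex_of_real (if s \<in> N then \<gamma> s else 0) else 0)"
    proof -
      have "cnj (b s (Inl (Inr x))) * b t (Inl (Inr x)) =
          (if x = s then (if s = t then complex_of_real (\<gamma> s) else 0) else 0)" for x
        unfolding b_def sum.case prod_if using \<gamma>[of x] by (auto simp: sq)
      then show ?thesis using finite_N by simp
    qed
    have B4: "(\<Sum>x\<in>I. cnj (b s (Inr (Inr x))) * b t (Inr (Inr x))) =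
        k * k * (complex_of_real \<tau> * complex_of_real \<tau> * (\<Sum>x\<in>I. S s x * S x t))"
      unfolding sum_distrib_left by (rule sum.cong) (simp_all add: b_def kr herm)
    have B3: "(\<Sum>r<n. cnj (b s (Inr (Inl r))) * b t (Inr (Inl r))) = (\<Sum>r<n. cnj (p r s) * p r t)"
      by (simp add: b_def)
    have splitA: "(\<Sum>x\<in>(I <+> N) <+> {..<m}. F x) =
        (\<Sum>x\<in>I. F (Inl (Inl x))) + (\<Sum>x\<in>N. F (Inl (Inr x))) + (\<Sum>j<m. F (Inr j))" for F :: "_ \<Rightarrow> complex"
      using finite_I finite_N by (simp add: sum.Plus finite_Plus)
    have splitB: "(\<Sum>y\<in>(I <+> N) <+> ({..<n} <+> I). F y) = (\<Sum>x\<in>I. F (Inl (Inl x)))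
        + (\<Sum>x\<in>N. F (Inl (Inr x))) + ((\<Sum>r<n. F (Inr (Inl r))) + (\<Sum>x\<in>I. F (Inr (Inr x))))" for F :: "_ \<Rightarrow> complex"
      using finite_I finite_N by (simp add: sum.Plus finite_Plus)
    have kS: "k * k * (2 * complex_of_real \<tau> * S s t) = S s t" unfolding kk using \<tau> by simp
    have "S s t + (\<Sum>r<n. cnj (p r s) * p r t) = (if s = t then complex_of_real (dg s) else 0)"
      by (simp add: S_def)
    also have "\<dots> = (if s = t then complex_of_real (if fst s = [] then 1 + \<epsilon> else 0) else 0)
        - (if s = t then complex_of_real (if s \<in> N then \<gamma> s else 0) else 0)
        + (if s = t then complex_of_real (\<Sum>x\<in>N. if par x = s then \<gamma> x else 0) else 0)"
      by (simp add: dg_def)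
    finally have bal: "S s t + (\<Sum>r<n. cnj (p r s) * p r t) = \<dots>" .
    have combine: "u - w + q + a2 + a3 = u + b2 + (g + q)" if "w + g = a3 - b2 + a2"
      for u w q a2 a3 b2 g :: complex
    proof -
      have "w = a3 - b2 + a2 - g" using that by (simp add: eq_diff_eq)
      then show ?thesis by simp
    qed
    show ?thesis
      unfolding splitA splitB A1 A2 A3 B1 B2 B3 B4 distrib_left right_diff_distrib kS
      by (rule combine[OF bal])
  qed
  obtain U where Ua: "\<And>t y. t \<in> I \<Longrightarrow> y \<in> (I <+> N) <+> ({..<n} <+> I) \<Longrightarrow>
      (\<Sum>x\<in>(I <+> N) <+> {..<m}. U y x * a t x) = b t y"
    and Uc: "\<And>h :: _ \<Rightarrow> 'a. (\<Sum>y\<in>(I <+> N) <+> ({..<n} <+> I). (norm (\<Sum>x\<in>(I <+> N) <+> {..<m}. U y x *\<^sub>C h x))\<^sup>2)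
      \<le> (\<Sum>x\<in>(I <+> N) <+> {..<m}. (norm (h x))\<^sup>2)"
  proof -
    have fin: "finite ((I <+> N) <+> {..<m})" "finite ((I <+> N) <+> ({..<n} <+> I))"
      using finite_I finite_N by (simp_all add: finite_Plus)
    show thesis
      using gram_eq_imp_contraction[of I "(I <+> N) <+> {..<m}" "(I <+> N) <+> ({..<n} <+> I)" a b,
        where 'h = 'a, OF finite_I fin gram] that by blast
  qed
  define ra where "ra x = (\<lambda>j. \<Sum>t\<in>I. a t x *\<^sub>C word_row t j)" for x
  define rb where "rb y = (\<lambda>j. \<Sum>t\<in>I. b t y *\<^sub>C word_row t j)" for y
  have delta_row: "(\<Sum>t\<in>I. (if t = s then c else 0) *\<^sub>C word_row t j) = c *\<^sub>C word_row s j" if "s \<in> I" for s c j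
  proof -
    have "(\<Sum>t\<in>I. (if t = s then c else 0) *\<^sub>C word_row t j) = (\<Sum>t\<in>I. if t = s then c *\<^sub>C word_row t j else 0)"
      by (rule sum.cong) auto
    then show ?thesis using that finite_I by simp
  qed
  have rb_state: "rb (Inl (Inl s)) j = k *\<^sub>C word_row s j" if "s \<in> I" for s j
    unfolding rb_def b_def sum.case using delta_row[OF that, of k j] by (simp only: eq_commute)
  have rb_rel: "rb (Inl (Inr s)) j = complex_of_real (sqrt (\<gamma> s)) *\<^sub>C word_row s j" if "s \<in> N" for s j
    unfolding rb_def b_def sum.case using delta_row[of s "complex_of_real (sqrt (\<gamma> s))" j] that N_sub
    by (simp only: eq_commute subsetD)
  obtain sl where sl: "set sl = I <+> N" "distinct sl"
    using finite_distinct_list[of "I <+> N"] finite_I finite_N by (auto simp: finite_Plus)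
  have "([], 0) \<in> I" using m empty_word by blast
  then have "sl \<noteq> []" using sl(1) by auto
  define xs where "xs = map Inl sl @ map Inr [0..<m]"
  define ys where "ys = map (\<lambda>r. Inr (Inl r :: nat + 'a bop list \<times> nat)) [0..<n] @ map Inl sl"
  have set_xs: "set xs = (I <+> N) <+> {..<m}" using sl by (auto simp: xs_def)
  have dxs: "distinct xs" "xs \<noteq> []" using sl \<open>sl \<noteq> []\<close> by (auto simp: xs_def distinct_map)
  have dys: "distinct ys" "ys \<noteq> []" using sl \<open>sl \<noteq> []\<close> by (auto simp: ys_def distinct_map inj_on_def)
  have set_ys: "set ys \<subseteq> (I <+> N) <+> ({..<n} <+> I)" using sl by (auto simp: ys_def)
  define src where "src x = (case x of Inl y \<Rightarrow> rb (Inl y)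
    | Inr i \<Rightarrow> (\<lambda>j. complex_of_real (sqrt (1 + \<epsilon>)) *\<^sub>C word_row ([], i) j))" for x
  define D where "D y x = (case (y, x) of
      (Inl (Inl s), Inl (Inl t)) \<Rightarrow> (if s = t then 1 else 0) - complex_of_real \<tau> *\<^sub>C X s t
    | (Inl (Inr s), Inl (Inr t)) \<Rightarrow> (if s = t then adj (letter s) else 0)
    | (Inr i, Inr j) \<Rightarrow> (if i = j then 1 else 0)
    | _ \<Rightarrow> 0)" for y x :: "('a bop list \<times> nat + 'a bop list \<times> nat) + nat"
  have "lin_step E (map src xs) (map ra xs)"
  proof (rule lin_step_map[where c = D])
    fix y x assume "y \<in> set xs" "x \<in> set xs"
    then show "D y x \<in> E"
      unfolding set_xs D_def
      by (auto intro!: E_diff E_minus E_scale X_E E0 E1 E_adj split: sum.splits)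
  next
    fix h :: "('a bop list \<times> nat + 'a bop list \<times> nat) + nat \<Rightarrow> 'a"
    define h1 h2 h3 where "h1 s = h (Inl (Inl s))" and "h2 s = h (Inl (Inr s))" and "h3 j = h (Inr j)" for s j
    have D1: "(\<Sum>t\<in>I. bop_apply ((if s = t then 1 else 0) - complex_of_real \<tau> *\<^sub>C X s t) (h1 t)) =
        h1 s - complex_of_real \<tau> *\<^sub>C Xh h1 s" if "s \<in> I" for s
    proof -
      have "bop_apply ((if s = t then 1 else 0) - complex_of_real \<tau> *\<^sub>C X s t) (h1 t) =
          (if s = t then h1 t else 0) - complex_of_real \<tau> *\<^sub>C bop_apply (X s t) (h1 t)" for t
        by (simp add: bop_rep)
      then show ?thesis using that finite_I
        by (simp add: sum_subtractf complex_vector.scale_sum_right[symmetric] Xh_def)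
    qed
    have Dd: "(\<Sum>t\<in>T. bop_apply (if s = t then A s else 0) (g t)) = bop_apply (A s) (g s)"
      if "finite T" "s \<in> T" for s T A and g :: "'k \<Rightarrow> 'a"
    proof -
      have "(\<Sum>t\<in>T. bop_apply (if s = t then A s else 0) (g t)) =
          (\<Sum>t\<in>T. if s = t then bop_apply (A s) (g t) else 0)"
        by (rule sum.cong) (auto simp: bop_rep)
      then show ?thesis using that by simp
    qed
    have "(\<Sum>y\<in>set xs. (norm (\<Sum>x\<in>set xs. bop_apply (D y x) (h x)))\<^sup>2) =
        (\<Sum>s\<in>I. (norm (h1 s - complex_of_real \<tau> *\<^sub>C Xh h1 s))\<^sup>2) +
        (\<Sum>s\<in>N. (norm (bop_apply (adj (letter s)) (h2 s)))\<^sup>2) + (\<Sum>j<m. (norm (h3 j))\<^sup>2)"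
    proof -
      have inner: "(\<Sum>x\<in>set xs. bop_apply (D y x) (h x)) = (\<Sum>t\<in>I. bop_apply (D y (Inl (Inl t))) (h1 t))
          + (\<Sum>t\<in>N. bop_apply (D y (Inl (Inr t))) (h2 t)) + (\<Sum>j<m. bop_apply (D y (Inr j)) (h3 j))" for y
        unfolding set_xs h1_def h2_def h3_def using finite_I finite_N by (simp add: sum.Plus finite_Plus)
      have "(\<Sum>x\<in>set xs. bop_apply (D (Inl (Inl s)) x) (h x)) = h1 s - complex_of_real \<tau> *\<^sub>C Xh h1 s"
        if "s \<in> I" for s
        unfolding inner using D1[OF that] by (simp add: D_def zero_bop.rep_eq)
      moreover have "(\<Sum>x\<in>set xs. bop_apply (D (Inl (Inr s)) x) (h x)) = bop_apply (adj (letter s)) (h2 s)"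
        if "s \<in> N" for s
        unfolding inner using Dd[OF finite_N that, of "\<lambda>s. adj (letter s)" h2]
        by (simp add: D_def zero_bop.rep_eq)
      moreover have "(\<Sum>x\<in>set xs. bop_apply (D (Inr j) x) (h x)) = h3 j" if "j < m" for j
        unfolding inner using Dd[of "{..<m}" j "\<lambda>_. 1" h3] that
        by (simp add: D_def zero_bop.rep_eq one_bop.rep_eq)
      moreover have "(\<Sum>y\<in>set xs. F y) = (\<Sum>s\<in>I. F (Inl (Inl s))) + (\<Sum>s\<in>N. F (Inl (Inr s))) + (\<Sum>j<m. F (Inr j))"
        for F :: "_ \<Rightarrow> real"
        unfolding set_xs using finite_I finite_N by (simp add: sum.Plus finite_Plus)
      ultimately show ?thesis by simp
    qed
    also have "\<dots> = (\<Sum>s\<in>I. (norm (h1 s - complex_of_real \<tau> *\<^sub>C Xh h1 s))\<^sup>2) +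
        (\<Sum>s\<in>N. (norm (h2 s))\<^sup>2) + (\<Sum>j<m. (norm (h3 j))\<^sup>2)"
      by (simp add: norm_unitary unitary_adj unitary_N)
    also have "\<dots> \<le> (\<Sum>s\<in>I. (norm (h1 s))\<^sup>2) + (\<Sum>s\<in>N. (norm (h2 s))\<^sup>2) + (\<Sum>j<m. (norm (h3 j))\<^sup>2)"
      using contrX[of h1] by simp
    also have "\<dots> = (\<Sum>x\<in>set xs. (norm (h x))\<^sup>2)"
      unfolding set_xs using finite_I finite_N
      by (simp add: sum.Plus finite_Plus h1_def h2_def h3_def)
    finally show "(\<Sum>y\<in>set xs. (norm (\<Sum>x\<in>set xs. bop_apply (D y x) (h x)))\<^sup>2) \<le> (\<Sum>x\<in>set xs. (norm (h x))\<^sup>2)" .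
  next
    fix y j assume y: "y \<in> set xs"
    have expand: "(\<Sum>x\<in>set xs. D y x * src x j) = (\<Sum>t\<in>I. D y (Inl (Inl t)) * src (Inl (Inl t)) j)
        + (\<Sum>t\<in>N. D y (Inl (Inr t)) * src (Inl (Inr t)) j) + (\<Sum>i<m. D y (Inr i) * src (Inr i) j)"
      unfolding set_xs using finite_I finite_N by (simp add: sum.Plus finite_Plus)
    have Dd: "(\<Sum>t\<in>T. (if s = t then A else 0) * (g t :: 'a bop)) = A * g s"
      if "finite T" "s \<in> T" for s T A and g :: "'k \<Rightarrow> 'a bop"
      using that by (simp add: if_distrib[of "\<lambda>x. x * _"] cong: if_cong)
    consider s where "y = Inl (Inl s)" "s \<in> I" | s where "y = Inl (Inr s)" "s \<in> N"
      | i where "y = Inr i" "i < m" using y unfolding set_xs by blast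
    then show "ra y j = (\<Sum>x\<in>set xs. D y x * src x j)"
    proof cases
      case 1
      have "(\<Sum>x\<in>set xs. D y x * src x j) = (\<Sum>t\<in>I. k *\<^sub>C (((if s = t then 1 else 0) - complex_of_real \<tau> *\<^sub>C X s t) * word_row t j))"
        unfolding expand unfolding 1(1) by (simp add: D_def src_def rb_state bop_scaleC_mult)
      also have "\<dots> = k *\<^sub>C (word_row s j - complex_of_real \<tau> *\<^sub>C (\<Sum>t\<in>I. X s t * word_row t j))"
        using 1(2) finite_I
        by (simp add: complex_vector.scale_sum_right[symmetric] left_diff_distrib sum_subtractf Dd
            bop_scaleC_mult)
      also have "\<dots> = k *\<^sub>C (word_row s j - (\<Sum>t\<in>I. (complex_of_real \<tau> * S s t) *\<^sub>C word_row t j))"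
        unfolding X_row[OF 1(2)] by (simp add: complex_vector.scale_sum_right scaleC_scaleC)
      also have "word_row s j = (\<Sum>t\<in>I. (if s = t then 1 else 0) *\<^sub>C word_row t j)"
        using delta_row[OF 1(2), of 1 j] by (simp only: eq_commute scaleC_one)
      also have "k *\<^sub>C (\<dots> - (\<Sum>t\<in>I. (complex_of_real \<tau> * S s t) *\<^sub>C word_row t j)) = ra y j"
        unfolding 1(1) ra_def a_def sum.case scaleC_scaleC[symmetric]
        unfolding sum_subtractf[symmetric] complex_vector.scale_left_diff_distrib[symmetric]
          complex_vector.scale_sum_right scaleC_scaleC ..
      finally show ?thesis ..
    next
      case 2
      have "(\<Sum>x\<in>set xs. D y x * src x j) = (\<Sum>t\<in>N. (if s = t then adj (letter s) else 0) * rb (Inl (Inr t)) j)"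
        unfolding expand unfolding 2(1) by (simp add: D_def src_def)
      also have "\<dots> = complex_of_real (sqrt (\<gamma> s)) *\<^sub>C (adj (letter s) * word_row s j)"
        unfolding Dd[OF finite_N 2(2), of "adj (letter s)"] by (simp add: rb_rel[OF 2(2)] bop_scaleC_mult)
      also have "word_row s j = letter s * word_row (par s) j"
        using N_cases[OF 2(2)] by (auto simp: word_row_def letter_def par_def)
      also have "adj (letter s) * \<dots> = word_row (par s) j"
        using unitary_N[OF 2(2)] by (simp add: unitary_op_def mult.assoc[symmetric])
      also have "complex_of_real (sqrt (\<gamma> s)) *\<^sub>C word_row (par s) j = ra y j"
        unfolding 2(1) ra_def a_def sum.case
        using delta_row[OF par_I[OF 2(2)], of "complex_of_real (sqrt (\<gamma> s))" j] by (simp only: eq_commute)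
      finally show ?thesis ..
    next
      case 3
      have "(\<Sum>x\<in>set xs. D y x * src x j) = src (Inr i) j"
        unfolding expand unfolding 3(1) using 3(2) by (simp add: D_def Dd)
      also have "\<dots> = ra y j"
        unfolding 3(1) ra_def a_def src_def sum.case
        using delta_row[of "([], i)" "complex_of_real (sqrt (1 + \<epsilon>))" j] 3(2) empty_word by simp
      finally show ?thesis ..
    qed
  qed (use dxs in auto)
  moreover have "lin_step E (map ra xs) (map rb ys)"
  proof (rule lin_step_map[where c = "\<lambda>y x. U y x *\<^sub>C 1"])
    fix h :: "('a bop list \<times> nat + 'a bop list \<times> nat) + nat \<Rightarrow> 'a"
    have "(\<Sum>y\<in>set ys. (norm (\<Sum>x\<in>set xs. bop_apply (U y x *\<^sub>C 1) (h x)))\<^sup>2) \<le>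
        (\<Sum>y\<in>(I <+> N) <+> ({..<n} <+> I). (norm (\<Sum>x\<in>set xs. bop_apply (U y x *\<^sub>C 1) (h x)))\<^sup>2)"
      using set_ys finite_I finite_N by (intro sum_mono2) (auto simp: finite_Plus)
    also have "\<dots> \<le> (\<Sum>x\<in>set xs. (norm (h x))\<^sup>2)"
      unfolding set_xs using Uc[of h] by (simp add: bop_rep)
    finally show "(\<Sum>y\<in>set ys. (norm (\<Sum>x\<in>set xs. bop_apply (U y x *\<^sub>C 1) (h x)))\<^sup>2) \<le> (\<Sum>x\<in>set xs. (norm (h x))\<^sup>2)" .
  next
    fix y j assume y: "y \<in> set ys"
    have "(\<Sum>x\<in>set xs. (U y x *\<^sub>C 1) * ra x j) = (\<Sum>x\<in>set xs. \<Sum>t\<in>I. (U y x * a t x) *\<^sub>C word_row t j)"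
      by (simp add: ra_def bop_scaleC_mult complex_vector.scale_sum_right scaleC_scaleC)
    also have "\<dots> = (\<Sum>t\<in>I. (\<Sum>x\<in>set xs. U y x * a t x) *\<^sub>C word_row t j)"
      unfolding complex_vector.scale_sum_left by (rule sum.swap)
    also have "\<dots> = rb y j"
      unfolding rb_def set_xs using Ua[OF _ subsetD[OF set_ys y]] by (intro sum.cong) simp_all
    finally show "rb y j = (\<Sum>x\<in>set xs. (U y x *\<^sub>C 1) * ra x j)" ..
  qed (use dxs dys E_scale[OF E1] in auto)
  ultimately have steps: "(lin_step E)\<^sup>+\<^sup>+ (map src xs) (map rb ys)"
    by (blast intro: tranclp.intros)
  define z where "z = map (\<lambda>y. rb (Inl y)) sl"
  have "map src xs = z @ map (\<lambda>i j. complex_of_real (sqrt (1 + \<epsilon>)) *\<^sub>C word_row ([], i) j) [0..<m]"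
    by (simp add: xs_def z_def src_def comp_def)
  moreover have "map rb ys = map (\<lambda>r j. \<Sum>t\<in>I. p r t *\<^sub>C word_row t j) [0..<n] @ z"
    by (simp add: ys_def z_def comp_def rb_def[of "Inr (Inl _)"] b_def)
  moreover have "\<exists>c. \<exists>t\<in>I. y = (\<lambda>j. c *\<^sub>C word_row t j)" if "y \<in> set z" for y
  proof -
    have "y \<in> (\<lambda>y. rb (Inl y)) ` (I <+> N)" using that sl(1) by (simp add: z_def)
    then obtain x where x: "x \<in> I <+> N" "y = rb (Inl x)" by blast
    from x(1) show ?thesis
    proof
      fix s assume "x = Inl s" "s \<in> I"
      then show ?thesis using x(2) rb_state by blast
    next
      fix s assume "x = Inr s" "s \<in> N"
      then show ?thesis using x(2) rb_rel N_sub by blast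
    qed
  qed
  moreover have "z \<noteq> []" using \<open>sl \<noteq> []\<close> by (simp add: z_def)
  ultimately show thesis using that[of z] steps by simp
qed

end

section \<open>From steps to matrix factors\<close>

lemma mat_opnorm_bound:
  fixes h :: "nat \<Rightarrow> 'a::chilbert_space"
  shows "(\<Sum>i<dim_row A. (norm (\<Sum>j<dim_col A. bop_apply (A $$ (i, j)) (h j)))\<^sup>2)
    \<le> (mat_opnorm A)\<^sup>2 * (\<Sum>j<dim_col A. (norm (h j))\<^sup>2)"
proof -
  define s where "s = (\<Sum>j<dim_col A. (norm (h j))\<^sup>2)"
  show ?thesis
  proof (cases "s = 0")
    case True
    then have "h j = 0" if "j < dim_col A" for j
      using that by (simp add: s_def sum_nonneg_eq_0_iff)
    then show ?thesis by (simp add: bop_apply_0)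
  next
    case False
    then have s: "s > 0" by (simp add: s_def less_le sum_nonneg)
    define v where "v = vec (dim_col A) (\<lambda>j. (1 / sqrt s) *\<^sub>R h j)"
    have "(\<Sum>j<dim_col A. (norm (v $ j))\<^sup>2) = (\<Sum>j<dim_col A. (norm (h j))\<^sup>2 / s)"
      using s by (intro sum.cong) (simp_all add: v_def power_mult_distrib power_divide)
    also have "\<dots> = 1" using s by (simp add: sum_divide_distrib[symmetric] s_def[symmetric])
    finally have "dsum_norm v \<le> 1" by (simp add: dsum_norm_def L2_set_def v_def)
    then have "dsum_norm (mat_apply A v) \<le> mat_opnorm A"
      unfolding mat_opnorm_def by (intro cSUP_upper mat_opnorm_bdd_above) (simp add: v_def)
    then have "(dsum_norm (mat_apply A v))\<^sup>2 \<le> (mat_opnorm A)\<^sup>2"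
      by (intro power_mono) (simp_all add: dsum_norm_def)
    also have "(dsum_norm (mat_apply A v))\<^sup>2 =
        (\<Sum>i<dim_row A. (norm (\<Sum>j<dim_col A. bop_apply (A $$ (i, j)) (v $ j)))\<^sup>2)"
      by (simp add: dsum_norm_def L2_set_def mat_apply_def sum_nonneg)
    also have "\<dots> = (\<Sum>i<dim_row A. (norm (\<Sum>j<dim_col A. bop_apply (A $$ (i, j)) (h j)))\<^sup>2 / s)"
    proof (rule sum.cong[OF refl])
      fix i
      have "(\<Sum>j<dim_col A. bop_apply (A $$ (i, j)) (v $ j)) =
          (1 / sqrt s) *\<^sub>R (\<Sum>j<dim_col A. bop_apply (A $$ (i, j)) (h j))"
        by (simp add: v_def scaleR_scaleC bop_apply_scaleC complex_vector.scale_sum_right)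
      then show "(norm (\<Sum>j<dim_col A. bop_apply (A $$ (i, j)) (v $ j)))\<^sup>2 =
          (norm (\<Sum>j<dim_col A. bop_apply (A $$ (i, j)) (h j)))\<^sup>2 / s"
        using s by (simp add: power_mult_distrib power_divide)
    qed
    finally show ?thesis
      using s by (simp add: sum_divide_distrib[symmetric] divide_le_eq s_def[symmetric])
  qed
qed

lemma mat_opnorm_le:
  fixes A :: "'a::chilbert_space bop mat"
  assumes c: "0 \<le> c" and bound: "\<And>h. (\<Sum>i<dim_row A. (norm (\<Sum>j<dim_col A. bop_apply (A $$ (i, j)) (h j)))\<^sup>2)
    \<le> c\<^sup>2 * (\<Sum>j<dim_col A. (norm (h j))\<^sup>2)"
  shows "mat_opnorm A \<le> c"
  unfolding mat_opnorm_def
proof (rule cSUP_least)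
  have "vec (dim_col A) (\<lambda>_. 0 :: 'a) \<in> {v \<in> carrier_vec (dim_col A). dsum_norm v \<le> 1}"
    by (simp add: dsum_norm_def L2_set_def)
  then show "{v \<in> carrier_vec (dim_col A). dsum_norm (v :: 'a vec) \<le> 1} \<noteq> {}" by blast
next
  fix v :: "'a vec" assume v: "v \<in> {v \<in> carrier_vec (dim_col A). dsum_norm v \<le> 1}"
  then have "(\<Sum>j<dim_col A. (norm (v $ j))\<^sup>2) \<le> 1"
    by (auto simp: dsum_norm_def L2_set_def)
  then have "c\<^sup>2 * (\<Sum>j<dim_col A. (norm (v $ j))\<^sup>2) \<le> c\<^sup>2" by (simp add: mult_left_le)
  then have "(\<Sum>i<dim_row A. (norm (\<Sum>j<dim_col A. bop_apply (A $$ (i, j)) (v $ j)))\<^sup>2) \<le> c\<^sup>2"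
    using bound[of "\<lambda>j. v $ j"] by linarith
  then show "dsum_norm (mat_apply A v) \<le> c"
    using c by (simp add: dsum_norm_def L2_set_def mat_apply_def real_le_lsqrt)
qed

abbreviation smul_rows :: "complex \<Rightarrow> (nat \<Rightarrow> 'a::chilbert_space bop) list \<Rightarrow> (nat \<Rightarrow> 'a bop) list" where
  "smul_rows c X \<equiv> map (\<lambda>y j. c *\<^sub>C y j) X"

lemma smul_rows_smul_rows: "smul_rows c (smul_rows d X) = smul_rows (c * d) X"
  by (simp add: scaleC_scaleC)

lemma lin_step_factor:
  assumes "lin_step E X Y" and E: "\<And>c A. A \<in> E \<Longrightarrow> c *\<^sub>C A \<in> E" and r: "0 \<le> r" "r < 1"
  obtains Q where "Q \<in> mats_over E" "mat_opnorm Q < 1" "dim_row Q = length Y" "dim_col Q = length X"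
    "\<And>m. mat (length Y) m (\<lambda>(i, j). complex_of_real r *\<^sub>C (Y ! i) j) =
      Q * mat (length X) m (\<lambda>(i, j). (X ! i) j)"
proof -
  obtain q where q: "\<And>i l. i < length Y \<Longrightarrow> l < length X \<Longrightarrow> q i l \<in> E"
    "\<And>h. (\<Sum>i<length Y. (norm (\<Sum>l<length X. bop_apply (q i l) (h l)))\<^sup>2) \<le> (\<Sum>l<length X. (norm (h l))\<^sup>2)"
    "\<And>i j. i < length Y \<Longrightarrow> (Y ! i) j = (\<Sum>l<length X. q i l * (X ! l) j)"
    and ne: "X \<noteq> []" "Y \<noteq> []"
    using assms(1) unfolding lin_step_def by blast
  define Q where "Q = mat (length Y) (length X) (\<lambda>(i, l). complex_of_real r *\<^sub>C q i l)"
  have "mat_opnorm Q \<le> r"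
  proof (rule mat_opnorm_le[OF r(1)])
    fix h :: "nat \<Rightarrow> 'a"
    have "(\<Sum>i<dim_row Q. (norm (\<Sum>j<dim_col Q. bop_apply (Q $$ (i, j)) (h j)))\<^sup>2) =
        r\<^sup>2 * (\<Sum>i<length Y. (norm (\<Sum>l<length X. bop_apply (q i l) (h l)))\<^sup>2)"
      unfolding sum_distrib_left using r
      by (intro sum.cong) (simp_all add: Q_def bop_rep complex_vector.scale_sum_right[symmetric]
          norm_scaleC power_mult_distrib)
    then show "(\<Sum>i<dim_row Q. (norm (\<Sum>j<dim_col Q. bop_apply (Q $$ (i, j)) (h j)))\<^sup>2)
        \<le> r\<^sup>2 * (\<Sum>j<dim_col Q. (norm (h j))\<^sup>2)"
      using mult_left_mono[OF q(2)[of h], of "r\<^sup>2"] by (simp add: Q_def)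
  qed
  moreover have "Q \<in> mats_over E"
    using ne by (auto simp: mats_over_def elements_mat_def Q_def intro!: E q)
  moreover have "mat (length Y) m (\<lambda>(i, j). complex_of_real r *\<^sub>C (Y ! i) j) =
      Q * mat (length X) m (\<lambda>(i, j). (X ! i) j)" for m
    by (rule eq_matI)
      (simp_all add: Q_def scalar_prod_def q(3) complex_vector.scale_sum_right bop_scaleC_mult
        atLeast0LessThan)
  ultimately show thesis using r by (intro that[of Q]) (auto simp: Q_def)
qed

text \<open>A scalar \<open>r < 1\<close> is shared among the factors by splitting \<open>r = \<surd>r \<surd>r\<close> at every step, which makes each
factor strictly contractive.\<close>

lemma steps_factor:
  assumes "(lin_step E)\<^sup>+\<^sup>+ X Y" and E: "\<And>c A. A \<in> E \<Longrightarrow> c *\<^sub>C A \<in> E"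
    and "0 \<le> r" "r < 1"
  shows "\<exists>Ps. Ps \<noteq> [] \<and> composable Ps \<and> (\<forall>Q\<in>set Ps. Q \<in> mats_over E \<and> mat_opnorm Q < 1) \<and>
    dim_row (hd Ps) = length Y \<and> mat_prod Ps \<in> carrier_mat (length Y) (length X) \<and>
    (\<forall>m. mat (length Y) m (\<lambda>(i, j). complex_of_real r *\<^sub>C (Y ! i) j) =
      mat_prod Ps * mat (length X) m (\<lambda>(i, j). (X ! i) j))"
  using assms(1,3,4)
proof (induction arbitrary: r rule: tranclp_induct)
  case (base Y)
  obtain Q where Q: "Q \<in> mats_over E" "mat_opnorm Q < 1" "dim_row Q = length Y" "dim_col Q = length X"
    "\<And>m. mat (length Y) m (\<lambda>(i, j). complex_of_real r *\<^sub>C (Y ! i) j) =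
      Q * mat (length X) m (\<lambda>(i, j). (X ! i) j)"
    using lin_step_factor[OF base.hyps E base.prems] by blast
  then show ?case by (intro exI[of _ "[Q]"]) (auto simp: composable_def)
next
  case (step Y Z)
  have r': "0 \<le> sqrt r" "sqrt r < 1" using step.prems by auto
  obtain Ps where Ps: "Ps \<noteq> []" "composable Ps" "\<And>Q. Q \<in> set Ps \<Longrightarrow> Q \<in> mats_over E \<and> mat_opnorm Q < 1"
    "dim_row (hd Ps) = length Y" "mat_prod Ps \<in> carrier_mat (length Y) (length X)"
    "\<And>m. mat (length Y) m (\<lambda>(i, j). complex_of_real (sqrt r) *\<^sub>C (Y ! i) j) =
      mat_prod Ps * mat (length X) m (\<lambda>(i, j). (X ! i) j)"
    using step.IH[OF r'] by blast
  obtain Q where Q: "Q \<in> mats_over E" "mat_opnorm Q < 1" "dim_row Q = length Z" "dim_col Q = length Y"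
    "\<And>m. mat (length Z) m (\<lambda>(i, j). complex_of_real (sqrt r) *\<^sub>C
        (smul_rows (complex_of_real (sqrt r)) Z ! i) j) =
      Q * mat (length Y) m (\<lambda>(i, j). (smul_rows (complex_of_real (sqrt r)) Y ! i) j)"
    using lin_step_factor[OF lin_step_scale[OF step.hyps(2)] E r'] unfolding length_map by blast
  have prod: "mat_prod (Q # Ps) = Q * mat_prod Ps" using Ps(1) by (cases Ps) auto
  have Qc: "Q \<in> carrier_mat (length Z) (length Y)" using Q by auto
  have "mat (length Z) m (\<lambda>(i, j). complex_of_real r *\<^sub>C (Z ! i) j) =
      mat_prod (Q # Ps) * mat (length X) m (\<lambda>(i, j). (X ! i) j)" for m
  proof -
    have "complex_of_real (sqrt r) * complex_of_real (sqrt r) = complex_of_real r"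
      using step.prems by (simp add: of_real_mult[symmetric] del: of_real_mult)
    then have "mat (length Z) m (\<lambda>(i, j). complex_of_real r *\<^sub>C (Z ! i) j) =
        mat (length Z) m (\<lambda>(i, j). complex_of_real (sqrt r) *\<^sub>C
          (smul_rows (complex_of_real (sqrt r)) Z ! i) j)"
      by (intro eq_matI) (simp_all add: scaleC_scaleC)
    also have "\<dots> = Q * mat (length Y) m (\<lambda>(i, j). complex_of_real (sqrt r) *\<^sub>C (Y ! i) j)"
      unfolding Q(5) by (rule arg_cong[of _ _ "(*) Q"]) (auto intro!: eq_matI)
    also have "\<dots> = mat_prod (Q # Ps) * mat (length X) m (\<lambda>(i, j). (X ! i) j)"
      unfolding Ps(6) prod by (rule assoc_mult_mat[OF Qc Ps(5) mat_carrier, symmetric])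
    finally show ?thesis .
  qed
  moreover have "composable (Q # Ps)"
    using Ps(1,2,4) Q(4) by (auto simp: composable_def successively_Cons)
  moreover have "mat_prod (Q # Ps) \<in> carrier_mat (length Z) (length X)"
    unfolding prod using Qc Ps(5) by (rule mult_carrier_mat)
  ultimately show ?case using Ps(3) Q by (intro exI[of _ "Q # Ps"]) auto
qed

section \<open>Scalar steps, recycling, and the cost of a column\<close>

lemma concat_rows_as_map:
  "concat (map (\<lambda>i. map (f i) ys) xs) = map (\<lambda>(i, y). f i y) (List.product xs ys)"
  by (induction xs) (simp_all add: comp_def)

lemma lin_step_copies:
  fixes X :: "(nat \<Rightarrow> 'a::chilbert_space bop) list"
  assumes E: "\<And>c. c *\<^sub>C 1 \<in> E" and X: "X \<noteq> []" and as: "as \<noteq> []" "(\<Sum>a\<leftarrow>as. a\<^sup>2) \<le> 1"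
  shows "lin_step E X (concat (map (\<lambda>a. smul_rows (complex_of_real a) X) as))"
proof -
  let ?xs = "[0..<length X]" and ?is = "[0..<length as]"
  define g where "g = (\<lambda>(i, l) j. complex_of_real (as ! i) *\<^sub>C (X ! l) j)"
  have E0: "0 \<in> E" using E[of 0] by simp
  have "lin_step E (map ((!) X) ?xs) (map g (List.product ?is ?xs))"
  proof (rule lin_step_map[where c = "\<lambda>(i, l) l'. if l = l' then complex_of_real (as ! i) *\<^sub>C 1 else 0"])
    show "List.product ?is ?xs \<noteq> []"
      using X as unfolding length_greater_0_conv[symmetric] length_product by simp
    show "distinct (List.product ?is ?xs)" by (simp add: distinct_product)
  next
    fix h :: "nat \<Rightarrow> 'a"
    have *: "(\<Sum>x<length X. bop_apply (if l = x then complex_of_real a *\<^sub>C 1 else 0) (h x)) = complex_of_real a *\<^sub>C h l"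
      if "l < length X" for l a
    proof -
      have "(\<Sum>x<length X. bop_apply (if l = x then complex_of_real a *\<^sub>C 1 else 0) (h x)) =
          (\<Sum>x<length X. if l = x then complex_of_real a *\<^sub>C h x else 0)"
        by (rule sum.cong) (auto simp: bop_rep)
      then show ?thesis using that by simp
    qed
    have "(\<Sum>y\<in>{..<length as} \<times> {..<length X}. (norm (\<Sum>x<length X. bop_apply
        (case y of (i, l) \<Rightarrow> (if l = x then complex_of_real (as ! i) *\<^sub>C 1 else 0)) (h x)))\<^sup>2) =
        (\<Sum>i<length as. \<Sum>l<length X. (as ! i)\<^sup>2 * (norm (h l))\<^sup>2)"
      unfolding sum.cartesian_product
      by (rule sum.cong) (auto simp: * norm_scaleC power_mult_distrib)
    also have "\<dots> = (\<Sum>i<length as. (as ! i)\<^sup>2) * (\<Sum>l<length X. (norm (h l))\<^sup>2)"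
      by (simp add: sum_product)
    also have "\<dots> \<le> 1 * (\<Sum>l<length X. (norm (h l))\<^sup>2)"
      using as(2) by (intro mult_right_mono) (simp_all add: sum_nonneg sum_list_sum_nth atLeast0LessThan)
    finally show "(\<Sum>y\<in>set (List.product ?is ?xs). (norm (\<Sum>x\<in>set ?xs. bop_apply
        ((\<lambda>(i, l) l'. if l = l' then complex_of_real (as ! i) *\<^sub>C 1 else 0) y x) (h x)))\<^sup>2)
        \<le> (\<Sum>x\<in>set ?xs. (norm (h x))\<^sup>2)"
      by (simp add: atLeast0LessThan case_prod_beta)
  next
    fix y j assume "y \<in> set (List.product ?is ?xs)"
    then show "g y j = (\<Sum>x\<in>set ?xs. (\<lambda>(i, l) l'. if l = l' then complex_of_real (as ! i) *\<^sub>C 1 else 0) y x * (X ! x) j)"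
      by (auto simp: g_def if_distrib[of "\<lambda>x. x * _"] bop_scaleC_mult cong: if_cong)
  qed (use X E E0 in auto)
  moreover have "map g (List.product ?is ?xs) = concat (map (\<lambda>a. smul_rows (complex_of_real a) X) as)"
  proof -
    have "map g (List.product ?is ?xs) = concat (map (\<lambda>i. map (\<lambda>l j. complex_of_real (as ! i) *\<^sub>C (X ! l) j) ?xs) ?is)"
      unfolding concat_rows_as_map g_def by simp
    also have "\<dots> = concat (map (\<lambda>i. smul_rows (complex_of_real (as ! i)) X) ?is)"
    proof -
      have "map (\<lambda>l j. c *\<^sub>C (X ! l) j) ?xs = smul_rows c X" for c
        by (rule nth_equalityI) simp_all
      then show ?thesis by simp
    qed
    also have "map (\<lambda>i. smul_rows (complex_of_real (as ! i)) X) ?is = map (\<lambda>a. smul_rows (complex_of_real a) X) as"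
      by (rule nth_equalityI) simp_all
    finally show ?thesis .
  qed
  ultimately show ?thesis by (simp add: map_nth)
qed

lemma lin_step_take:
  fixes X :: "(nat \<Rightarrow> 'a::chilbert_space bop) list"
  assumes E: "0 \<in> E" "1 \<in> E" and X: "X \<noteq> []"
  shows "lin_step E (X @ Y) X"
proof -
  have "lin_step E (map ((!) (X @ Y)) [0..<length (X @ Y)]) (map ((!) X) [0..<length X])"
  proof (rule lin_step_map[where c = "\<lambda>y x. if y = x then 1 else 0"])
    fix h :: "nat \<Rightarrow> 'a"
    have "(\<Sum>x<length (X @ Y). bop_apply (if y = x then 1 else 0) (h x)) = h y" if "y < length X" for y
    proof -
      have "(\<Sum>x<length (X @ Y). bop_apply (if y = x then 1 else 0) (h x)) =
          (\<Sum>x<length (X @ Y). if y = x then h x else 0)"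
        by (rule sum.cong) (auto simp: bop_rep)
      then show ?thesis using that by simp
    qed
    then have "(\<Sum>y<length X. (norm (\<Sum>x<length (X @ Y). bop_apply (if y = x then 1 else 0) (h x)))\<^sup>2)
        = (\<Sum>y<length X. (norm (h y))\<^sup>2)"
      by simp
    also have "\<dots> \<le> (\<Sum>x<length (X @ Y). (norm (h x))\<^sup>2)"
      by (rule sum_mono2) auto
    finally show "(\<Sum>y\<in>set [0..<length X]. (norm (\<Sum>x\<in>set [0..<length (X @ Y)].
        bop_apply (if y = x then 1 else 0) (h x)))\<^sup>2) \<le> (\<Sum>x\<in>set [0..<length (X @ Y)]. (norm (h x))\<^sup>2)"
      by (simp only: set_upt atLeast0LessThan)
  next
    fix y j assume "y \<in> set [0..<length X]"
    then show "(X ! y) j = (\<Sum>x\<in>set [0..<length (X @ Y)]. (if y = x then 1 else 0) * ((X @ Y) ! x) j)"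
      by (simp add: if_distrib[of "\<lambda>x. x * _"] nth_append cong: if_cong)
  qed (use X E in auto)
  then show ?thesis by (simp only: map_nth)
qed

lemma norm_sum_sq_le:
  fixes f :: "'i \<Rightarrow> 'a::real_normed_vector"
  shows "(norm (\<Sum>i\<in>S. f i))\<^sup>2 \<le> real (card S) * (\<Sum>i\<in>S. (norm (f i))\<^sup>2)"
proof -
  have "(norm (\<Sum>i\<in>S. f i))\<^sup>2 \<le> (\<Sum>i\<in>S. norm (f i) * 1)\<^sup>2"
    by (rule power_mono) (simp_all add: norm_sum)
  also have "\<dots> \<le> (\<Sum>i\<in>S. (norm (f i))\<^sup>2) * (\<Sum>i\<in>S. 1\<^sup>2)"
    by (rule Cauchy_Schwarz_ineq_sum)
  finally show ?thesis by (simp add: mult.commute)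
qed

text \<open>The row \<open>(1, \<dots>, 1) / \<surd>N\<close> is a contraction and carries \<open>N\<close> copies of \<open>X\<close> to \<open>\<surd>N X\<close>.\<close>

lemma lin_step_average:
  fixes X :: "(nat \<Rightarrow> 'a::chilbert_space bop) list"
  assumes E: "\<And>c. c *\<^sub>C 1 \<in> E" and X: "X \<noteq> []" and N: "N > 0"
  shows "lin_step E (concat (replicate N X) @ Y) (smul_rows (complex_of_real (sqrt N)) X)"
proof -
  define k where "k = complex_of_real (1 / sqrt N)"
  let ?xs = "map Inl (List.product [0..<N] [0..<length X]) @ map Inr [0..<length Y]"
  define f where "f = case_sum (\<lambda>(i :: nat, l). X ! l) ((!) Y)"
  define c where "c l x = (case x of Inl (i, l') \<Rightarrow> if l = l' then k *\<^sub>C (1 :: 'a bop) else 0 | Inr _ \<Rightarrow> 0)"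
    for l :: nat and x :: "nat \<times> nat + nat"
  have E0: "0 \<in> E" using E[of 0] by simp
  have sxs: "set ?xs = ({..<N} \<times> {..<length X}) <+> {..<length Y}"
    by (auto simp: atLeast0LessThan)
  have sum_c: "(\<Sum>x\<in>set ?xs. F (c l x) x) = (\<Sum>i<N. F (k *\<^sub>C 1) (Inl (i, l)))"
    if "\<And>x. F 0 x = 0" "l < length X" for l and F :: "'a bop \<Rightarrow> nat \<times> nat + nat \<Rightarrow> 'z::comm_monoid_add"
  proof -
    have "(\<Sum>x\<in>set ?xs. F (c l x) x) = (\<Sum>i<N. \<Sum>l'<length X. F (if l = l' then k *\<^sub>C 1 else 0) (Inl (i, l')))"
      unfolding sxs by (simp add: sum.Plus c_def that(1) sum.cartesian_product case_prod_beta)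
    also have "\<dots> = (\<Sum>i<N. \<Sum>l'<length X. if l = l' then F (k *\<^sub>C 1) (Inl (i, l')) else 0)"
      by (intro sum.cong refl) (auto simp: that(1))
    finally show ?thesis using that(2) by simp
  qed
  have "lin_step E (map f ?xs) (map (\<lambda>l j. complex_of_real (sqrt N) *\<^sub>C (X ! l) j) [0..<length X])"
  proof (rule lin_step_map[where c = c])
    show "?xs \<noteq> []"
      using X N unfolding length_greater_0_conv[symmetric] length_append length_map length_product by simp
    show "distinct ?xs" by (auto simp: distinct_map distinct_product)
    show "c y x \<in> E" for y x by (auto simp: c_def E E0 split: sum.splits)
  next
    fix h :: "nat \<times> nat + nat \<Rightarrow> 'a"
    have "(\<Sum>l<length X. (norm (\<Sum>x\<in>set ?xs. bop_apply (c l x) (h x)))\<^sup>2) =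
        (\<Sum>l<length X. (norm (\<Sum>i<N. h (Inl (i, l))))\<^sup>2 / N)"
    proof (rule sum.cong[OF refl])
      fix l assume "l \<in> {..<length X}"
      then have "(\<Sum>x\<in>set ?xs. bop_apply (c l x) (h x)) = k *\<^sub>C (\<Sum>i<N. h (Inl (i, l)))"
        using sum_c[of "\<lambda>A x. bop_apply A (h x)" l]
        by (simp add: bop_rep complex_vector.scale_sum_right)
      then show "(norm (\<Sum>x\<in>set ?xs. bop_apply (c l x) (h x)))\<^sup>2 = (norm (\<Sum>i<N. h (Inl (i, l))))\<^sup>2 / N"
        by (simp add: norm_scaleC k_def norm_divide power_mult_distrib power_divide)
    qed
    also have "\<dots> \<le> (\<Sum>l<length X. \<Sum>i<N. (norm (h (Inl (i, l))))\<^sup>2)"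
    proof (rule sum_mono)
      fix l
      show "(norm (\<Sum>i<N. h (Inl (i, l))))\<^sup>2 / N \<le> (\<Sum>i<N. (norm (h (Inl (i, l))))\<^sup>2)"
        using norm_sum_sq_le[of "\<lambda>i. h (Inl (i, l))" "{..<N}"] N
        by (simp add: divide_le_eq mult.commute)
    qed
    also have "\<dots> = (\<Sum>i<N. \<Sum>l<length X. (norm (h (Inl (i, l))))\<^sup>2)" by (rule sum.swap)
    also have "\<dots> \<le> (\<Sum>x\<in>set ?xs. (norm (h x))\<^sup>2)"
      unfolding sxs by (simp add: sum.Plus sum.cartesian_product case_prod_beta sum_nonneg)
    finally show "(\<Sum>l\<in>set [0..<length X]. (norm (\<Sum>x\<in>set ?xs. bop_apply (c l x) (h x)))\<^sup>2)
        \<le> (\<Sum>x\<in>set ?xs. (norm (h x))\<^sup>2)"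
      by (simp only: set_upt atLeast0LessThan)
  next
    fix l j assume "l \<in> set [0..<length X]"
    then have "(\<Sum>x\<in>set ?xs. c l x * f x j) = (\<Sum>i<N. (k *\<^sub>C 1) * (X ! l) j)"
      using sum_c[of "\<lambda>A x. A * f x j" l] by (simp add: f_def)
    also have "\<dots> = (of_nat N * k) *\<^sub>C (X ! l) j"
      unfolding bop_scaleC_mult mult_1_left complex_vector.scale_sum_left[symmetric] by simp
    also have "of_nat N * k = complex_of_real (sqrt N)"
    proof -
      have "real N * (1 / sqrt N) = sqrt N" by (simp add: real_div_sqrt)
      moreover have "of_nat N * k = complex_of_real (real N * (1 / sqrt N))" by (simp add: k_def)
      ultimately show ?thesis by (simp only:)
    qed
    finally show "complex_of_real (sqrt N) *\<^sub>C (X ! l) j = (\<Sum>x\<in>set ?xs. c l x * f x j)" ..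
  qed (use X in auto)
  moreover have "map f ?xs = concat (replicate N X) @ Y"
  proof -
    have "map (\<lambda>(i::nat, l). X ! l) (List.product [0..<N] [0..<length X]) = concat (replicate N X)"
      using concat_rows_as_map[of "\<lambda>_ l. X ! l" "[0..<length X]" "[0..<N]"]
      by (simp add: map_nth map_replicate_const)
    then show ?thesis by (simp add: f_def comp_def map_nth)
  qed
  moreover have "map (\<lambda>l j. complex_of_real (sqrt N) *\<^sub>C (X ! l) j) [0..<length X] = smul_rows (complex_of_real (sqrt N)) X"
    by (rule nth_equalityI) simp_all
  ultimately show ?thesis by simp
qed

text \<open>The column \<open>z\<close> returned by one use of the given steps is the input of the next use, so a single copy
of \<open>z\<close> suffices for any number of uses.\<close>

lemma steps_recycle:
  assumes E: "0 \<in> E" "1 \<in> E" and one: "(lin_step E)\<^sup>+\<^sup>+ (z @ U) (P @ z)" and ne: "z \<noteq> []" "U \<noteq> []" "P \<noteq> []"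
  shows "(lin_step E)\<^sup>+\<^sup>+ (z @ concat (replicate (Suc k) U)) (concat (replicate (Suc k) P) @ z)"
proof (induction k)
  case 0 then show ?case using one by simp
next
  case (Suc k)
  let ?U = "concat (replicate (Suc k) U)" and ?P = "concat (replicate (Suc k) P)"
  have "(lin_step E)\<^sup>+\<^sup>+ ((z @ U) @ ?U) ((P @ z) @ ?U)"
    by (rule steps_append[OF E one steps_refl[OF E]]) (use ne in simp)
  also have "(P @ z) @ ?U = P @ (z @ ?U)" by simp
  also have "(lin_step E)\<^sup>+\<^sup>+ (P @ (z @ ?U)) (P @ (?P @ z))"
    by (rule steps_append[OF E steps_refl[OF E ne(3)] Suc.IH])
  finally show ?case by simp
qed

lemma lin_step_smul:
  assumes E: "\<And>c. c *\<^sub>C 1 \<in> E" and "X \<noteq> []" and c: "\<bar>c\<bar> \<le> 1"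
  shows "lin_step E X (smul_rows (complex_of_real c) X)"
  using lin_step_copies[of E X "[c]"] assms by (simp add: abs_square_le_1)

text \<open>Every list of rows that can be reached separately can be reached jointly up to a scalar, at the price
of splitting \<open>X\<close> into two copies of norm \<open>1 / \<surd>2\<close>.  The copy of \<open>X\<close> at the end lets the induction start
from the empty list although steps only relate nonempty lists.\<close>

lemma steps_reach_list:
  assumes E: "\<And>c. c *\<^sub>C 1 \<in> E" and X: "X \<noteq> []"
    and "\<And>y. y \<in> set z \<Longrightarrow> \<exists>\<eta>. 0 < \<eta> \<and> \<eta> \<le> 1 \<and> (lin_step E)\<^sup>+\<^sup>+ X (smul_rows (complex_of_real \<eta>) [y])"
  shows "\<exists>\<eta>. 0 < \<eta> \<and> \<eta> \<le> 1 \<and> (lin_step E)\<^sup>+\<^sup>+ X (smul_rows (complex_of_real \<eta>) (z @ X))"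
  using assms(3)
proof (induction z)
  case Nil
  have "0 \<in> E" "1 \<in> E" using E[of 0] E[of 1] by (simp_all add: scaleC_one)
  then show ?case using X by (intro exI[of _ 1]) (simp add: scaleC_one steps_refl)
next
  case (Cons y z)
  have E01: "0 \<in> E" "1 \<in> E" using E[of 0] E[of 1] by (simp_all add: scaleC_one)
  obtain \<eta>1 where 1: "0 < \<eta>1" "\<eta>1 \<le> 1" "(lin_step E)\<^sup>+\<^sup>+ X (smul_rows (complex_of_real \<eta>1) [y])"
    using Cons.prems[of y] by auto
  obtain \<eta>2 where 2: "0 < \<eta>2" "\<eta>2 \<le> 1" "(lin_step E)\<^sup>+\<^sup>+ X (smul_rows (complex_of_real \<eta>2) (z @ X))"
    using Cons.IH Cons.prems by auto
  define s where "s = 1 / sqrt 2"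
  have s: "0 < s" "s \<le> 1" "s\<^sup>2 + s\<^sup>2 \<le> 1" by (simp_all add: s_def power_divide)
  have shrink: "(lin_step E)\<^sup>+\<^sup>+ X (smul_rows (complex_of_real (c * d)) Z)"
    if "(lin_step E)\<^sup>+\<^sup>+ X (smul_rows (complex_of_real d) Z)" "0 < c" "c \<le> 1" for c d Z
  proof -
    have "lin_step E (smul_rows (complex_of_real d) Z) (smul_rows (complex_of_real c) (smul_rows (complex_of_real d) Z))"
      by (rule lin_step_smul[OF E]) (use that lin_step_nonempty[OF that(1)] in auto)
    then show ?thesis
      unfolding smul_rows_smul_rows of_real_mult by (rule tranclp.trancl_into_trancl[OF that(1)])
  qed
  have a: "(lin_step E)\<^sup>+\<^sup>+ X (smul_rows (complex_of_real (\<eta>1 * \<eta>2)) [y])"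
    using shrink[OF 1(3) 2(1,2)] by (simp only: mult.commute)
  have b: "(lin_step E)\<^sup>+\<^sup>+ X (smul_rows (complex_of_real (\<eta>1 * \<eta>2)) (z @ X))"
    by (rule shrink[OF 2(3) 1(1,2)])
  have "lin_step E X (smul_rows (complex_of_real s) X @ smul_rows (complex_of_real s) X)"
    using lin_step_copies[OF E X, of "[s, s]"] s by simp
  then have "(lin_step E)\<^sup>+\<^sup>+ X (smul_rows (complex_of_real s) X @ smul_rows (complex_of_real s) X)"
    by (rule tranclp.r_into_trancl)
  also have "(lin_step E)\<^sup>+\<^sup>+ (smul_rows (complex_of_real s) X @ smul_rows (complex_of_real s) X)
      (smul_rows (complex_of_real s) (smul_rows (complex_of_real (\<eta>1 * \<eta>2)) [y]) @
        smul_rows (complex_of_real s) (smul_rows (complex_of_real (\<eta>1 * \<eta>2)) (z @ X)))"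
    by (rule steps_append[OF E01 steps_scale[OF a] steps_scale[OF b]])
  also have "\<dots> = smul_rows (complex_of_real (s * (\<eta>1 * \<eta>2))) ((y # z) @ X)"
    unfolding smul_rows_smul_rows of_real_mult by simp
  finally show ?case
    using s 1 2 by (intro exI[of _ "s * (\<eta>1 * \<eta>2)"]) (simp add: mult_le_one)
qed

lemma steps_word_row:
  assumes E: "\<And>c. c *\<^sub>C 1 \<in> E" and w: "\<And>u. u \<in> set w \<Longrightarrow> u \<in> E \<and> unitary_op u" and j: "j < m"
  shows "(lin_step E)\<^sup>+\<^sup>+ (map (\<lambda>i. word_row ([], i)) [0..<m]) [word_row (w, j)]"
  using w
proof (induction w)
  case Nil
  have E01: "0 \<in> E" "1 \<in> E" using E[of 0] E[of 1] by (simp_all add: scaleC_one)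
  have "lin_step E (map (\<lambda>i. word_row ([], i) :: nat \<Rightarrow> 'a bop) [0..<m]) (map (\<lambda>i. word_row ([], i)) [j])"
  proof (rule lin_step_map[where c = "\<lambda>y x. if y = x then 1 else 0"])
    fix h :: "nat \<Rightarrow> 'a"
    have "(\<Sum>x<m. bop_apply (if j = x then 1 else 0) (h x)) = (\<Sum>x<m. if j = x then h x else 0)"
      by (rule sum.cong) (auto simp: bop_rep)
    also have "\<dots> = h j" using j by simp
    finally show "(\<Sum>y\<in>set [j]. (norm (\<Sum>x\<in>set [0..<m]. bop_apply (if y = x then 1 else 0) (h x)))\<^sup>2)
        \<le> (\<Sum>x\<in>set [0..<m]. (norm (h x))\<^sup>2)"
      using j member_le_sum[of j "{..<m}" "\<lambda>x. (norm (h x))\<^sup>2"] by (simp add: atLeast0LessThan)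
  next
    fix y i assume "y \<in> set [j]"
    then show "word_row ([], y) i = (\<Sum>x\<in>set [0..<m]. (if y = x then 1 else 0) * (word_row ([], x) i :: 'a bop))"
      using j by (simp add: if_distrib[of "\<lambda>x. x * _"] cong: if_cong)
  qed (use j E01 in auto)
  then show ?case by (simp add: tranclp.r_into_trancl)
next
  case (Cons u w)
  have IH: "(lin_step E)\<^sup>+\<^sup>+ (map (\<lambda>i. word_row ([], i)) [0..<m]) [word_row (w, j)]"
    by (rule Cons.IH) (use Cons.prems in auto)
  have u: "u \<in> E" "unitary_op u" using Cons.prems by auto
  have "lin_step E (map (\<lambda>_. word_row (w, j)) [0::nat]) (map (\<lambda>_. word_row (u # w, j)) [0::nat])"
    by (rule lin_step_map[where c = "\<lambda>_ _. u"]) (use u in \<open>auto simp: norm_unitary word_row_def\<close>)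
  then show ?case using tranclp.trancl_into_trancl[OF IH] by simp
qed

section \<open>Polynomials and the factorization\<close>

definition words :: "'b set \<Rightarrow> nat \<Rightarrow> 'b list set" where
  "words G d = {w. set w \<subseteq> G \<and> length w \<le> d}"

lemma finite_words: "finite G \<Longrightarrow> finite (words G d)"
  unfolding words_def by (rule finite_lists_length_le)

lemma words_sum_extend:
  assumes "finite G" "d \<le> d'"
  shows "\<exists>c'. (\<Sum>w\<in>words G d. c w *\<^sub>C prod_list w) = (\<Sum>w\<in>words G d'. c' w *\<^sub>C (prod_list w :: 'a::chilbert_space bop))"
proof (intro exI[of _ "\<lambda>w. if length w \<le> d then c w else 0"] sum.mono_neutral_cong_left)
  show "finite (words G d')" by (rule finite_words[OF assms(1)])
qed (use assms(2) in \<open>auto simp: words_def\<close>)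

text \<open>Words of bounded length form a finite set that is closed under removing the first letter, and bounds
for the entries of a matrix have a common upper bound; this gives the index set of the column of words.\<close>

lemma cspan_words:
  assumes G: "finite (G :: 'a::chilbert_space bop set)" and A: "A \<in> cspan (\<Union>d. prod_list ` words G d)"
  shows "\<exists>d c. A = (\<Sum>w\<in>words G d. c w *\<^sub>C prod_list w)"
  using A
proof (induction rule: complex_vector.span_induct_alt)
  case base
  show ?case by (rule exI[of _ 0], rule exI[of _ "\<lambda>_. 0"]) simp
next
  case (step c B A)
  obtain d v where v: "B = prod_list v" "v \<in> words G d" using step.hyps by blast
  obtain d' c' where A: "A = (\<Sum>w\<in>words G d'. c' w *\<^sub>C prod_list w)" using step.IH by blast
  obtain c1 where c1: "A = (\<Sum>w\<in>words G (max d d'). c1 w *\<^sub>C prod_list w)"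
    using words_sum_extend[OF G, of d' "max d d'" c'] A by auto
  have v': "v \<in> words G (max d d')" using v(2) by (auto simp: words_def)
  have "(\<Sum>w\<in>words G (max d d'). (if w = v then c else 0) *\<^sub>C prod_list w) =
      (\<Sum>w\<in>words G (max d d'). if w = v then c *\<^sub>C prod_list w else 0)"
    by (rule sum.cong) auto
  also have "\<dots> = c *\<^sub>C B" using v' finite_words[OF G] by (simp add: v(1))
  finally have "c *\<^sub>C B + A = (\<Sum>w\<in>words G (max d d'). ((if w = v then c else 0) + c1 w) *\<^sub>C prod_list w)"
    unfolding c1 by (simp add: scaleC_add_left sum.distrib)
  then show ?case by (intro exI[of _ "max d d'"] exI[of _ "\<lambda>w. (if w = v then c else 0) + c1 w"])
qed

theorem theorem1:
  fixes x :: "'i \<Rightarrow> 'a::chilbert_space bop" and J :: "'i set" and P :: "'a bop mat"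
  assumes "finite J"
    and "\<And>j. j \<in> J \<Longrightarrow> unitary_op (x j)"
    and "P \<in> mats_over (polys J x)"
    and "mat_opnorm P < 1"
  shows "\<exists>Ps. Ps \<noteq> [] \<and> composable Ps \<and> P = mat_prod Ps \<and>
    (\<forall>Q \<in> set Ps. Q \<in> mats_over (polys_deg J x 1) \<and> mat_opnorm Q < 1)"
proof -
  define G where "G = {1} \<union> x ` J \<union> (\<lambda>j. adj (x j)) ` J"
  define E where "E = polys_deg J x 1"
  have mono: "monomials J x d = prod_list ` words G d" for d
    by (auto simp: monomials_def words_def G_def)
  have finG: "finite G" using assms(1) by (simp add: G_def)
  have uG: "unitary_op u" if "u \<in> G" for u
    using that assms(2) by (auto simp: G_def unitary_1 unitary_adj)
  have adjG: "adj u \<in> G" if "u \<in> G" for u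
    using that by (auto simp: G_def adj_1 adj_adj)
  have GE: "u \<in> E" if "u \<in> G" for u
  proof -
    have "u \<in> prod_list ` words G 1"
      using that by (intro image_eqI[of _ _ "[u]"]) (simp_all add: words_def)
    then show ?thesis by (simp add: E_def polys_deg_def mono complex_vector.span_base)
  qed
  have E_add: "A + B \<in> E" if "A \<in> E" "B \<in> E" for A B
    using that by (simp add: E_def polys_deg_def complex_vector.span_add)
  have E_scale: "c *\<^sub>C A \<in> E" if "A \<in> E" for c A
    using that by (simp add: E_def polys_deg_def complex_vector.span_scale)
  have E1: "1 \<in> E" by (rule GE) (simp add: G_def)
  have E0: "0 \<in> E" using E_scale[OF E1, of 0] by simp
  have Ec: "c *\<^sub>C 1 \<in> E" for c by (rule E_scale[OF E1])
  define n m where "n = dim_row P" and "m = dim_col P"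
  have nm: "0 < n" "0 < m" using assms(3) by (auto simp: mats_over_def n_def m_def)
  have "\<exists>d c. P $$ (r, j) = (\<Sum>w\<in>words G d. c w *\<^sub>C prod_list w)" if "r < n" "j < m" for r j
  proof (rule cspan_words[OF finG])
    have "P $$ (r, j) \<in> elements_mat P" using that by (auto simp: n_def m_def)
    then show "P $$ (r, j) \<in> cspan (\<Union>d. prod_list ` words G d)"
      using assms(3) by (auto simp: mats_over_def polys_def mono)
  qed
  then obtain dd where dd: "\<And>r j. r < n \<Longrightarrow> j < m \<Longrightarrow> \<exists>c. P $$ (r, j) = (\<Sum>w\<in>words G (dd r j). c w *\<^sub>C prod_list w)"
    by metis
  define d where "d = (\<Sum>r<n. \<Sum>j<m. dd r j)"
  have "\<exists>c. P $$ (r, j) = (\<Sum>w\<in>words G d. c w *\<^sub>C prod_list w)" if "r < n" "j < m" for r j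
  proof -
    have "dd r j \<le> (\<Sum>j<m. dd r j)" using that by (intro member_le_sum) auto
    also have "\<dots> \<le> d" unfolding d_def
      using that member_le_sum[of r "{..<n}" "\<lambda>r. \<Sum>j<m. dd r j"] by auto
    finally have le: "dd r j \<le> d" .
    from dd[OF that] obtain c where "P $$ (r, j) = (\<Sum>w\<in>words G (dd r j). c w *\<^sub>C prod_list w)"
      by blast
    then show ?thesis using words_sum_extend[OF finG le, of c] by simp
  qed
  then have ex: "\<exists>c. r < n \<longrightarrow> j < m \<longrightarrow> P $$ (r, j) = (\<Sum>w\<in>words G d. c w *\<^sub>C prod_list w)" for r j
    by blast
  define cf where "cf r j = (SOME c. r < n \<longrightarrow> j < m \<longrightarrow> P $$ (r, j) = (\<Sum>w\<in>words G d. c w *\<^sub>C prod_list w))" for r j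
  have cf: "P $$ (r, j) = (\<Sum>w\<in>words G d. cf r j w *\<^sub>C prod_list w)" if "r < n" "j < m" for r j
    using someI_ex[OF ex[of r j]] that unfolding cf_def by blast
  \<comment> \<open>The matrix \<open>P / b\<close> is a contraction.  The factor \<open>b < 1\<close> is split between the slack \<open>\<epsilon>\<close>, with
    \<open>b\<^sup>2 (1 + \<epsilon>) = b\<close>, and the cost of the auxiliary column.\<close>
  define b where "b = (1 + max 0 (mat_opnorm P)) / 2"
  have b: "0 < b" "b < 1" "mat_opnorm P \<le> b" using assms(4) by (auto simp: b_def max_def)
  define I where "I = words G d \<times> {..<m}"
  define p where "p r t = complex_of_real (1 / b) * cf r (snd t) (fst t)" for r t
  interpret word_system I m
  proof
    show "finite I" by (simp add: I_def finite_words[OF finG])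
    show "(w, j) \<in> I" if "(u # w, j) \<in> I" for u w j using that by (auto simp: I_def words_def)
    show "j < m \<longleftrightarrow> ([], j) \<in> I" for j by (auto simp: I_def words_def)
    show "unitary_op u" if "(u # w, j) \<in> I" for u w j using that uG by (auto simp: I_def words_def)
  qed
  have letterG: "letter t \<in> G" if "t \<in> N" for t
    using N_cases[OF that] by (auto simp: I_def words_def letter_def)
  have p_sum: "(\<Sum>t\<in>I. p r t *\<^sub>C F (prod_list (fst t)) (snd t)) =
      complex_of_real (1 / b) *\<^sub>C (\<Sum>j<m. \<Sum>w\<in>words G d. cf r j w *\<^sub>C F (prod_list w) j)"
    for r and F :: "'a bop \<Rightarrow> nat \<Rightarrow> 'v::complex_vector"
  proof -
    have "(\<Sum>t\<in>I. p r t *\<^sub>C F (prod_list (fst t)) (snd t)) =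
        (\<Sum>w\<in>words G d. \<Sum>j<m. complex_of_real (1 / b) *\<^sub>C cf r j w *\<^sub>C F (prod_list w) j)"
      unfolding I_def sum.cartesian_product by (simp add: p_def scaleC_scaleC case_prod_beta)
    also have "\<dots> = (\<Sum>j<m. \<Sum>w\<in>words G d. complex_of_real (1 / b) *\<^sub>C cf r j w *\<^sub>C F (prod_list w) j)"
      by (rule sum.swap)
    finally show ?thesis unfolding complex_vector.scale_sum_right .
  qed
  have contr: "(\<Sum>r<n. (norm (\<Sum>t\<in>I. p r t *\<^sub>C bop_apply (prod_list (fst t)) (h (snd t))))\<^sup>2)
        \<le> (\<Sum>j<m. (norm (h j))\<^sup>2)" for h :: "nat \<Rightarrow> 'a"
  proof -
    have "(\<Sum>t\<in>I. p r t *\<^sub>C bop_apply (prod_list (fst t)) (h (snd t))) =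
        complex_of_real (1 / b) *\<^sub>C (\<Sum>j<m. bop_apply (P $$ (r, j)) (h j))" if "r < n" for r
      using that unfolding p_sum[of r "\<lambda>A j. bop_apply A (h j)"]
      by (simp add: cf bop_apply_sum_left bop_rep)
    then have "(\<Sum>r<n. (norm (\<Sum>t\<in>I. p r t *\<^sub>C bop_apply (prod_list (fst t)) (h (snd t))))\<^sup>2) =
        (\<Sum>r<n. (norm (\<Sum>j<m. bop_apply (P $$ (r, j)) (h j)))\<^sup>2) / b\<^sup>2"
      unfolding sum_divide_distrib using b
      by (intro sum.cong) (simp_all add: norm_scaleC norm_divide power_mult_distrib power_divide)
    also have "\<dots> \<le> ((mat_opnorm P)\<^sup>2 * (\<Sum>j<m. (norm (h j))\<^sup>2)) / b\<^sup>2"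
      using mat_opnorm_bound[of P h] by (intro divide_right_mono) (simp_all add: n_def m_def)
    also have "\<dots> \<le> (b\<^sup>2 * (\<Sum>j<m. (norm (h j))\<^sup>2)) / b\<^sup>2"
    proof -
      have "0 \<le> mat_opnorm P"
      proof -
        have "dsum_norm (mat_apply P (vec m (\<lambda>_. 0))) \<le> mat_opnorm P"
          unfolding mat_opnorm_def
          by (intro cSUP_upper mat_opnorm_bdd_above) (simp add: m_def dsum_norm_def L2_set_def)
        moreover have "0 \<le> dsum_norm (mat_apply P (vec m (\<lambda>_. 0)))" by (simp add: dsum_norm_def)
        ultimately show ?thesis by linarith
      qed
      then have "(mat_opnorm P)\<^sup>2 \<le> b\<^sup>2" using b by (intro power_mono)
      then show ?thesis by (intro divide_right_mono mult_right_mono) (simp_all add: sum_nonneg)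
    qed
    finally show ?thesis using b by simp
  qed
  define \<epsilon> where "\<epsilon> = 1 / b - 1"
  have \<epsilon>: "\<epsilon> > 0" "b\<^sup>2 * (1 + \<epsilon>) = b" using b by (simp_all add: \<epsilon>_def field_simps power2_eq_square)
  define us where "us = map (\<lambda>i. word_row ([], i) :: nat \<Rightarrow> 'a bop) [0..<m]"
  define Pr where "Pr = map (\<lambda>r j. \<Sum>t\<in>I. p r t *\<^sub>C (word_row t j :: 'a bop)) [0..<n]"
  obtain z where zne: "z \<noteq> []" and z: "\<And>y. y \<in> set z \<Longrightarrow> \<exists>c. \<exists>t\<in>I. y = (\<lambda>j. c *\<^sub>C word_row t j)"
    and recycle: "(lin_step E)\<^sup>+\<^sup>+ (z @ smul_rows (complex_of_real (sqrt (1 + \<epsilon>))) us) (Pr @ z)"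
  proof (rule recycling_step[OF contr \<epsilon>(1) nm(2) E0 E1 E_add E_scale])
    show "letter t \<in> E" "adj (letter t) \<in> E" if "t \<in> N" for t
      using letterG[OF that] adjG GE by blast+
  qed (auto simp: us_def Pr_def comp_def)
  have us: "us \<noteq> []" and Pr: "Pr \<noteq> []" using nm by (simp_all add: us_def Pr_def)
  have reach: "\<exists>\<eta>. 0 < \<eta> \<and> \<eta> \<le> 1 \<and> (lin_step E)\<^sup>+\<^sup>+ us (smul_rows (complex_of_real \<eta>) [y])" if "y \<in> set z" for y
  proof -
    from z[OF that] obtain c w j where y: "y = (\<lambda>i. c *\<^sub>C word_row (w, j) i)" "(w, j) \<in> I" by auto
    have "(lin_step E)\<^sup>+\<^sup>+ us [word_row (w, j)]" unfolding us_def
      by (rule steps_word_row[OF Ec]) (use y(2) GE uG in \<open>auto simp: I_def words_def\<close>)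
    moreover define \<eta> where "\<eta> = 1 / (1 + cmod c)"
    have \<eta>: "0 < \<eta>" "\<eta> \<le> 1" "\<eta> * cmod c \<le> 1"
      by (simp_all add: \<eta>_def add_pos_nonneg divide_le_eq)
    have "lin_step E (map (\<lambda>_. word_row (w, j)) [0::nat]) (map (\<lambda>_ i. complex_of_real \<eta> *\<^sub>C y i) [0::nat])"
    proof (rule lin_step_map[where c = "\<lambda>_ _. (complex_of_real \<eta> * c) *\<^sub>C 1"])
      fix h :: "nat \<Rightarrow> 'a"
      have "(norm ((complex_of_real \<eta> * c) *\<^sub>C h 0))\<^sup>2 \<le> (1 * norm (h 0))\<^sup>2"
        unfolding norm_scaleC using \<eta> by (intro power_mono mult_right_mono) (simp_all add: norm_mult)
      then show "(\<Sum>y\<in>set [0::nat]. (norm (\<Sum>x\<in>set [0]. bop_apply ((complex_of_real \<eta> * c) *\<^sub>C 1) (h x)))\<^sup>2)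
          \<le> (\<Sum>x\<in>set [0]. (norm (h x))\<^sup>2)" by (simp add: bop_rep)
    qed (simp_all add: Ec y(1) bop_scaleC_mult scaleC_scaleC)
    ultimately show ?thesis using \<eta> by (intro exI[of _ \<eta>]) (auto intro: tranclp.trancl_into_trancl)
  qed
  obtain \<eta> where \<eta>: "0 < \<eta>" "\<eta> \<le> 1" and zs: "(lin_step E)\<^sup>+\<^sup>+ us (smul_rows (complex_of_real \<eta>) (z @ us))"
    using steps_reach_list[OF Ec us reach] by blast
  \<comment> \<open>The input consists of \<open>\<theta> / \<eta>\<close> times the unit rows, from which \<open>\<theta> z\<close> is produced, and of \<open>M\<close> copies
    of \<open>\<theta> e\<close>; the number \<open>\<theta>\<close> makes this a contraction, and \<open>k\<close> is chosen such that \<open>b < \<theta> \<surd>M\<close>.\<close>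
  obtain k :: nat where k: "b\<^sup>2 / (\<eta>\<^sup>2 * (1 - b)) < real k" using reals_Archimedean2 by blast
  define M where "M = Suc k"
  define \<theta> where "\<theta> = 1 / sqrt (1 / \<eta>\<^sup>2 + M * (1 + \<epsilon>))"
  have pos: "0 < 1 / \<eta>\<^sup>2 + M * (1 + \<epsilon>)" using \<eta> \<epsilon> by (intro add_pos_nonneg) auto
  have \<theta>: "0 < \<theta>" "\<theta>\<^sup>2 * (1 / \<eta>\<^sup>2 + M * (1 + \<epsilon>)) = 1"
    using pos by (simp_all add: \<theta>_def power_divide)
  define as where "as = \<theta> / \<eta> # replicate M (\<theta> * sqrt (1 + \<epsilon>))"
  have as: "(\<Sum>a\<leftarrow>as. a\<^sup>2) \<le> 1"
  proof -
    have "(\<Sum>a\<leftarrow>as. a\<^sup>2) = (\<theta> / \<eta>)\<^sup>2 + M * (\<theta> * sqrt (1 + \<epsilon>))\<^sup>2"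
      by (simp add: as_def sum_list_replicate)
    also have "\<dots> = \<theta>\<^sup>2 * (1 / \<eta>\<^sup>2 + M * (1 + \<epsilon>))"
      using \<epsilon> by (simp add: power_mult_distrib power_divide algebra_simps)
    finally show ?thesis using \<theta> by simp
  qed
  define e where "e = smul_rows (complex_of_real (sqrt (1 + \<epsilon>))) us"
  let ?t = "complex_of_real \<theta>"
  have "concat (map (\<lambda>a. smul_rows (complex_of_real a) us) as) =
      smul_rows (complex_of_real (\<theta> / \<eta>)) us @ smul_rows ?t (concat (replicate M e))"
    by (simp add: as_def e_def map_concat map_replicate comp_def scaleC_scaleC)
  then have "(lin_step E)\<^sup>+\<^sup>+ us (smul_rows (complex_of_real (\<theta> / \<eta>)) us @ smul_rows ?t (concat (replicate M e)))"
    using lin_step_copies[OF Ec us _ as] by (simp add: as_def tranclp.r_into_trancl)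
  also have "(lin_step E)\<^sup>+\<^sup>+ (smul_rows (complex_of_real (\<theta> / \<eta>)) us @ smul_rows ?t (concat (replicate M e)))
      (smul_rows ?t z @ smul_rows ?t (concat (replicate M e)))"
  proof (rule steps_append[OF E0 E1])
    have "(lin_step E)\<^sup>+\<^sup>+ (smul_rows (complex_of_real (\<theta> / \<eta>)) us)
        (smul_rows (complex_of_real (\<theta> / \<eta>)) (smul_rows (complex_of_real \<eta>) (z @ us)))"
      by (rule steps_scale[OF zs])
    also have "\<dots> = smul_rows ?t z @ smul_rows ?t us"
      unfolding smul_rows_smul_rows of_real_mult[symmetric] using \<eta> by simp
    finally show "(lin_step E)\<^sup>+\<^sup>+ (smul_rows (complex_of_real (\<theta> / \<eta>)) us) (smul_rows ?t z)"
      by (rule tranclp.trancl_into_trancl) (rule lin_step_take[OF E0 E1], use zne in simp)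
    show "(lin_step E)\<^sup>+\<^sup>+ (smul_rows ?t (concat (replicate M e))) (smul_rows ?t (concat (replicate M e)))"
      by (rule steps_refl[OF E0 E1]) (use us in \<open>simp add: M_def e_def\<close>)
  qed
  also have "\<dots> = smul_rows ?t (z @ concat (replicate M e))" by simp
  also have "(lin_step E)\<^sup>+\<^sup>+ \<dots> (smul_rows ?t (concat (replicate M Pr) @ z))"
    unfolding M_def
    by (rule steps_scale[OF steps_recycle[OF E0 E1 recycle[folded e_def] zne _ Pr]])
      (use us in \<open>simp add: e_def\<close>)
  also have "(lin_step E)\<^sup>+\<^sup>+ \<dots> (smul_rows ?t (smul_rows (complex_of_real (sqrt M)) Pr))"
    by (rule steps_scale, rule tranclp.r_into_trancl, rule lin_step_average[OF Ec Pr]) (simp add: M_def)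
  finally have total: "(lin_step E)\<^sup>+\<^sup>+ us (smul_rows (complex_of_real (\<theta> * sqrt M)) Pr)"
    unfolding smul_rows_smul_rows of_real_mult .
  define r where "r = b / (\<theta> * sqrt M)"
  have r: "0 \<le> r" "r < 1"
  proof -
    have M: "0 < real M" by (simp add: M_def)
    show "0 \<le> r" using b \<theta> by (simp add: r_def)
    have "b\<^sup>2 < \<theta>\<^sup>2 * M"
    proof -
      have "b\<^sup>2 / \<eta>\<^sup>2 < M * (1 - b)"
      proof -
        have "0 < \<eta>\<^sup>2 * (1 - b)" using \<eta> b by simp
        moreover have "b\<^sup>2 / (\<eta>\<^sup>2 * (1 - b)) < real M" using k by (simp add: M_def)
        ultimately have "b\<^sup>2 < real M * (1 - b) * \<eta>\<^sup>2" by (simp add: pos_divide_less_eq mult_ac)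
        then show ?thesis using \<eta> by (simp add: pos_divide_less_eq)
      qed
      then have "b\<^sup>2 * (1 / \<eta>\<^sup>2) + M * (b\<^sup>2 * (1 + \<epsilon>)) < M" unfolding \<epsilon>(2) by (simp add: algebra_simps)
      then have "b\<^sup>2 * (1 / \<eta>\<^sup>2 + M * (1 + \<epsilon>)) < M" by (simp add: algebra_simps)
      then have "\<theta>\<^sup>2 * (b\<^sup>2 * (1 / \<eta>\<^sup>2 + M * (1 + \<epsilon>))) < \<theta>\<^sup>2 * M" using \<theta> by simp
      moreover have "\<theta>\<^sup>2 * (b\<^sup>2 * (1 / \<eta>\<^sup>2 + M * (1 + \<epsilon>))) = b\<^sup>2"
        using \<theta>(2) by (metis mult.left_commute mult.right_neutral)
      ultimately show ?thesis by simp
    qed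
    also have "\<dots> = (\<theta> * sqrt M)\<^sup>2" using M by (simp add: power_mult_distrib)
    finally have "b < \<theta> * sqrt M" by (rule power2_less_imp_less) (use \<theta> in simp)
    then show "r < 1" using \<theta> M by (simp add: r_def divide_less_eq)
  qed
  obtain Ps where Ps: "Ps \<noteq> []" "composable Ps" "\<forall>Q\<in>set Ps. Q \<in> mats_over E \<and> mat_opnorm Q < 1"
    "mat_prod Ps \<in> carrier_mat n m"
    "mat n m (\<lambda>(i, j). complex_of_real r *\<^sub>C (smul_rows (complex_of_real (\<theta> * sqrt M)) Pr ! i) j) =
      mat_prod Ps * mat m m (\<lambda>(i, j). (us ! i) j)"
    using steps_factor[OF total E_scale r] by (auto simp: us_def Pr_def)
  have "mat_prod Ps * mat m m (\<lambda>(i, j). (us ! i) j) = mat_prod Ps"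
    using Ps(4) by (intro eq_matI)
      (auto simp: us_def word_row_def scalar_prod_def if_distrib[of "\<lambda>x. _ * x"] cong: if_cong)
  moreover have "mat n m (\<lambda>(i, j). complex_of_real r *\<^sub>C (smul_rows (complex_of_real (\<theta> * sqrt M)) Pr ! i) j) = P"
  proof (rule eq_matI)
    fix i j assume "i < dim_row P" "j < dim_col P"
    then have ij: "i < n" "j < m" by (simp_all add: n_def m_def)
    have rb: "complex_of_real r * complex_of_real (\<theta> * sqrt M) * complex_of_real (1 / b) = 1"
      unfolding of_real_mult[symmetric] using b \<theta> by (simp add: r_def M_def)
    have "(\<Sum>t\<in>I. p i t *\<^sub>C word_row t j) = complex_of_real (1 / b) *\<^sub>C
        (\<Sum>j'<m. \<Sum>w\<in>words G d. cf i j' w *\<^sub>C (if j = j' then prod_list w else 0))"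
      using p_sum[of i "\<lambda>A j'. if j = j' then A else 0"] by (simp only: word_row_def)
    also have "(\<Sum>j'<m. \<Sum>w\<in>words G d. cf i j' w *\<^sub>C (if j = j' then prod_list w else 0)) =
        (\<Sum>j'<m. if j = j' then P $$ (i, j') else 0)"
      by (rule sum.cong) (use ij in \<open>auto simp: cf\<close>)
    also have "\<dots> = P $$ (i, j)" using ij by simp
    finally show "mat n m (\<lambda>(i, j). complex_of_real r *\<^sub>C
        (smul_rows (complex_of_real (\<theta> * sqrt M)) Pr ! i) j) $$ (i, j) = P $$ (i, j)"
      using ij rb by (simp add: Pr_def scaleC_scaleC scaleC_one)
  qed (simp_all add: n_def m_def)
  ultimately have "P = mat_prod Ps" using Ps(5) by simp
  then show ?thesis using Ps(1,2,3) unfolding E_def by blast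
qed

end
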